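(* Let $\mathcal S$ be a semispray on $\mathcal M$, $\mathcal J$ the almost tangent structure on $\mathbf T\mathcal M$ compatible with $\mathcal S$, $\mathcal C=\mathcal J\mathcal S$, and let $\Omega$ be a semi-Hamiltonian almost cotangent structure on $\mathbf T\mathcal M$. Then the nonlinear connection $\mathcal N_{\mathcal S}=-\mathcal L^{\mathcal P}_{\mathcal S}\mathcal J$ is Lagrangian (relative to $\Omega$) and $g_\Omega$-metric (relative to $\mathcal S$) if and only if around any point $m\in\mathcal M$ there exists a semi-basic $1$-form $\xi$ such that $d^{\mathcal P}\xi$ is semi-basic and $$i_{\mathcal S}\Omega=d^{\mathcal P}\big(\mathcal L^{\mathcal P}_{\mathcal C}(L)-L\big)+\xi ,$$ where $L$ is a local function around $m$ such that $\Omega=-d^{\mathcal P}(\mathcal J^*d^{\mathcal P}L)$. In this case $\mathcal N_{\mathcal S}$ is the unique nonlinear connection which is $g_\Omega$-metric and Lagrangian.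
   Context: Prolongation. $M$ is a connected paracompact smooth manifold; $\tau:\mathcal A\to M$ is a rank $k$ vector bundle with anchor $\rho:\mathcal A\to TM$ and an almost Lie bracket $[\,,\,]_{\mathcal A}$ (antisymmetric, $\mathbb R$-bilinear, $[X,fY]_{\mathcal A}=f[X,Y]_{\mathcal A}+df(\rho X)Y$) with $\rho[X,Y]_{\mathcal A}=[\rho X,\rho Y]$ (a pre-Lie algebroid; no Jacobi identity). $\pi:\mathcal M\to M$ is a fibered manifold with connected typical fiber of dimension $k$. $\mathbf T\mathcal M\to\mathcal M$ is the vector bundle with fiber $\{(b,v)\in\mathcal A_{\pi(m)}\times T_m\mathcal M:\rho(b)=T\pi(v)\}$ at $m$, with anchor $\hat\rho(m,b,v)=v$; $\mathbf V\mathcal M=\{(m,0,v)\}$ is the vertical subbundle. Given coordinates $(x^i,y^\alpha)$ adapted to $\pi$ and a local frame $(e_\alpha)$ of $\mathcal A$ with $\rho(e_\alpha)=\rho_\alpha^i\partial_{x^i}$, $[e_\alpha,e_\beta]_{\mathcal A}=C_{\alpha\beta}^\gamma e_\gamma$, the canonical basis is $\mathcal X_\alpha=(e_\alpha,\rho_\alpha^i\partial_{x^i})$, $\mathcal V_\alpha=(0,\partial_{y^\alpha})$. The almost Lie bracket $[\,,\,]_{\mathcal P}$ on $(\mathbf T\mathcal M,\mathcal M,\hat\rho)$ is determined by $[\mathcal X_\alpha,\mathcal X_\beta]_{\mathcal P}=C_{\alpha\beta}^\gamma\mathcal X_\gamma$, $[\mathcal X_\alpha,\mathcal V_\beta]_{\mathcal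 P}=[\mathcal V_\alpha,\mathcal V_\beta]_{\mathcal P}=0$. $d^{\mathcal P}f=df\circ\hat\rho$ and $d^{\mathcal P}\eta(\mathcal X,\mathcal Y)=\hat\rho(\mathcal X)\eta(\mathcal Y)-\hat\rho(\mathcal Y)\eta(\mathcal X)-\eta([\mathcal X,\mathcal Y]_{\mathcal P})$ for $1$-forms $\eta$ (sections of $(\mathbf T\mathcal M)^*$). $\mathcal L^{\mathcal P}_{\mathcal X}f=\hat\rho(\mathcal X)f$; $(\mathcal L^{\mathcal P}_{\mathcal S}I)(\mathcal X)=[\mathcal S,I\mathcal X]_{\mathcal P}-I[\mathcal S,\mathcal X]_{\mathcal P}$ for an endomorphism $I$. A form on $\mathbf T\mathcal M$ is semi-basic if its contraction with every vertical section vanishes. Structures. An almost tangent structure is an endomorphism $\mathcal J$ of $\mathbf T\mathcal M$ with $\operatorname{im}\mathcal J=\ker\mathcal J=\mathbf V\mathcal M$; $\mathcal J^*\eta=\eta\circ\mathcal J$. A semispray is a global section $\mathcal S$ of $\mathbf T\mathcal M$ such that for local frames $(\mathcal V_\alpha)$ of $\mathbf V\mathcal M$ the $\mathcal V_\alpha$ and $[\mathcal S,\mathcal V_\alpha]_{\mathcal P}$ span $\mathbf T\mathcal M$; it has a unique compatible almost tangent structure $\mathcal J$, i.e. with $\mathcal J[\mathcal S,\mathcal V]_{\mathcal P}=-\mathcal V$ for vertical $\mathcal V$. Around every point there are adapted coordinates/frames for which $\mathcal J\mathcal X_\alpha=\mathcal V_\alpha$, $\mathcal S=y^\alpha\mathcal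 X_\alpha+\mathcal S^\beta\mathcal V_\beta$, $\mathcal C=\mathcal J\mathcal S=y^\alpha\mathcal V_\alpha$. An almost cotangent structure is a nondegenerate $2$-form $\Omega$ on $\mathbf T\mathcal M$ for which the vertical spaces are Lagrangian. A $1$-form $\theta$ on $\mathbf T\mathcal M$ is a regular semi-Hamiltonian if $(d^{\mathcal P}\theta)|_{\mathbf V\mathcal M}=0$ and, for any local function $L$ with $(d^{\mathcal P}L)|_{\mathbf V\mathcal M}=\theta|_{\mathbf V\mathcal M}$, the Hessian $(\partial^2L/\partial y^\alpha\partial y^\beta)$ in adapted coordinates is invertible. $\Omega$ is semi-Hamiltonian if $\Omega=-d^{\mathcal P}(\mathcal J^*\theta)$ for some regular semi-Hamiltonian $\theta$; then locally $\Omega=-d^{\mathcal P}(\mathcal J^*d^{\mathcal P}L)$ for local functions $L$, $\Omega$ is compatible with $\mathcal J$, and $g_\Omega(\mathcal J\mathcal Z,\mathcal Y)=\Omega(\mathcal Z,\mathcal Y)$ ($\mathcal Y$ vertical) defines a pseudo-Riemannian metric on $\mathbf V\mathcal M$. Connections. A nonlinear connection is an endomorphism $\mathcal N$ of $\mathbf T\mathcal M$ with $\mathcal N^2=\mathrm{Id}$, $\ker(\mathrm{Id}+\mathcal N)=\mathbf V\mathcal M$; its horizontal bundle is $\ker(\mathrm{Id}-\mathcal N)$ and $v_{\mathcal N}=\frac12(\mathrm{Id}-\mathcal N)$. It is Lagrangian if its horizontal bundle is Lagrangian for $\Omega$; it is $g$-metric (relative to $\mathcal S$) if $D_{\mathcal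 N}g=0$, where $D_{\mathcal N}\mathcal X=v_{\mathcal N}[\mathcal S,\mathcal X]_{\mathcal P}$ for vertical $\mathcal X$ and $D_{\mathcal N}g(\mathcal X,\mathcal X')=\mathcal L^{\mathcal P}_{\mathcal S}(g(\mathcal X,\mathcal X'))-g(D_{\mathcal N}\mathcal X,\mathcal X')-g(\mathcal X,D_{\mathcal N}\mathcal X')$. *)

theory Defs
  imports "HOL-Analysis.Analysis" "HOL-Library.Function_Algebras"
begin

text \<open>Tangent vectors are functionals on real functions, so functions into a real vector
  space have to form a real vector space.\<close>

instantiation "fun" :: (type, real_vector) real_vector
begin

definition scaleR_fun :: "real \<Rightarrow> ('a \<Rightarrow> 'b) \<Rightarrow> 'a \<Rightarrow> 'b" where
  "scaleR_fun c f = (\<lambda>x. c *\<^sub>R f x)"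

instance
  by standard (auto simp: scaleR_fun_def fun_eq_iff algebra_simps)

end


section \<open>Smooth manifolds\<close>

primrec Ck_on :: "nat \<Rightarrow> 'e::real_normed_vector set \<Rightarrow> ('e \<Rightarrow> 'f::real_normed_vector) \<Rightarrow> bool" where
  "Ck_on 0 S = (\<lambda>f. continuous_on S f)"
| "Ck_on (Suc n) S = (\<lambda>f. (\<forall>x\<in>S. f differentiable (at x)) \<and>
     (\<forall>v. Ck_on n S (\<lambda>x. frechet_derivative f (at x) v)))"

text \<open>This is used for open subsets of finite-dimensional spaces, where it is the usual \<open>C\<^sup>\<infinity>\<close>.\<close>

definition smooth_on :: "'e::real_normed_vector set \<Rightarrow> ('e \<Rightarrow> 'f::real_normed_vector) \<Rightarrow> bool" where
  "smooth_on S f \<longleftrightarrow> (\<forall>n. Ck_on n S f)"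

text \<open>The points of a manifold are all the points of a Hausdorff type. The model space is a
  normed space which \<open>manifold\<close> requires to be finite-dimensional; unlike the class
  \<open>euclidean_space\<close>, this does not exclude dimension zero.\<close>

type_synonym ('p, 'e) chart = "'p set \<times> ('p \<Rightarrow> 'e)"
type_synonym ('p, 'e) atlas = "('p, 'e) chart set"
type_synonym 'p tangent = "('p \<Rightarrow> real) \<Rightarrow> real"

definition topological_chart :: "('p::t2_space, 'e::real_normed_vector) chart \<Rightarrow> bool" where
  "topological_chart c \<longleftrightarrow> (case c of (U, \<phi>) \<Rightarrow>
     open U \<and> open (\<phi> ` U) \<and> inj_on \<phi> U \<and> homeomorphism U (\<phi> ` U) \<phi> (inv_into U \<phi>))"

definition smooth_transition :: "('p, 'e::real_normed_vector) chart \<Rightarrow> ('p, 'e) chart \<Rightarrow> bool" where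
  "smooth_transition c d \<longleftrightarrow> (case c of (U, \<phi>) \<Rightarrow> case d of (V, \<psi>) \<Rightarrow>
     smooth_on (\<phi> ` (U \<inter> V)) (\<psi> \<circ> inv_into U \<phi>))"

text \<open>The charts of the maximal atlas containing \<open>\<A>\<close>.\<close>

definition smooth_chart :: "('p::t2_space, 'e::real_normed_vector) atlas \<Rightarrow> ('p, 'e) chart \<Rightarrow> bool" where
  "smooth_chart \<A> c \<longleftrightarrow> topological_chart c \<and>
     (\<forall>d\<in>\<A>. smooth_transition c d \<and> smooth_transition d c)"

definition manifold :: "('p::t2_space, 'e::real_normed_vector) atlas \<Rightarrow> bool" where
  "manifold \<A> \<longleftrightarrow> (\<exists>B::'e set. finite B \<and> span B = UNIV) \<and>
     (\<Union>c\<in>\<A>. fst c) = UNIV \<and> (\<forall>c\<in>\<A>. smooth_chart \<A> c)"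

definition smooth_fun ::
  "('p, 'e::real_normed_vector) atlas \<Rightarrow> 'p set \<Rightarrow> ('p \<Rightarrow> real) \<Rightarrow> bool" where
  "smooth_fun \<A> U f \<longleftrightarrow> (\<forall>(V, \<phi>)\<in>\<A>. smooth_on (\<phi> ` (U \<inter> V)) (f \<circ> inv_into V \<phi>))"

definition smooth_near ::
  "('p::topological_space, 'e::real_normed_vector) atlas \<Rightarrow> 'p \<Rightarrow> ('p \<Rightarrow> real) \<Rightarrow> bool" where
  "smooth_near \<A> p f \<longleftrightarrow> (\<exists>U. open U \<and> p \<in> U \<and> smooth_fun \<A> U f)"

definition paracompact_space :: "'p::topological_space itself \<Rightarrow> bool" where
  "paracompact_space _ \<longleftrightarrow>
     (\<forall>\<U>::'p set set. (\<forall>U\<in>\<U>. open U) \<and> \<Union>\<U> = UNIV \<longrightarrow>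
        (\<exists>\<V>. (\<forall>V\<in>\<V>. open V \<and> (\<exists>U\<in>\<U>. V \<subseteq> U)) \<and> \<Union>\<V> = UNIV \<and>
             locally_finite_in euclidean \<V>))"

text \<open>\<open>tvec \<A> (U, \<phi>) p w\<close> is the derivation at \<open>p\<close> with components \<open>w\<close> in the chart
  \<open>(U, \<phi>)\<close>. The value zero on functions which are not smooth near \<open>p\<close> makes the
  representation of a tangent vector unique.\<close>

definition tvec :: "('p::topological_space, 'e::real_normed_vector) atlas \<Rightarrow> ('p, 'e) chart \<Rightarrow>
    'p \<Rightarrow> 'e \<Rightarrow> 'p tangent" where
  "tvec \<A> c p w = (case c of (U, \<phi>) \<Rightarrow> \<lambda>f.
     if smooth_near \<A> p f
     then frechet_derivative (f \<circ> inv_into U \<phi>) (at (\<phi> p)) w else 0)"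

definition tangent_space ::
  "('p::topological_space, 'e::real_normed_vector) atlas \<Rightarrow> 'p \<Rightarrow> 'p tangent set" where
  "tangent_space \<A> p = {tvec \<A> c p w | c w. c \<in> \<A> \<and> p \<in> fst c}"

definition components :: "('p::topological_space, 'e::real_normed_vector) atlas \<Rightarrow>
    ('p, 'e) chart \<Rightarrow> 'p \<Rightarrow> 'p tangent \<Rightarrow> 'e" where
  "components \<A> c p v = (THE w. v = tvec \<A> c p w)"

definition push_forward :: "('b::topological_space, 'e::real_normed_vector) atlas \<Rightarrow>
    ('p \<Rightarrow> 'b) \<Rightarrow> 'p \<Rightarrow> 'p tangent \<Rightarrow> 'b tangent" where
  "push_forward \<B> \<pi> m v = (\<lambda>g. if smooth_near \<B> (\<pi> m) g then v (g \<circ> \<pi>) else 0)"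

definition vector_field_bracket :: "('p::topological_space, 'e::real_normed_vector) atlas \<Rightarrow>
    ('p \<Rightarrow> 'p tangent) \<Rightarrow> ('p \<Rightarrow> 'p tangent) \<Rightarrow> 'p \<Rightarrow> 'p tangent" where
  "vector_field_bracket \<A> X Y p = (\<lambda>f. if smooth_near \<A> p f
     then X p (\<lambda>q. Y q f) - Y p (\<lambda>q. X q f) else 0)"


section \<open>Anchored vector bundles with a bracket\<close>

text \<open>The fibres of a vector bundle are subspaces of one real vector space \<open>'v\<close>, and the smooth
  structure is given by a family of local frames \<open>(U, e)\<close>, indexed by \<open>'i\<close>, whose domains cover
  the base; the rank is \<open>CARD('i)\<close>. A local section over an open set \<open>U\<close> is a total function
  whose values outside \<open>U\<close> are irrelevant. The bracket is an operation on local sections.\<close>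

record ('i, 'p, 'e, 'v) algebroid =
  base_atlas :: "('p, 'e) atlas"
  fibre :: "'p \<Rightarrow> 'v set"
  frames :: "('p set \<times> ('i \<Rightarrow> 'p \<Rightarrow> 'v)) set"
  anchor :: "'p \<Rightarrow> 'v \<Rightarrow> 'p tangent"
  bracket :: "('p \<Rightarrow> 'v) \<Rightarrow> ('p \<Rightarrow> 'v) \<Rightarrow> 'p \<Rightarrow> 'v"

definition smooth_section ::
  "('i::finite, 'p::t2_space, 'e::real_normed_vector, 'v::real_vector) algebroid \<Rightarrow> 'p set \<Rightarrow>
    ('p \<Rightarrow> 'v) \<Rightarrow> bool" where
  "smooth_section E U X \<longleftrightarrow> (\<forall>x\<in>U. X x \<in> fibre E x) \<and>
     (\<forall>(V, e)\<in>frames E. \<exists>c. (\<forall>i. smooth_fun (base_atlas E) (U \<inter> V) (c i)) \<and>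
        (\<forall>x\<in>U \<inter> V. X x = (\<Sum>i\<in>UNIV. c i x *\<^sub>R e i x)))"

definition is_basis_of :: "('i \<Rightarrow> 'v::real_vector) \<Rightarrow> 'v set \<Rightarrow> bool" where
  "is_basis_of b W \<longleftrightarrow> inj b \<and> independent (range b) \<and> span (range b) = W"

definition local_frame ::
  "('i::finite, 'p::t2_space, 'e::real_normed_vector, 'v::real_vector) algebroid \<Rightarrow> 'p set \<Rightarrow>
    ('i \<Rightarrow> 'p \<Rightarrow> 'v) \<Rightarrow> bool" where
  "local_frame E U e \<longleftrightarrow> open U \<and> (\<forall>i. smooth_section E U (e i)) \<and>
     (\<forall>x\<in>U. is_basis_of (\<lambda>i. e i x) (fibre E x))"

definition vector_bundle ::
  "('i::finite, 'p::t2_space, 'e::real_normed_vector, 'v::real_vector) algebroid \<Rightarrow> bool" where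
  "vector_bundle E \<longleftrightarrow> manifold (base_atlas E) \<and> (\<Union>F\<in>frames E. fst F) = UNIV \<and>
     (\<forall>(U, e)\<in>frames E. local_frame E U e)"

definition anchored ::
  "('i::finite, 'p::t2_space, 'e::real_normed_vector, 'v::real_vector) algebroid \<Rightarrow> bool" where
  "anchored E \<longleftrightarrow>
     (\<forall>x. \<forall>b\<in>fibre E x. anchor E x b \<in> tangent_space (base_atlas E) x) \<and>
     (\<forall>x. \<forall>b\<in>fibre E x. \<forall>b'\<in>fibre E x. \<forall>c.
        anchor E x (b + b') = anchor E x b + anchor E x b' \<and>
        anchor E x (c *\<^sub>R b) = c *\<^sub>R anchor E x b) \<and>
     (\<forall>U X f. open U \<and> smooth_section E U X \<and> smooth_fun (base_atlas E) U f \<longrightarrow>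
        smooth_fun (base_atlas E) U (\<lambda>x. anchor E x (X x) f))"

definition almost_lie_bracket ::
  "('i::finite, 'p::t2_space, 'e::real_normed_vector, 'v::real_vector) algebroid \<Rightarrow> bool" where
  "almost_lie_bracket E \<longleftrightarrow>
     (\<forall>U X Y. open U \<and> smooth_section E U X \<and> smooth_section E U Y \<longrightarrow>
        smooth_section E U (bracket E X Y) \<and>
        (\<forall>x\<in>U. bracket E X Y x = - bracket E Y X x) \<and>
        (\<forall>x\<in>U. \<forall>c. bracket E X (\<lambda>y. c *\<^sub>R Y y) x = c *\<^sub>R bracket E X Y x) \<and>
        (\<forall>f. smooth_fun (base_atlas E) U f \<longrightarrow>
          (\<forall>x\<in>U. bracket E X (\<lambda>y. f y *\<^sub>R Y y) x =
             f x *\<^sub>R bracket E X Y x + anchor E x (X x) f *\<^sub>R Y x)) \<and>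
        (\<forall>Y'. smooth_section E U Y' \<longrightarrow>
          (\<forall>x\<in>U. bracket E X (\<lambda>y. Y y + Y' y) x = bracket E X Y x + bracket E X Y' x)) \<and>
        (\<forall>X' Y'. (\<forall>x\<in>U. X' x = X x \<and> Y' x = Y x) \<longrightarrow>
          (\<forall>x\<in>U. bracket E X' Y' x = bracket E X Y x)))"

definition pre_lie_algebroid ::
  "('i::finite, 'p::t2_space, 'e::real_normed_vector, 'v::real_vector) algebroid \<Rightarrow> bool" where
  "pre_lie_algebroid E \<longleftrightarrow> vector_bundle E \<and> anchored E \<and> almost_lie_bracket E \<and>
     (\<forall>U X Y. open U \<and> smooth_section E U X \<and> smooth_section E U Y \<longrightarrow>
        (\<forall>x\<in>U. anchor E x (bracket E X Y x) =
           vector_field_bracket (base_atlas E)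
             (\<lambda>y. anchor E y (X y)) (\<lambda>y. anchor E y (Y y)) x))"


subsection \<open>Differential calculus\<close>

definition one_form ::
  "('i::finite, 'p::t2_space, 'e::real_normed_vector, 'v::real_vector) algebroid \<Rightarrow> 'p set \<Rightarrow>
    ('p \<Rightarrow> 'v \<Rightarrow> real) \<Rightarrow> bool" where
  "one_form E U \<eta> \<longleftrightarrow>
     (\<forall>x\<in>U. \<forall>z\<in>fibre E x. \<forall>z'\<in>fibre E x. \<forall>c.
        \<eta> x (z + z') = \<eta> x z + \<eta> x z' \<and> \<eta> x (c *\<^sub>R z) = c * \<eta> x z) \<and>
     (\<forall>W X. open W \<and> W \<subseteq> U \<and> smooth_section E W X \<longrightarrow>
        smooth_fun (base_atlas E) W (\<lambda>x. \<eta> x (X x)))"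

definition two_form ::
  "('i::finite, 'p::t2_space, 'e::real_normed_vector, 'v::real_vector) algebroid \<Rightarrow>
    ('p \<Rightarrow> 'v \<Rightarrow> 'v \<Rightarrow> real) \<Rightarrow> bool" where
  "two_form E \<omega> \<longleftrightarrow>
     (\<forall>x. \<forall>u\<in>fibre E x. \<forall>z\<in>fibre E x. \<forall>z'\<in>fibre E x. \<forall>c.
        \<omega> x u (z + z') = \<omega> x u z + \<omega> x u z' \<and> \<omega> x u (c *\<^sub>R z) = c * \<omega> x u z \<and>
        \<omega> x u z = - \<omega> x z u) \<and>
     (\<forall>W X Y. open W \<and> smooth_section E W X \<and> smooth_section E W Y \<longrightarrow>
        smooth_fun (base_atlas E) W (\<lambda>x. \<omega> x (X x) (Y x)))"

definition endomorphism ::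
  "('i::finite, 'p::t2_space, 'e::real_normed_vector, 'v::real_vector) algebroid \<Rightarrow>
    ('p \<Rightarrow> 'v \<Rightarrow> 'v) \<Rightarrow> bool" where
  "endomorphism E I \<longleftrightarrow>
     (\<forall>x. \<forall>z\<in>fibre E x. \<forall>z'\<in>fibre E x. \<forall>c.
        I x z \<in> fibre E x \<and> I x (z + z') = I x z + I x z' \<and> I x (c *\<^sub>R z) = c *\<^sub>R I x z) \<and>
     (\<forall>W X. open W \<and> smooth_section E W X \<longrightarrow> smooth_section E W (\<lambda>x. I x (X x)))"

definition diff0 :: "('i, 'p, 'e, 'v) algebroid \<Rightarrow> ('p \<Rightarrow> real) \<Rightarrow> 'p \<Rightarrow> 'v \<Rightarrow> real" where
  "diff0 E f x z = anchor E x z f"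

definition diff1 :: "('i, 'p, 'e, 'v) algebroid \<Rightarrow> ('p \<Rightarrow> 'v \<Rightarrow> real) \<Rightarrow>
    ('p \<Rightarrow> 'v) \<Rightarrow> ('p \<Rightarrow> 'v) \<Rightarrow> 'p \<Rightarrow> real" where
  "diff1 E \<eta> X Y x = anchor E x (X x) (\<lambda>y. \<eta> y (Y y)) - anchor E x (Y x) (\<lambda>y. \<eta> y (X y))
     - \<eta> x (bracket E X Y x)"

definition pullback :: "('p \<Rightarrow> 'v \<Rightarrow> 'v) \<Rightarrow> ('p \<Rightarrow> 'v \<Rightarrow> real) \<Rightarrow> 'p \<Rightarrow> 'v \<Rightarrow> real" where
  "pullback I \<eta> x z = \<eta> x (I x z)"

definition lie_fun :: "('i, 'p, 'e, 'v) algebroid \<Rightarrow> ('p \<Rightarrow> 'v) \<Rightarrow> ('p \<Rightarrow> real) \<Rightarrow> 'p \<Rightarrow> real" where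
  "lie_fun E X f x = anchor E x (X x) f"

text \<open>The Lie derivative of an endomorphism is defined by its action on sections, and it is
  tensorial: its value on \<open>z\<close> in the fibre over \<open>x\<close> is obtained from any local section through \<open>z\<close>.\<close>

definition lie_endo ::
  "('i::finite, 'p::t2_space, 'e::real_normed_vector, 'v::real_vector) algebroid \<Rightarrow>
    ('p \<Rightarrow> 'v) \<Rightarrow> ('p \<Rightarrow> 'v \<Rightarrow> 'v) \<Rightarrow> 'p \<Rightarrow> 'v \<Rightarrow> 'v" where
  "lie_endo E S I x z = (THE w. \<forall>U X. open U \<and> x \<in> U \<and> smooth_section E U X \<and> X x = z \<longrightarrow>
     w = bracket E S (\<lambda>y. I y (X y)) x - I x (bracket E S X x))"

definition lagrangian_subspace :: "('v \<Rightarrow> 'v \<Rightarrow> real) \<Rightarrow> 'v set \<Rightarrow> 'v set \<Rightarrow> bool" where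
  "lagrangian_subspace \<omega> F W \<longleftrightarrow> W = {z \<in> F. \<forall>w\<in>W. \<omega> z w = 0}"


section \<open>Fibred manifolds and the prolongation\<close>

definition adapted_charts :: "('b::t2_space, 'e::real_normed_vector) atlas \<Rightarrow>
    ('p::t2_space, 'e \<times> 'f::real_normed_vector) atlas \<Rightarrow> ('p \<Rightarrow> 'b) \<Rightarrow>
    ('b, 'e) chart \<Rightarrow> ('p, 'e \<times> 'f) chart \<Rightarrow> bool" where
  "adapted_charts \<B> \<A> \<pi> \<kappa> \<phi> \<longleftrightarrow> smooth_chart \<B> \<kappa> \<and> smooth_chart \<A> \<phi> \<and> \<pi> ` fst \<phi> \<subseteq> fst \<kappa> \<and>
     (\<forall>m\<in>fst \<phi>. fst (snd \<phi> m) = snd \<kappa> (\<pi> m))"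

text \<open>A fibred manifold is a surjective submersion. A submersion is a map which in suitable charts
  around any point is a linear projection; the fibre dimension is \<open>CARD('k)\<close>.\<close>

definition fibred_manifold :: "('b::t2_space, 'e::real_normed_vector) atlas \<Rightarrow>
    ('p::t2_space, 'e \<times> (real ^ 'k::finite)) atlas \<Rightarrow> ('p \<Rightarrow> 'b) \<Rightarrow> bool" where
  "fibred_manifold \<B> \<A> \<pi> \<longleftrightarrow> manifold \<B> \<and> manifold \<A> \<and> surj \<pi> \<and>
     (\<forall>m. \<exists>\<kappa> \<phi>. m \<in> fst \<phi> \<and> adapted_charts \<B> \<A> \<pi> \<kappa> \<phi>)"

definition adapted_frame ::
  "('k::finite, 'b::t2_space, 'e::real_normed_vector, 'v::real_vector) algebroid \<Rightarrow>
    ('p::t2_space, 'e \<times> (real ^ 'k)) atlas \<Rightarrow> ('p \<Rightarrow> 'b) \<Rightarrow>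
    ('b, 'e) chart \<Rightarrow> ('p, 'e \<times> (real ^ 'k)) chart \<Rightarrow> ('k \<Rightarrow> 'b \<Rightarrow> 'v) \<Rightarrow> bool" where
  "adapted_frame A \<A> \<pi> \<kappa> \<phi> e \<longleftrightarrow>
     adapted_charts (base_atlas A) \<A> \<pi> \<kappa> \<phi> \<and> local_frame A (fst \<kappa>) e"

text \<open>The canonical basis. Here \<open>components (base_atlas A) \<kappa> x (anchor A x (e \<alpha> x))\<close> is the vector
  of the coefficients of \<open>\<rho>(e\<^sub>\<alpha>)\<close> with respect to the coordinates of the base.\<close>

definition canonical_X ::
  "('k::finite, 'b::t2_space, 'e::real_normed_vector, 'v::real_vector) algebroid \<Rightarrow>
    ('p::t2_space, 'e \<times> (real ^ 'k)) atlas \<Rightarrow> ('p \<Rightarrow> 'b) \<Rightarrow>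
    ('b, 'e) chart \<Rightarrow> ('p, 'e \<times> (real ^ 'k)) chart \<Rightarrow> ('k \<Rightarrow> 'b \<Rightarrow> 'v) \<Rightarrow>
    'k \<Rightarrow> 'p \<Rightarrow> 'v \<times> 'p tangent" where
  "canonical_X A \<A> \<pi> \<kappa> \<phi> e \<alpha> m =
     (e \<alpha> (\<pi> m),
      tvec \<A> \<phi> m (components (base_atlas A) \<kappa> (\<pi> m) (anchor A (\<pi> m) (e \<alpha> (\<pi> m))), 0))"

definition d_dy :: "('p::t2_space, 'e::real_normed_vector \<times> (real ^ 'k::finite)) atlas \<Rightarrow>
    ('p, 'e \<times> (real ^ 'k)) chart \<Rightarrow> 'k \<Rightarrow> 'p \<Rightarrow> 'p tangent" where
  "d_dy \<A> \<phi> \<alpha> m = tvec \<A> \<phi> m (0, axis \<alpha> 1)"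

definition canonical_V :: "('p::t2_space, 'e::real_normed_vector \<times> (real ^ 'k::finite)) atlas \<Rightarrow>
    ('p, 'e \<times> (real ^ 'k)) chart \<Rightarrow> 'k \<Rightarrow> 'p \<Rightarrow> 'v::real_vector \<times> 'p tangent" where
  "canonical_V \<A> \<phi> \<alpha> m = (0, d_dy \<A> \<phi> \<alpha> m)"

text \<open>The bracket of the prolongation is only characterised: local sections are combinations of
  canonical bases, so an almost Lie bracket is determined by its values on these.\<close>

definition is_prolongation ::
  "('k::finite, 'b::t2_space, 'e::real_normed_vector, 'v::real_vector) algebroid \<Rightarrow>
    ('p::t2_space, 'e \<times> (real ^ 'k)) atlas \<Rightarrow> ('p \<Rightarrow> 'b) \<Rightarrow>
    ('k + 'k, 'p, 'e \<times> (real ^ 'k), 'v \<times> 'p tangent) algebroid \<Rightarrow> bool" where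
  "is_prolongation A \<A> \<pi> P \<longleftrightarrow>
     base_atlas P = \<A> \<and>
     fibre P = (\<lambda>m. {(b, v). b \<in> fibre A (\<pi> m) \<and> v \<in> tangent_space \<A> m \<and>
                      anchor A (\<pi> m) b = push_forward (base_atlas A) \<pi> m v}) \<and>
     frames P = {(fst \<phi>, case_sum (canonical_X A \<A> \<pi> \<kappa> \<phi> e) (canonical_V \<A> \<phi>)) | \<kappa> \<phi> e.
                   adapted_frame A \<A> \<pi> \<kappa> \<phi> e} \<and>
     anchor P = (\<lambda>m z. snd z) \<and>
     almost_lie_bracket P \<and>
     (\<forall>\<kappa> \<phi> e. adapted_frame A \<A> \<pi> \<kappa> \<phi> e \<longrightarrow> (\<forall>m\<in>fst \<phi>. \<forall>\<alpha> \<beta>.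
        (\<forall>C::'k \<Rightarrow> real.
           bracket A (e \<alpha>) (e \<beta>) (\<pi> m) = (\<Sum>\<gamma>\<in>UNIV. C \<gamma> *\<^sub>R e \<gamma> (\<pi> m)) \<longrightarrow>
           bracket P (canonical_X A \<A> \<pi> \<kappa> \<phi> e \<alpha>) (canonical_X A \<A> \<pi> \<kappa> \<phi> e \<beta>) m =
             (\<Sum>\<gamma>\<in>UNIV. C \<gamma> *\<^sub>R canonical_X A \<A> \<pi> \<kappa> \<phi> e \<gamma> m)) \<and>
        bracket P (canonical_X A \<A> \<pi> \<kappa> \<phi> e \<alpha>) (canonical_V \<A> \<phi> \<beta>) m = 0 \<and>
        bracket P (canonical_V \<A> \<phi> \<alpha>) (canonical_V \<A> \<phi> \<beta>) m = 0))"

definition vertical :: "('i, 'p, 'e, 'v::real_vector \<times> 't) algebroid \<Rightarrow> 'p \<Rightarrow> ('v \<times> 't) set" where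
  "vertical P m = {z \<in> fibre P m. fst z = 0}"

definition vertical_section ::
  "('i::finite, 'p::t2_space, 'e::real_normed_vector, 'v::real_vector \<times> 't::real_vector) algebroid \<Rightarrow>
    'p set \<Rightarrow> ('p \<Rightarrow> 'v \<times> 't) \<Rightarrow> bool" where
  "vertical_section P U X \<longleftrightarrow> smooth_section P U X \<and> (\<forall>m\<in>U. X m \<in> vertical P m)"

definition semi_basic1 :: "('i, 'p, 'e, 'v::real_vector \<times> 't) algebroid \<Rightarrow> 'p set \<Rightarrow>
    ('p \<Rightarrow> 'v \<times> 't \<Rightarrow> real) \<Rightarrow> bool" where
  "semi_basic1 P U \<xi> \<longleftrightarrow> (\<forall>m\<in>U. \<forall>z\<in>vertical P m. \<xi> m z = 0)"

text \<open>Semi-basic \<open>2\<close>-forms, where the \<open>2\<close>-form is given by its values on pairs of local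
  sections, as \<open>diff1 P \<xi>\<close> is.\<close>

definition semi_basic2 ::
  "('i::finite, 'p::t2_space, 'e::real_normed_vector, 'v::real_vector \<times> 't::real_vector) algebroid \<Rightarrow>
    'p set \<Rightarrow> (('p \<Rightarrow> 'v \<times> 't) \<Rightarrow> ('p \<Rightarrow> 'v \<times> 't) \<Rightarrow> 'p \<Rightarrow> real) \<Rightarrow> bool" where
  "semi_basic2 P U \<omega> \<longleftrightarrow>
     (\<forall>W V X. open W \<and> W \<subseteq> U \<and> vertical_section P W V \<and> smooth_section P W X \<longrightarrow>
        (\<forall>m\<in>W. \<omega> V X m = 0))"


section \<open>Tangent and cotangent structures, semisprays\<close>

definition almost_tangent_structure ::
  "('i::finite, 'p::t2_space, 'e::real_normed_vector, 'v::real_vector \<times> 't::real_vector) algebroid \<Rightarrow>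
    ('p \<Rightarrow> 'v \<times> 't \<Rightarrow> 'v \<times> 't) \<Rightarrow> bool" where
  "almost_tangent_structure P J \<longleftrightarrow> endomorphism P J \<and>
     (\<forall>m. J m ` fibre P m = vertical P m \<and> {z \<in> fibre P m. J m z = 0} = vertical P m)"

definition semispray ::
  "('k::finite + 'k, 'p::t2_space, 'e::real_normed_vector,
     'v::real_vector \<times> 't::real_vector) algebroid \<Rightarrow> ('p \<Rightarrow> 'v \<times> 't) \<Rightarrow> bool" where
  "semispray P S \<longleftrightarrow> smooth_section P UNIV S \<and>
     (\<forall>U (v :: 'k \<Rightarrow> 'p \<Rightarrow> 'v \<times> 't). open U \<and> (\<forall>\<alpha>. vertical_section P U (v \<alpha>)) \<and>
        (\<forall>m\<in>U. is_basis_of (\<lambda>\<alpha>. v \<alpha> m) (vertical P m)) \<longrightarrow>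
        (\<forall>m\<in>U. span (range (\<lambda>\<alpha>. v \<alpha> m) \<union> range (\<lambda>\<alpha>. bracket P S (v \<alpha>) m)) = fibre P m))"

definition compatible ::
  "('i::finite, 'p::t2_space, 'e::real_normed_vector, 'v::real_vector \<times> 't::real_vector) algebroid \<Rightarrow>
    ('p \<Rightarrow> 'v \<times> 't) \<Rightarrow> ('p \<Rightarrow> 'v \<times> 't \<Rightarrow> 'v \<times> 't) \<Rightarrow> bool" where
  "compatible P S J \<longleftrightarrow>
     (\<forall>U V. open U \<and> vertical_section P U V \<longrightarrow> (\<forall>m\<in>U. J m (bracket P S V m) = - V m))"

definition almost_cotangent_structure ::
  "('i::finite, 'p::t2_space, 'e::real_normed_vector, 'v::real_vector \<times> 't::real_vector) algebroid \<Rightarrow>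
    ('p \<Rightarrow> 'v \<times> 't \<Rightarrow> 'v \<times> 't \<Rightarrow> real) \<Rightarrow> bool" where
  "almost_cotangent_structure P \<Omega> \<longleftrightarrow> two_form P \<Omega> \<and>
     (\<forall>m. \<forall>z\<in>fibre P m. (\<forall>w\<in>fibre P m. \<Omega> m z w = 0) \<longrightarrow> z = 0) \<and>
     (\<forall>m. lagrangian_subspace (\<Omega> m) (fibre P m) (vertical P m))"

text \<open>The Hessian of \<open>L\<close> is not invariant under arbitrary changes of the fibre coordinates. The
  coordinates meant in the regularity condition are those adapted to \<open>J\<close>, in which \<open>J\<close> sends
  each \<open>X\<^sub>\<alpha>\<close> to \<open>V\<^sub>\<alpha>\<close>; two systems of these are related by transformations that are affine in \<open>y\<close>.\<close>

definition regular_semi_hamiltonian ::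
  "('k::finite, 'b::t2_space, 'e::real_normed_vector, 'v::real_vector) algebroid \<Rightarrow> ('p \<Rightarrow> 'b) \<Rightarrow>
    ('k + 'k, 'p::t2_space, 'e \<times> (real ^ 'k), 'v \<times> 'p tangent) algebroid \<Rightarrow>
    ('p \<Rightarrow> 'v \<times> 'p tangent \<Rightarrow> 'v \<times> 'p tangent) \<Rightarrow>
    ('p \<Rightarrow> 'v \<times> 'p tangent \<Rightarrow> real) \<Rightarrow> bool" where
  "regular_semi_hamiltonian A \<pi> P J \<theta> \<longleftrightarrow> one_form P UNIV \<theta> \<and>
     (\<forall>U V W. open U \<and> vertical_section P U V \<and> vertical_section P U W \<longrightarrow>
        (\<forall>m\<in>U. diff1 P \<theta> V W m = 0)) \<and>
     (\<forall>U L \<kappa> \<phi> e. open U \<and> smooth_fun (base_atlas P) U L \<and>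
        (\<forall>m\<in>U. \<forall>z\<in>vertical P m. diff0 P L m z = \<theta> m z) \<and>
        adapted_frame A (base_atlas P) \<pi> \<kappa> \<phi> e \<and>
        (\<forall>m\<in>fst \<phi>. \<forall>\<alpha>. J m (canonical_X A (base_atlas P) \<pi> \<kappa> \<phi> e \<alpha> m) =
           canonical_V (base_atlas P) \<phi> \<alpha> m) \<longrightarrow>
        (\<forall>m\<in>U \<inter> fst \<phi>. invertible (\<chi> \<alpha> \<beta>.
           d_dy (base_atlas P) \<phi> \<alpha> m (\<lambda>q. d_dy (base_atlas P) \<phi> \<beta> q L))))"

definition is_minus_diff1 ::
  "('i::finite, 'p::t2_space, 'e::real_normed_vector, 'v::real_vector) algebroid \<Rightarrow> 'p set \<Rightarrow>
    ('p \<Rightarrow> 'v \<Rightarrow> 'v \<Rightarrow> real) \<Rightarrow> ('p \<Rightarrow> 'v \<Rightarrow> real) \<Rightarrow> bool" where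
  "is_minus_diff1 E U \<omega> \<eta> \<longleftrightarrow>
     (\<forall>W X Y. open W \<and> W \<subseteq> U \<and> smooth_section E W X \<and> smooth_section E W Y \<longrightarrow>
        (\<forall>x\<in>W. \<omega> x (X x) (Y x) = - diff1 E \<eta> X Y x))"

definition semi_hamiltonian ::
  "('k::finite, 'b::t2_space, 'e::real_normed_vector, 'v::real_vector) algebroid \<Rightarrow> ('p \<Rightarrow> 'b) \<Rightarrow>
    ('k + 'k, 'p::t2_space, 'e \<times> (real ^ 'k), 'v \<times> 'p tangent) algebroid \<Rightarrow>
    ('p \<Rightarrow> 'v \<times> 'p tangent \<Rightarrow> 'v \<times> 'p tangent) \<Rightarrow>
    ('p \<Rightarrow> 'v \<times> 'p tangent \<Rightarrow> 'v \<times> 'p tangent \<Rightarrow> real) \<Rightarrow> bool" where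
  "semi_hamiltonian A \<pi> P J \<Omega> \<longleftrightarrow>
     (\<exists>\<theta>. regular_semi_hamiltonian A \<pi> P J \<theta> \<and> is_minus_diff1 P UNIV \<Omega> (pullback J \<theta>))"

definition local_potential ::
  "('i::finite, 'p::t2_space, 'e::real_normed_vector, 'v::real_vector) algebroid \<Rightarrow>
    ('p \<Rightarrow> 'v \<Rightarrow> 'v) \<Rightarrow> ('p \<Rightarrow> 'v \<Rightarrow> 'v \<Rightarrow> real) \<Rightarrow> 'p set \<Rightarrow> ('p \<Rightarrow> real) \<Rightarrow> bool" where
  "local_potential P J \<Omega> U L \<longleftrightarrow> open U \<and> smooth_fun (base_atlas P) U L \<and>
     is_minus_diff1 P U \<Omega> (pullback J (diff0 P L))"

definition induced_metric ::
  "('i, 'p, 'e, 'v) algebroid \<Rightarrow> ('p \<Rightarrow> 'v \<Rightarrow> 'v) \<Rightarrow> ('p \<Rightarrow> 'v \<Rightarrow> 'v \<Rightarrow> real) \<Rightarrow>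
    'p \<Rightarrow> 'v \<Rightarrow> 'v \<Rightarrow> real" where
  "induced_metric P J \<Omega> m v w = \<Omega> m (SOME z. z \<in> fibre P m \<and> J m z = v) w"


section \<open>Nonlinear connections\<close>

definition nonlinear_connection ::
  "('i::finite, 'p::t2_space, 'e::real_normed_vector, 'v::real_vector \<times> 't::real_vector) algebroid \<Rightarrow>
    ('p \<Rightarrow> 'v \<times> 't \<Rightarrow> 'v \<times> 't) \<Rightarrow> bool" where
  "nonlinear_connection P N \<longleftrightarrow> endomorphism P N \<and>
     (\<forall>m. \<forall>z\<in>fibre P m. N m (N m z) = z) \<and>
     (\<forall>m. {z \<in> fibre P m. z + N m z = 0} = vertical P m)"

definition lagrangian_connection :: "('i, 'p, 'e, 'v) algebroid \<Rightarrow>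
    ('p \<Rightarrow> 'v \<Rightarrow> 'v \<Rightarrow> real) \<Rightarrow> ('p \<Rightarrow> 'v::real_vector \<Rightarrow> 'v) \<Rightarrow> bool" where
  "lagrangian_connection P \<Omega> N \<longleftrightarrow>
     (\<forall>m. lagrangian_subspace (\<Omega> m) (fibre P m) {z \<in> fibre P m. z - N m z = 0})"

definition dyn_derivative :: "('i, 'p, 'e, 'v) algebroid \<Rightarrow> ('p \<Rightarrow> 'v) \<Rightarrow>
    ('p \<Rightarrow> 'v::real_vector \<Rightarrow> 'v) \<Rightarrow> ('p \<Rightarrow> 'v) \<Rightarrow> 'p \<Rightarrow> 'v" where
  "dyn_derivative P S N X m =
     (1/2) *\<^sub>R (bracket P S X m - N m (bracket P S X m))"

definition metric_connection ::
  "('i::finite, 'p::t2_space, 'e::real_normed_vector, 'v::real_vector \<times> 't::real_vector) algebroid \<Rightarrow>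
    ('p \<Rightarrow> 'v \<times> 't) \<Rightarrow> ('p \<Rightarrow> 'v \<times> 't \<Rightarrow> 'v \<times> 't \<Rightarrow> real) \<Rightarrow>
    ('p \<Rightarrow> 'v \<times> 't \<Rightarrow> 'v \<times> 't) \<Rightarrow> bool" where
  "metric_connection P S g N \<longleftrightarrow>
     (\<forall>U X Y. open U \<and> vertical_section P U X \<and> vertical_section P U Y \<longrightarrow>
        (\<forall>m\<in>U. lie_fun P S (\<lambda>q. g q (X q) (Y q)) m
                - g m (dyn_derivative P S N X m) (Y m)
                - g m (X m) (dyn_derivative P S N Y m) = 0))"

definition canonical_connection ::
  "('i::finite, 'p::t2_space, 'e::real_normed_vector, 'v::real_vector) algebroid \<Rightarrow>
    ('p \<Rightarrow> 'v) \<Rightarrow> ('p \<Rightarrow> 'v \<Rightarrow> 'v) \<Rightarrow> 'p \<Rightarrow> 'v \<Rightarrow> 'v" where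
  "canonical_connection P S J m z = - lie_endo P S J m z"

text \<open>\<open>\<xi>\<close> is a semi-basic \<open>1\<close>-form on \<open>U\<close> such that \<open>d\<xi>\<close> is semi-basic and
  \<open>i\<^sub>S \<Omega> = d (\<L>\<^sub>C L - L) + \<xi>\<close> on \<open>U\<close>, where \<open>C = J S\<close>.\<close>

definition semi_basic_force ::
  "('i::finite, 'p::t2_space, 'e::real_normed_vector, 'v::real_vector \<times> 't::real_vector) algebroid \<Rightarrow>
    ('p \<Rightarrow> 'v \<times> 't) \<Rightarrow> ('p \<Rightarrow> 'v \<times> 't \<Rightarrow> 'v \<times> 't) \<Rightarrow>
    ('p \<Rightarrow> 'v \<times> 't \<Rightarrow> 'v \<times> 't \<Rightarrow> real) \<Rightarrow> 'p set \<Rightarrow> ('p \<Rightarrow> real) \<Rightarrow>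
    ('p \<Rightarrow> 'v \<times> 't \<Rightarrow> real) \<Rightarrow> bool" where
  "semi_basic_force P S J \<Omega> U L \<xi> \<longleftrightarrow>
     one_form P U \<xi> \<and> semi_basic1 P U \<xi> \<and> semi_basic2 P U (diff1 P \<xi>) \<and>
     (\<forall>m\<in>U. \<forall>z\<in>fibre P m. \<Omega> m (S m) z =
        diff0 P (\<lambda>q. lie_fun P (\<lambda>p. J p (S p)) L q - L q) m z + \<xi> m z)"

end

theory Submission
  imports Defs
begin

text \<open>Write \<open>\<eta> = J\<^sup>* dL\<close>, so that \<open>\<Omega> = - d\<eta>\<close> locally. The formula for \<open>i\<^sub>S \<Omega>\<close> determines the force as
  \<open>\<xi> = dL - \<L>\<^sub>S \<eta>\<close>, and compatibility of \<open>J\<close> with \<open>S\<close> makes \<open>\<xi>\<close> vanish on vertical vectors. Its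
  differential satisfies \<open>d\<xi>(V, X) = (\<L>\<^sub>S \<Omega>)(V, X)\<close> for vertical \<open>V\<close>: the defect is \<open>\<eta>\<close> of a
  Jacobiator with a vertical entry, which is vertical. The right-hand side is zero on pairs of
  vertical vectors because the metric is symmetric, and for the horizontal lifts \<open>V\<^sup>h, W\<^sup>h\<close> of
  vertical \<open>V, W\<close> it is \<open>(\<L>\<^sub>S \<Omega>)(V, W\<^sup>h) = \<Omega>(V\<^sup>h, W\<^sup>h) - (D g)(V, W)\<close>. The first term is antisymmetric
  and the second symmetric in \<open>V, W\<close>, so \<open>d\<xi>\<close> is semi-basic iff both vanish.\<close>

section \<open>Calculus on finite-dimensional normed spaces\<close>

text \<open>The obstacle is the absence of a Jacobi identity: neither \<open>A\<close> nor
  \<open>P\<close> has to satisfy one. What survives is that the brackets of the canonical basis of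
  \<open>P\<close> vanish when an entry is vertical and otherwise have coefficients pulled back from
  the base, which vertical derivatives kill. Seen through \<open>J\<close>, this replaces the Jacobi
  identity both for the symmetry of the metric and for the differential of the force. The given
  datum is a global form \<open>\<theta>\<close> that is closed on vertical vectors only, whereas
  the force is expressed by a function \<open>L\<close>. The passage between them is a Poincare
  lemma along the fibres with the base point as a smooth parameter; hence the treatment of integrals
  depending on a parameter. The model spaces are merely normed and finite-dimensional, possibly of
  dimension zero, so derivatives are expanded along a finite basis with continuous coordinate
  functionals. That \<open>P\<close> is a smooth vector bundle is derived: coefficients between
  frames of \<open>A\<close> are smooth by Cramer's rule, and the remaining coefficients are
  derivatives of fibre coordinates.\<close>

definition coordinates :: "'e::real_normed_vector set \<Rightarrow> ('e \<Rightarrow> 'e \<Rightarrow> real) \<Rightarrow> bool" where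
  "coordinates B d \<longleftrightarrow> finite B \<and> (\<forall>b\<in>B. bounded_linear (d b)) \<and> (\<forall>x. x = (\<Sum>b\<in>B. d b x *\<^sub>R b))"

text \<open>Induction on the basis. A new vector \<open>a\<close> has positive distance from
  \<open>span B\<close>, because the coefficient bound already known for \<open>B\<close> makes that
  span closed. This is where finite dimension turns into continuity of the coordinate
  functionals.\<close>

lemma independent_coefficient_bound:
  fixes B :: "'e::real_normed_vector set"
  assumes "finite B" "independent B"
  shows "\<exists>K\<ge>0. \<forall>c. \<forall>b\<in>B. \<bar>c b\<bar> \<le> K * norm (\<Sum>b\<in>B. c b *\<^sub>R b)"
  using assms
proof (induction B)
  case empty
  then show ?case by auto
next
  case (insert a B)
  then have ind: "independent B" and a: "a \<notin> span B"
    by (auto simp: independent_insert split: if_splits)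
  obtain K where K: "K \<ge> 0" "\<And>c b. b \<in> B \<Longrightarrow> \<bar>c b\<bar> \<le> K * norm (\<Sum>b\<in>B. c b *\<^sub>R b)"
    using insert.IH[OF ind] by blast
  \<comment> \<open>A sequence in the span approaching \<open>a\<close> would have Cauchy
    coefficients by the bound for \<open>B\<close>, and their limits would express \<open>a\<close>
    through \<open>B\<close>.\<close>
  have "\<exists>\<delta>>0. \<forall>c. \<delta> \<le> norm (a - (\<Sum>b\<in>B. c b *\<^sub>R b))"
  proof (rule ccontr)
    assume "\<not> ?thesis"
    then have "\<forall>n::nat. \<exists>c. norm (a - (\<Sum>b\<in>B. c b *\<^sub>R b)) < inverse (real (Suc n))"
      by (metis inverse_positive_iff_positive not_le of_nat_0_less_iff zero_less_Suc)
    then obtain c where c: "\<And>n. norm (a - (\<Sum>b\<in>B. c n b *\<^sub>R b)) < inverse (real (Suc n))"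
      by metis
    define s where "s n = (\<Sum>b\<in>B. c n b *\<^sub>R b)" for n
    have "(\<lambda>n. a - s n) \<longlonglongrightarrow> 0"
      by (rule LIMSEQ_norm_0) (use c in \<open>auto simp: s_def inverse_eq_divide\<close>)
    then have s: "s \<longlonglongrightarrow> a"
      using tendsto_diff[OF tendsto_const[of a], of "\<lambda>n. a - s n" 0] by simp
    have "Cauchy s" using s LIMSEQ_imp_Cauchy by blast
    have "convergent (\<lambda>n. c n b)" if b: "b \<in> B" for b
    proof -
      have *: "\<bar>c n b - c m b\<bar> \<le> K * norm (s n - s m)" for n m
        using K(2)[OF b, of "\<lambda>b. c n b - c m b"]
        by (simp add: s_def sum_subtractf scaleR_diff_left)
      have "Cauchy (\<lambda>n. c n b)"
        unfolding Cauchy_def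
      proof (intro allI impI)
        fix e :: real assume e: "e > 0"
        then have "e / (K + 1) > 0" using K(1) by simp
        then obtain M where M: "\<forall>m\<ge>M. \<forall>n\<ge>M. dist (s m) (s n) < e / (K + 1)"
          using \<open>Cauchy s\<close> unfolding Cauchy_def by blast
        have "dist (c m b) (c n b) < e" if "m \<ge> M" "n \<ge> M" for m n
        proof -
          have "dist (c m b) (c n b) \<le> K * norm (s m - s n)" using * by (simp add: dist_real_def)
          also have "\<dots> \<le> (K + 1) * norm (s m - s n)" by (simp add: distrib_right)
          also have "\<dots> < (K + 1) * (e / (K + 1))"
            using M that K(1) by (intro mult_strict_left_mono) (auto simp: dist_norm)
          finally show ?thesis using K(1) by simp
        qed
        then show "\<exists>M. \<forall>m\<ge>M. \<forall>n\<ge>M. dist (c m b) (c n b) < e" by blast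
      qed
      then show ?thesis by (simp add: Cauchy_convergent_iff)
    qed
    then obtain l where l: "\<And>b. b \<in> B \<Longrightarrow> (\<lambda>n. c n b) \<longlonglongrightarrow> l b"
      unfolding convergent_def by metis
    have "s \<longlonglongrightarrow> (\<Sum>b\<in>B. l b *\<^sub>R b)"
      unfolding s_def by (intro tendsto_intros l)
    then have "a = (\<Sum>b\<in>B. l b *\<^sub>R b)" using s LIMSEQ_unique by blast
    moreover have "(\<Sum>b\<in>B. l b *\<^sub>R b) \<in> span B" by (intro span_sum span_scale span_base)
    ultimately have "a \<in> span B" by simp
    with a show False by simp
  qed
  then obtain \<delta> where \<delta>: "\<delta> > 0" "\<And>c. \<delta> \<le> norm (a - (\<Sum>b\<in>B. c b *\<^sub>R b))" by blast
  \<comment> \<open>With \<open>N\<close> the norm of the whole sum, the coefficient of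
    \<open>a\<close> is at most \<open>N / \<delta>\<close>; the rest then has norm at most
    \<open>N * (1 + norm a / \<delta>)\<close>, and \<open>K\<close> bounds its coefficients.
    \<open>K'\<close> adds the two constants.\<close>
  define K' where "K' = 1 / \<delta> + K * (1 + norm a / \<delta>)"
  have "\<bar>c b\<bar> \<le> K' * norm (\<Sum>b\<in>insert a B. c b *\<^sub>R b)" if b: "b \<in> insert a B" for c b
  proof -
    define r where "r = (\<Sum>b\<in>B. c b *\<^sub>R b)"
    define N where "N = norm (c a *\<^sub>R a + r)"
    have N: "norm (\<Sum>b\<in>insert a B. c b *\<^sub>R b) = N"
      using insert.hyps by (simp add: N_def r_def)
    have t: "\<bar>c a\<bar> \<le> N / \<delta>"
    proof (cases "c a = 0")
      case True
      then show ?thesis using \<delta>(1) by (simp add: N_def)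
    next
      case False
      have "\<delta> \<le> norm (a - (\<Sum>b\<in>B. (- c b / c a) *\<^sub>R b))" by (rule \<delta>(2))
      also have "(\<Sum>b\<in>B. (- c b / c a) *\<^sub>R b) = - (inverse (c a) *\<^sub>R r)"
        unfolding r_def scaleR_sum_right sum_negf[symmetric]
        by (intro sum.cong) (auto simp: divide_inverse mult.commute)
      finally have "\<bar>c a\<bar> * \<delta> \<le> \<bar>c a\<bar> * norm (a + inverse (c a) *\<^sub>R r)"
        by (simp add: mult_left_mono)
      also have "\<dots> = norm (c a *\<^sub>R (a + inverse (c a) *\<^sub>R r))" by simp
      also have "\<dots> = N" using False by (simp add: N_def scaleR_add_right)
      finally show ?thesis using \<delta>(1) by (simp add: field_simps)
    qed
    have N0: "N \<ge> 0" by (simp add: N_def)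
    show ?thesis
    proof (cases "b = a")
      case True
      have "N / \<delta> \<le> K' * N"
        using N0 K(1) \<delta>(1) by (simp add: K'_def algebra_simps)
      then show ?thesis using t True N by simp
    next
      case False
      then have cb: "\<bar>c b\<bar> \<le> K * norm r" using K(2) b by (simp add: r_def)
      have "norm r \<le> N + \<bar>c a\<bar> * norm a"
        using norm_triangle_ineq4[of "c a *\<^sub>R a + r" "c a *\<^sub>R a"] by (simp add: N_def)
      also have "\<dots> \<le> N + N / \<delta> * norm a"
        using mult_right_mono[OF t, of "norm a"] by simp
      finally have "norm r \<le> N + N / \<delta> * norm a" .
      then have "K * norm r \<le> K * (N + N / \<delta> * norm a)" using K(1) by (rule mult_left_mono)
      with cb have "\<bar>c b\<bar> \<le> K * (N + N / \<delta> * norm a)" by linarith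
      also have "\<dots> \<le> K' * N"
        using N0 \<delta>(1) by (simp add: K'_def algebra_simps)
      finally show ?thesis using N by simp
    qed
  qed
  moreover have "K' \<ge> 0" using K(1) \<delta>(1) by (simp add: K'_def)
  ultimately show ?case by blast
qed

lemma coordinates_exist:
  fixes B0 :: "'e::real_normed_vector set"
  assumes "finite B0" "span B0 = UNIV"
  obtains B and d :: "'e \<Rightarrow> 'e \<Rightarrow> real" where "coordinates B d"
proof -
  obtain B where B: "B \<subseteq> B0" "independent B" "B0 \<subseteq> span B"
    using maximal_independent_subset[of B0] by blast
  have fin: "finite B" using B(1) assms(1) finite_subset by blast
  have sp: "span B = UNIV" using B(3) assms(2) by (metis span_mono span_span top.extremum_uniqueI)
  have rep: "(\<Sum>b\<in>B. representation B x b *\<^sub>R b) = x" for x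
    using sum_representation_eq[OF B(2) _ fin, of x] sp by auto
  obtain K where K: "K \<ge> 0" "\<And>c b. b \<in> B \<Longrightarrow> \<bar>c b\<bar> \<le> K * norm (\<Sum>b\<in>B. c b *\<^sub>R b)"
    using independent_coefficient_bound[OF fin B(2)] by blast
  have "bounded_linear (\<lambda>x. representation B x b)" if "b \<in> B" for b
    by (rule bounded_linear_intro[where K = K])
      (use K(2)[OF that, of "\<lambda>b. representation B x b" for x] B(2) sp in
        \<open>auto simp: representation_add representation_scale rep mult.commute\<close>)
  then have "coordinates B (\<lambda>b x. representation B x b)"
    using fin rep by (simp add: coordinates_def)
  then show thesis by (rule that)
qed

lemma coordinates_eqD:
  assumes "coordinates B d" "\<And>b. b \<in> B \<Longrightarrow> d b x = d b y"
  shows "x = y"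
  using assms unfolding coordinates_def by (metis (no_types, lifting) sum.cong)

lemma linear_coordinates:
  assumes "coordinates B d" "linear f"
  shows "f x = (\<Sum>b\<in>B. d b x *\<^sub>R f b)"
proof -
  have "f x = f (\<Sum>b\<in>B. d b x *\<^sub>R b)" using assms(1) by (auto simp: coordinates_def)
  also have "\<dots> = (\<Sum>b\<in>B. d b x *\<^sub>R f b)"
    using assms(2) by (simp add: linear_sum linear_scale)
  finally show ?thesis .
qed

subsection \<open>Functions of class \<open>C\<^sup>k\<close>\<close>

lemma Ck_on_has_derivative:
  "Ck_on (Suc n) S f \<Longrightarrow> x \<in> S \<Longrightarrow> (f has_derivative frechet_derivative f (at x)) (at x)"
  by (simp add: frechet_derivative_works[symmetric])

lemma Ck_on_cong:
  assumes "open S" "\<And>x. x \<in> S \<Longrightarrow> f x = g x" "Ck_on n S f"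
  shows "Ck_on n S g"
  using assms(2,3)
proof (induction n arbitrary: f g)
  case 0
  then show ?case using continuous_on_eq by auto
next
  case (Suc n)
  have d: "(g has_derivative frechet_derivative f (at x)) (at x)" if "x \<in> S" for x
    by (rule has_derivative_transform_within_open[OF Ck_on_has_derivative[OF Suc.prems(2) that] assms(1) that])
      (use Suc.prems in auto)
  have "frechet_derivative f (at x) = frechet_derivative g (at x)" if "x \<in> S" for x
    using d[OF that] frechet_derivative_at by blast
  then have "Ck_on n S (\<lambda>x. frechet_derivative g (at x) v)" for v
    using Suc.IH[of "\<lambda>x. frechet_derivative f (at x) v"] Suc.prems by simp
  then show ?case using d by (auto simp: differentiable_def)
qed

text \<open>\<open>Ck_on\<close> refers to \<open>frechet_derivative\<close>; here any family of
  derivatives may be supplied. Most closure rules below enter an explicit formula for the derivative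
  in this way.\<close>

lemma Ck_on_SucI:
  assumes "open S" "\<And>x. x \<in> S \<Longrightarrow> (f has_derivative f' x) (at x)" "\<And>v. Ck_on n S (\<lambda>x. f' x v)"
  shows "Ck_on (Suc n) S f"
proof -
  have "f' x = frechet_derivative f (at x)" if "x \<in> S" for x
    using assms(2)[OF that] frechet_derivative_at by blast
  then have "Ck_on n S (\<lambda>x. frechet_derivative f (at x) v)" for v
    using Ck_on_cong[OF assms(1) _ assms(3)[of v]] by simp
  then show ?thesis using assms(2) by (auto simp: differentiable_def)
qed

lemma Ck_on_subset: "Ck_on n S f \<Longrightarrow> T \<subseteq> S \<Longrightarrow> Ck_on n T f"
  by (induction n arbitrary: f) (auto intro: continuous_on_subset)

lemma Ck_on_SucD: "Ck_on (Suc n) S f \<Longrightarrow> Ck_on n S f"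
proof (induction n arbitrary: f)
  case 0
  then show ?case
    by (auto intro!: continuous_at_imp_continuous_on differentiable_imp_continuous_within)
next
  case (Suc n)
  then show ?case by (auto simp del: Ck_on.simps simp: Ck_on.simps(2)[of "Suc n"] Ck_on.simps(2)[of n])
qed

lemma Ck_on_local:
  assumes "\<And>x. x \<in> S \<Longrightarrow> \<exists>T. open T \<and> x \<in> T \<and> Ck_on n T f"
  shows "Ck_on n S f"
  using assms
proof (induction n arbitrary: f)
  case 0
  have "isCont f x" if "x \<in> S" for x
    using 0[OF that] by (auto simp: continuous_on_eq_continuous_at)
  then show ?case by (auto intro!: continuous_at_imp_continuous_on)
next
  case (Suc n)
  have "Ck_on n S (\<lambda>x. frechet_derivative f (at x) v)" for v
    by (rule Suc.IH) (use Suc.prems in fastforce)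
  moreover have "f differentiable (at x)" if "x \<in> S" for x
    using Suc.prems[OF that] by auto
  ultimately show ?case by simp
qed

lemma Ck_on_const: "Ck_on n S (\<lambda>x. c)"
proof (induction n arbitrary: c)
  case (Suc n)
  have "frechet_derivative (\<lambda>x. c) (at x) = (\<lambda>v. 0)" for x :: 'a
    using frechet_derivative_at[OF has_derivative_const] by metis
  then show ?case using Suc by simp
qed auto

lemma Ck_on_bounded_linear_compose:
  assumes "open S" "bounded_linear L" "Ck_on n S f"
  shows "Ck_on n S (\<lambda>x. L (f x))"
  using assms(3)
proof (induction n arbitrary: f)
  case 0
  then show ?case using bounded_linear.continuous_on[OF assms(2)] by simp
next
  case (Suc n)
  show ?case
    by (rule Ck_on_SucI[OF assms(1), where f' = "\<lambda>x v. L (frechet_derivative f (at x) v)"])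
      (use Suc bounded_linear.has_derivative[OF assms(2) Ck_on_has_derivative[OF Suc.prems]] in auto)
qed

lemma Ck_on_id: "open S \<Longrightarrow> Ck_on n S (\<lambda>x. x)"
proof (cases n)
  case (Suc k)
  assume "open S"
  then show ?thesis unfolding Suc
    by (rule Ck_on_SucI[where f' = "\<lambda>x v. v"]) (auto intro: has_derivative_ident Ck_on_const)
qed auto

lemma Ck_on_add:
  assumes "open S" "Ck_on n S f" "Ck_on n S g"
  shows "Ck_on n S (\<lambda>x. f x + g x)"
  using assms(2,3)
proof (induction n arbitrary: f g)
  case 0
  then show ?case by (auto intro!: continuous_intros)
next
  case (Suc n)
  show ?case
    by (rule Ck_on_SucI[OF assms(1), where f' = "\<lambda>x v. frechet_derivative f (at x) v + frechet_derivative g (at x) v"])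
      (use Suc has_derivative_add[OF Ck_on_has_derivative[OF Suc.prems(1)] Ck_on_has_derivative[OF Suc.prems(2)]] in auto)
qed

lemma Ck_on_sum:
  assumes "open S" "\<And>i. i \<in> I \<Longrightarrow> Ck_on n S (f i)"
  shows "Ck_on n S (\<lambda>x. \<Sum>i\<in>I. f i x)"
  using assms(2)
  by (induction I rule: infinite_finite_induct) (auto intro: Ck_on_const Ck_on_add[OF assms(1)])

lemma Ck_on_scaleR:
  fixes f :: "'e::real_normed_vector \<Rightarrow> real"
  assumes "open S" "Ck_on n S f" "Ck_on n S g"
  shows "Ck_on n S (\<lambda>x. f x *\<^sub>R g x)"
  using assms(2,3)
proof (induction n arbitrary: f g)
  case 0
  then show ?case by (auto intro!: continuous_intros)
next
  case (Suc n)
  show ?case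
  proof (rule Ck_on_SucI[OF assms(1)])
    show "((\<lambda>x. f x *\<^sub>R g x) has_derivative
      (\<lambda>v. f x *\<^sub>R frechet_derivative g (at x) v + frechet_derivative f (at x) v *\<^sub>R g x)) (at x)"
      if "x \<in> S" for x
      using Ck_on_has_derivative[OF Suc.prems(1) that] Ck_on_has_derivative[OF Suc.prems(2) that]
      by (rule has_derivative_scaleR)
    show "Ck_on n S (\<lambda>x. f x *\<^sub>R frechet_derivative g (at x) v + frechet_derivative f (at x) v *\<^sub>R g x)" for v
      using Suc.prems Ck_on_SucD[OF Suc.prems(1)] Ck_on_SucD[OF Suc.prems(2)]
      by (intro Ck_on_add[OF assms(1)] Suc.IH) auto
  qed
qed

lemma Ck_on_inverse:
  fixes f :: "'e::real_normed_vector \<Rightarrow> real"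
  assumes "open S" "Ck_on n S f" "\<And>x. x \<in> S \<Longrightarrow> f x \<noteq> 0"
  shows "Ck_on n S (\<lambda>x. inverse (f x))"
  using assms(2,3)
proof (induction n)
  case 0
  then show ?case by (auto intro!: continuous_intros)
next
  case (Suc n)
  have i: "Ck_on n S (\<lambda>x. inverse (f x))"
    using Suc.IH[OF Ck_on_SucD[OF Suc.prems(1)] Suc.prems(2)] .
  show ?case
  proof (rule Ck_on_SucI[OF assms(1)])
    show "((\<lambda>x. inverse (f x)) has_derivative
      (\<lambda>v. - (inverse (f x) * frechet_derivative f (at x) v * inverse (f x)))) (at x)"
      if "x \<in> S" for x
      using Suc.prems(2)[OF that] Ck_on_has_derivative[OF Suc.prems(1) that]
      by (rule Deriv.has_derivative_inverse)
    have "Ck_on n S (\<lambda>x. - (inverse (f x) *\<^sub>R frechet_derivative f (at x) v *\<^sub>R inverse (f x)))" for v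
      using Suc.prems
      by (intro Ck_on_bounded_linear_compose[OF assms(1) bounded_linear_minus[OF bounded_linear_ident]]
          Ck_on_scaleR[OF assms(1)] i) auto
    then show "Ck_on n S (\<lambda>x. - (inverse (f x) * frechet_derivative f (at x) v * inverse (f x)))" for v
      by (simp add: mult.assoc)
  qed
qed

text \<open>The derivative of the composite applies an operator depending on \<open>x\<close> to a
  vector depending on \<open>x\<close>. Expanding the vector in coordinates gives a finite sum of
  products whose factors are covered by the induction. \<open>f\<close> is generalised because its
  directional derivatives take its place.\<close>

lemma Ck_on_compose:
  fixes f :: "'e::real_normed_vector \<Rightarrow> 'f::real_normed_vector" and g :: "'g::real_normed_vector \<Rightarrow> 'e"
    and d :: "'e \<Rightarrow> 'e \<Rightarrow> real"
  assumes "open S" "open T" "coordinates B d" "g ` S \<subseteq> T" "Ck_on n T f" "Ck_on n S g"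
  shows "Ck_on n S (\<lambda>x. f (g x))"
  using assms(5,6)
proof (induction n arbitrary: f)
  case 0
  then show ?case using assms(4) by (auto intro: continuous_on_compose2)
next
  case (Suc n)
  have d: "(f has_derivative frechet_derivative f (at (g x))) (at (g x))" if "x \<in> S" for x
    using Ck_on_has_derivative[OF Suc.prems(1)] assms(4) that by blast
  show ?case
  proof (rule Ck_on_SucI[OF assms(1)])
    show "((\<lambda>x. f (g x)) has_derivative
      (\<lambda>v. frechet_derivative f (at (g x)) (frechet_derivative g (at x) v))) (at x)" if "x \<in> S" for x
      using has_derivative_compose[OF Ck_on_has_derivative[OF Suc.prems(2) that] d[OF that]] .
    show "Ck_on n S (\<lambda>x. frechet_derivative f (at (g x)) (frechet_derivative g (at x) v))" for v
    proof (rule Ck_on_cong[OF assms(1)])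
      show "(\<Sum>b\<in>B. d b (frechet_derivative g (at x) v) *\<^sub>R frechet_derivative f (at (g x)) b) =
        frechet_derivative f (at (g x)) (frechet_derivative g (at x) v)" if "x \<in> S" for x
        by (rule linear_coordinates[OF assms(3) has_derivative_linear[OF d[OF that]], symmetric])
      show "Ck_on n S (\<lambda>x. \<Sum>b\<in>B. d b (frechet_derivative g (at x) v) *\<^sub>R frechet_derivative f (at (g x)) b)"
      proof (intro Ck_on_sum[OF assms(1)] Ck_on_scaleR[OF assms(1)])
        fix b assume b: "b \<in> B"
        show "Ck_on n S (\<lambda>x. d b (frechet_derivative g (at x) v))"
          by (rule Ck_on_bounded_linear_compose[OF assms(1), where L = "d b"])
            (use assms(3) b Suc.prems(2) in \<open>auto simp: coordinates_def\<close>)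
        show "Ck_on n S (\<lambda>x. frechet_derivative f (at (g x)) b)"
          using Suc.IH[of "\<lambda>y. frechet_derivative f (at y) b"] Suc.prems(1) Ck_on_SucD[OF Suc.prems(2)] by simp
      qed
    qed
  qed
qed

subsection \<open>Germs of smooth functions\<close>

text \<open>A germ condition, so that domains can be shrunk without mention; on open sets it
  recovers \<open>smooth_on\<close> point by point.\<close>

definition smooth_at :: "'e::real_normed_vector \<Rightarrow> ('e \<Rightarrow> 'f::real_normed_vector) \<Rightarrow> bool" where
  "smooth_at x f \<longleftrightarrow> (\<exists>S. open S \<and> x \<in> S \<and> smooth_on S f)"

lemma smooth_on_iff_smooth_at: "open S \<Longrightarrow> smooth_on S f \<longleftrightarrow> (\<forall>x\<in>S. smooth_at x f)"
  unfolding smooth_at_def smooth_on_def by (meson Ck_on_local)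

lemma smooth_at_common:
  assumes "smooth_at x f" "smooth_at x g"
  obtains S where "open S" "x \<in> S" "smooth_on S f" "smooth_on S g"
proof -
  obtain S T where "open S" "x \<in> S" "smooth_on S f" "open T" "x \<in> T" "smooth_on T g"
    using assms unfolding smooth_at_def by blast
  then show thesis
    by (intro that[of "S \<inter> T"]) (auto simp: smooth_on_def intro: Ck_on_subset)
qed

lemma smooth_at_cong:
  assumes "smooth_at x f" "open S" "x \<in> S" "\<And>y. y \<in> S \<Longrightarrow> f y = g y"
  shows "smooth_at x g"
proof -
  obtain T where T: "open T" "x \<in> T" "smooth_on T f" using assms(1) unfolding smooth_at_def by blast
  have "smooth_on (S \<inter> T) g"
    unfolding smooth_on_def
    using Ck_on_cong[of "S \<inter> T" f g] T assms(2,4) Ck_on_subset[of _ T f "S \<inter> T"]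
    by (auto simp: smooth_on_def)
  then show ?thesis using T assms(2,3) unfolding smooth_at_def by (metis IntI open_Int)
qed

lemma smooth_at_eventually:
  assumes "smooth_at x f"
  obtains S where "open S" "x \<in> S" "\<And>y. y \<in> S \<Longrightarrow> smooth_at y f"
  using assms unfolding smooth_at_def by blast

lemma smooth_at_const: "smooth_at x (\<lambda>y. c)"
  unfolding smooth_at_def smooth_on_def using Ck_on_const by blast

lemma smooth_at_id: "smooth_at x (\<lambda>y. y)"
  unfolding smooth_at_def smooth_on_def using Ck_on_id open_UNIV by blast

lemma smooth_at_bounded_linear: "bounded_linear L \<Longrightarrow> smooth_at x f \<Longrightarrow> smooth_at x (\<lambda>y. L (f y))"
  unfolding smooth_at_def smooth_on_def using Ck_on_bounded_linear_compose by blast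

lemma smooth_at_add: "smooth_at x f \<Longrightarrow> smooth_at x g \<Longrightarrow> smooth_at x (\<lambda>y. f y + g y)"
  by (erule (1) smooth_at_common) (auto simp: smooth_at_def smooth_on_def intro!: Ck_on_add)

lemma smooth_at_scaleR:
  fixes f :: "'e::real_normed_vector \<Rightarrow> real"
  shows "smooth_at x f \<Longrightarrow> smooth_at x g \<Longrightarrow> smooth_at x (\<lambda>y. f y *\<^sub>R g y)"
  by (erule (1) smooth_at_common) (auto simp: smooth_at_def smooth_on_def intro!: Ck_on_scaleR)

lemma smooth_at_mult:
  fixes f g :: "'e::real_normed_vector \<Rightarrow> real"
  shows "smooth_at x f \<Longrightarrow> smooth_at x g \<Longrightarrow> smooth_at x (\<lambda>y. f y * g y)"
  using smooth_at_scaleR[of x f g] by simp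

lemma smooth_at_sum:
  assumes "\<And>i. i \<in> I \<Longrightarrow> smooth_at x (f i)"
  shows "smooth_at x (\<lambda>y. \<Sum>i\<in>I. f i y)"
  using assms by (induction I rule: infinite_finite_induct) (auto intro: smooth_at_const smooth_at_add)

lemma smooth_at_differentiable: "smooth_at x f \<Longrightarrow> (f has_derivative frechet_derivative f (at x)) (at x)"
  unfolding smooth_at_def smooth_on_def by (metis Ck_on_has_derivative)

lemma smooth_at_continuous: "smooth_at x f \<Longrightarrow> isCont f x"
  using smooth_at_differentiable has_derivative_continuous by blast

lemma smooth_at_derivative: "smooth_at x f \<Longrightarrow> smooth_at x (\<lambda>y. frechet_derivative f (at y) v)"
  unfolding smooth_at_def smooth_on_def by (metis Ck_on.simps(2))

lemma smooth_at_inverse: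
  fixes f :: "'e::real_normed_vector \<Rightarrow> real"
  assumes "smooth_at x f" "f x \<noteq> 0"
  shows "smooth_at x (\<lambda>y. inverse (f y))"
proof -
  obtain S where S: "open S" "x \<in> S" "smooth_on S f" using assms(1) unfolding smooth_at_def by blast
  have "continuous_on S f" using S(3) unfolding smooth_on_def by (metis Ck_on.simps(1))
  then have "open (S \<inter> f -` (- {0}))" using S(1) continuous_open_preimage by blast
  moreover have "Ck_on n (S \<inter> f -` (- {0})) (\<lambda>y. inverse (f y))" for n
    using S Ck_on_subset[of n S f] calculation by (intro Ck_on_inverse) (auto simp: smooth_on_def)
  ultimately show ?thesis
    unfolding smooth_at_def smooth_on_def using S(2) assms(2) by blast
qed

lemma smooth_at_compose:
  fixes d :: "'e::real_normed_vector \<Rightarrow> 'e \<Rightarrow> real"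
    and g :: "'g::real_normed_vector \<Rightarrow> 'e" and f :: "'e \<Rightarrow> 'f::real_normed_vector"
  assumes "coordinates B d" "smooth_at x g" "smooth_at (g x) f"
  shows "smooth_at x (\<lambda>y. f (g y))"
proof -
  obtain S where S: "open S" "x \<in> S" "smooth_on S g" using assms(2) unfolding smooth_at_def by blast
  obtain T where T: "open T" "g x \<in> T" "smooth_on T f" using assms(3) unfolding smooth_at_def by blast
  have "continuous_on S g" using S(3) unfolding smooth_on_def by (metis Ck_on.simps(1))
  then have o: "open (S \<inter> g -` T)" using S(1) T(1) continuous_open_preimage by blast
  have "Ck_on n (S \<inter> g -` T) (\<lambda>y. f (g y))" for n
    by (rule Ck_on_compose[OF o T(1) assms(1)])
      (use S(3) T(3) Ck_on_subset[of n S g "S \<inter> g -` T"] in \<open>auto simp: smooth_on_def\<close>)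
  then show ?thesis
    unfolding smooth_at_def smooth_on_def using o S(2) T(2) by blast
qed

lemma smooth_at_Pair: "smooth_at x f \<Longrightarrow> smooth_at x g \<Longrightarrow> smooth_at x (\<lambda>y. (f y, g y))"
  using smooth_at_add[of x "\<lambda>y. (f y, 0)" "\<lambda>y. (0, g y)"]
    smooth_at_bounded_linear[OF bounded_linear_Pair[OF bounded_linear_ident bounded_linear_zero], of x f]
    smooth_at_bounded_linear[OF bounded_linear_Pair[OF bounded_linear_zero bounded_linear_ident], of x g]
  by simp

lemma frechet_derivative_cong:
  assumes "open S" "x \<in> S" "\<And>y. y \<in> S \<Longrightarrow> f y = g y" "f differentiable (at x)"
  shows "frechet_derivative f (at x) = frechet_derivative g (at x)"
proof -
  have "(g has_derivative frechet_derivative f (at x)) (at x)"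
    using assms has_derivative_transform_within_open frechet_derivative_works by metis
  then show ?thesis using frechet_derivative_at by blast
qed

lemma smooth_at_derivative_along_line:
  fixes f :: "'e::real_normed_vector \<Rightarrow> real"
  assumes "smooth_at (a + t *\<^sub>R v) f"
  shows "((\<lambda>s. f (a + s *\<^sub>R v)) has_real_derivative frechet_derivative f (at (a + t *\<^sub>R v)) v) (at t)"
proof -
  have "((\<lambda>s. a + s *\<^sub>R v) has_derivative (\<lambda>h. h *\<^sub>R v)) (at t)"
    by (auto intro!: derivative_eq_intros)
  from has_derivative_compose[OF this smooth_at_differentiable[OF assms]]
  have "((\<lambda>s. f (a + s *\<^sub>R v)) has_derivative (\<lambda>h. frechet_derivative f (at (a + t *\<^sub>R v)) (h *\<^sub>R v))) (at t)" .
  moreover have "(\<lambda>h. frechet_derivative f (at (a + t *\<^sub>R v)) (h *\<^sub>R v)) = (*) (frechet_derivative f (at (a + t *\<^sub>R v)) v)"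
    using smooth_at_differentiable[OF assms, THEN has_derivative_linear]
    by (auto simp: linear_scale mult.commute)
  ultimately show ?thesis by (simp add: has_field_derivative_def)
qed

subsection \<open>Second derivatives\<close>

lemma isCont_eventually_dist:
  "isCont f x \<Longrightarrow> e > 0 \<Longrightarrow> \<forall>\<^sub>F y in nhds x. dist (f y) (f x) < e"
  unfolding isCont_def tendsto_at_iff_tendsto_nhds by (rule tendstoD)

text \<open>The mean value theorem is used twice: in the direction \<open>u\<close> for the
  difference of two translates of \<open>f\<close>, then in the direction \<open>w\<close> for the
  derivative of \<open>f\<close> along \<open>u\<close>.\<close>

lemma double_difference:
  fixes f :: "'e::real_normed_vector \<Rightarrow> real"
  assumes "h > 0" "\<And>s t. 0 \<le> s \<Longrightarrow> s \<le> h \<Longrightarrow> 0 \<le> t \<Longrightarrow> t \<le> h \<Longrightarrow> smooth_at (x + s *\<^sub>R u + t *\<^sub>R w) f"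
  obtains s t where "0 < s" "s < h" "0 < t" "t < h"
    "f (x + h *\<^sub>R u + h *\<^sub>R w) - f (x + h *\<^sub>R u) - f (x + h *\<^sub>R w) + f x =
      h * (h * frechet_derivative (\<lambda>y. frechet_derivative f (at y) u) (at (x + s *\<^sub>R u + t *\<^sub>R w)) w)"
proof -
  let ?D = "\<lambda>y. frechet_derivative f (at y) u"
  have "((\<lambda>s. f ((x + h *\<^sub>R w) + s *\<^sub>R u) - f (x + s *\<^sub>R u)) has_real_derivative
      ?D ((x + h *\<^sub>R w) + s *\<^sub>R u) - ?D (x + s *\<^sub>R u)) (at s)" if "0 \<le> s" "s \<le> h" for s
    using assms(2)[OF that, of h] assms(2)[OF that, of 0] assms(1)
    by (intro DERIV_diff smooth_at_derivative_along_line) (auto simp: algebra_simps)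
  from MVT2[OF assms(1) this]
  obtain s where s: "0 < s" "s < h"
    "f (x + h *\<^sub>R w + h *\<^sub>R u) - f (x + h *\<^sub>R u) - (f (x + h *\<^sub>R w + 0 *\<^sub>R u) - f (x + 0 *\<^sub>R u)) =
      (h - 0) * (?D (x + h *\<^sub>R w + s *\<^sub>R u) - ?D (x + s *\<^sub>R u))" by blast
  have "((\<lambda>t. ?D ((x + s *\<^sub>R u) + t *\<^sub>R w)) has_real_derivative
      frechet_derivative ?D (at ((x + s *\<^sub>R u) + t *\<^sub>R w)) w) (at t)" if "0 \<le> t" "t \<le> h" for t
    using assms(2)[of s t] s(1,2) that
    by (intro smooth_at_derivative_along_line smooth_at_derivative) auto
  from MVT2[OF assms(1) this]
  obtain t where t: "0 < t" "t < h"
    "?D (x + s *\<^sub>R u + h *\<^sub>R w) - ?D (x + s *\<^sub>R u + 0 *\<^sub>R w) =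
      (h - 0) * frechet_derivative ?D (at (x + s *\<^sub>R u + t *\<^sub>R w)) w" by blast
  show thesis
    by (rule that[OF s(1,2) t(1,2)]) (use s(3) t(3) in \<open>simp add: algebra_simps\<close>)
qed

text \<open>The double difference is symmetric in \<open>u\<close> and \<open>w\<close> and equals
  \<open>h^2\<close> times either mixed derivative at some point of a small parallelogram;
  continuity of both mixed derivatives at \<open>x\<close> does the rest.\<close>

lemma second_derivative_symmetric:
  fixes f :: "'e::real_normed_vector \<Rightarrow> real"
  assumes "smooth_at x f"
  shows "frechet_derivative (\<lambda>y. frechet_derivative f (at y) u) (at x) w =
    frechet_derivative (\<lambda>y. frechet_derivative f (at y) w) (at x) u"
proof -
  define G where "G u w y = frechet_derivative (\<lambda>y. frechet_derivative f (at y) u) (at y) w" for u w y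
  have cont: "isCont (G u w) x" for u w
    unfolding G_def using assms by (intro smooth_at_continuous smooth_at_derivative)
  obtain S where S: "open S" "x \<in> S" "\<And>y. y \<in> S \<Longrightarrow> smooth_at y f"
    using smooth_at_eventually[OF assms] by blast
  have "\<bar>G u w x - G w u x\<bar> \<le> e" if "e > 0" for e
  proof -
    have "\<forall>\<^sub>F y in nhds x. dist (G u w y) (G u w x) < e / 2 \<and> dist (G w u y) (G w u x) < e / 2 \<and> y \<in> S"
      using S(1,2) \<open>e > 0\<close>
      by (intro eventually_conj eventually_nhds_in_open isCont_eventually_dist cont) auto
    then obtain r where r: "r > 0" "\<And>y. dist y x < r \<Longrightarrow>
        dist (G u w y) (G u w x) < e / 2 \<and> dist (G w u y) (G w u x) < e / 2 \<and> y \<in> S"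
      unfolding eventually_nhds_metric by blast
    \<comment> \<open>This size keeps the whole parallelogram within distance \<open>r\<close> of
      \<open>x\<close>; the summand 1 makes the estimate strict and covers the case
      \<open>u = w = 0\<close>.\<close>
    define h where "h = r / (norm u + norm w + 1)"
    have n: "norm u + norm w + 1 > 0" by (simp add: add_nonneg_pos)
    have h: "h > 0" using r(1) n by (simp add: h_def)
    have near: "dist (x + s *\<^sub>R u + t *\<^sub>R w) x < r" if "0 \<le> s" "s \<le> h" "0 \<le> t" "t \<le> h" for s t
    proof -
      have "dist (x + s *\<^sub>R u + t *\<^sub>R w) x = norm (s *\<^sub>R u + t *\<^sub>R w)"
        by (simp add: dist_norm)
      also have "\<dots> \<le> s * norm u + t * norm w"
        using norm_triangle_ineq[of "s *\<^sub>R u" "t *\<^sub>R w"] that by simp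
      also have "\<dots> \<le> h * norm u + h * norm w"
        using that by (intro add_mono mult_right_mono) auto
      also have "\<dots> < h * (norm u + norm w + 1)" using h by (simp add: distrib_left)
      also have "\<dots> = r" using n by (simp add: h_def)
      finally show ?thesis .
    qed
    have sw: "x + s *\<^sub>R w + t *\<^sub>R u = x + t *\<^sub>R u + s *\<^sub>R w" for s t by simp
    obtain s t where 1: "0 < s" "s < h" "0 < t" "t < h"
      "f (x + h *\<^sub>R u + h *\<^sub>R w) - f (x + h *\<^sub>R u) - f (x + h *\<^sub>R w) + f x =
        h * (h * G u w (x + s *\<^sub>R u + t *\<^sub>R w))"
      using double_difference[OF h, of x u w f thesis] near r(2) S(3) unfolding G_def by blast
    obtain s' t' where 2: "0 < s'" "s' < h" "0 < t'" "t' < h"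
      "f (x + h *\<^sub>R w + h *\<^sub>R u) - f (x + h *\<^sub>R w) - f (x + h *\<^sub>R u) + f x =
        h * (h * G w u (x + s' *\<^sub>R w + t' *\<^sub>R u))"
      using double_difference[OF h, of x w u f thesis] near r(2) S(3) sw unfolding G_def by metis
    have "G u w (x + s *\<^sub>R u + t *\<^sub>R w) = G w u (x + s' *\<^sub>R w + t' *\<^sub>R u)"
    proof -
      have "h * (h * G u w (x + s *\<^sub>R u + t *\<^sub>R w)) = h * (h * G w u (x + s' *\<^sub>R w + t' *\<^sub>R u))"
        using 1(5) 2(5) unfolding sw[of h h] by linarith
      then show ?thesis using h by simp
    qed
    moreover have "dist (G u w (x + s *\<^sub>R u + t *\<^sub>R w)) (G u w x) < e / 2"
      using near[of s t] r(2) 1 by simp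
    moreover have "dist (G w u (x + s' *\<^sub>R w + t' *\<^sub>R u)) (G w u x) < e / 2"
      unfolding sw using near[of t' s'] r(2) 2 by simp
    ultimately show ?thesis unfolding dist_real_def by linarith
  qed
  then have "\<bar>G u w x - G w u x\<bar> \<le> 0" using field_le_epsilon[of "\<bar>G u w x - G w u x\<bar>" 0] by simp
  then show ?thesis by (simp add: G_def)
qed

subsection \<open>Integrals depending on a parameter\<close>

text \<open>The Leibniz rule for integrals yields derivatives along lines. Their continuity in the
  point upgrades them to a Frechet derivative: the mean value theorem on a segment reduces the error
  to a difference of \<open>D\<close> at two points, and expanding it along the finite basis makes
  the estimate uniform in the direction.\<close>

lemma has_derivative_from_directional:
  fixes d :: "'e::real_normed_vector \<Rightarrow> 'e \<Rightarrow> real" and f :: "'e \<Rightarrow> real"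
  assumes "coordinates B d" "open S" "x \<in> S"
    and deriv: "\<And>y v. y \<in> S \<Longrightarrow> ((\<lambda>s. f (y + s *\<^sub>R v)) has_real_derivative D y v) (at 0)"
    and lin: "\<And>y. y \<in> S \<Longrightarrow> linear (D y)"
    and cont: "\<And>v. continuous_on S (\<lambda>y. D y v)"
  shows "(f has_derivative D x) (at x)"
proof -
  have fin: "finite B" and bl: "\<And>b. b \<in> B \<Longrightarrow> bounded_linear (d b)"
    using assms(1) by (auto simp: coordinates_def)
  have D: "D y v = (\<Sum>b\<in>B. d b v * D y b)" if "y \<in> S" for y v
    using linear_coordinates[OF assms(1) lin[OF that], of v] by simp
  have "bounded_linear (\<lambda>v. \<Sum>b\<in>B. d b v * D x b)"
    by (intro bounded_linear_sum bounded_linear_mult_const bl)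
  moreover have "D x = (\<lambda>v. \<Sum>b\<in>B. d b v * D x b)" using D[OF assms(3)] by (rule ext)
  ultimately have bD: "bounded_linear (D x)" by simp
  define K where "K = (\<Sum>b\<in>B. onorm (d b))"
  have K: "(\<Sum>b\<in>B. \<bar>d b v\<bar>) \<le> K * norm v" for v
    unfolding K_def sum_distrib_right
    by (intro sum_mono) (use onorm[OF bl] in auto)
  have K0: "K \<ge> 0" unfolding K_def by (intro sum_nonneg onorm_pos_le bl)
  show ?thesis
    unfolding has_derivative_at_alt
  proof (intro conjI allI impI bD)
    fix e :: real assume "e > 0"
    \<comment> \<open>\<open>K\<close> bounds the sum of the absolute coordinates of a vector by its
      norm; the summand 1 keeps the denominator positive.\<close>
    define e' where "e' = e / (K + 1)"
    have e': "e' > 0" using \<open>e > 0\<close> K0 by (simp add: e'_def)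
    have "isCont (\<lambda>y. D y b) x" for b
      using cont assms(2,3) by (simp add: continuous_on_eq_continuous_at)
    then have "\<forall>\<^sub>F y in nhds x. (\<forall>b\<in>B. dist (D y b) (D x b) < e') \<and> y \<in> S"
      using assms(2,3) e' fin
      by (intro eventually_conj eventually_nhds_in_open eventually_ball_finite ballI
          isCont_eventually_dist) auto
    then obtain r where r: "r > 0"
      "\<And>y. dist y x < r \<Longrightarrow> (\<forall>b\<in>B. dist (D y b) (D x b) < e') \<and> y \<in> S"
      unfolding eventually_nhds_metric by blast
    have "norm (f y - f x - D x (y - x)) \<le> e * norm (y - x)" if y: "norm (y - x) < r" for y
    proof -
      define v where "v = y - x"
      have near: "dist (x + s *\<^sub>R v) x < r" if "0 \<le> s" "s \<le> 1" for s
      proof -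
        have "dist (x + s *\<^sub>R v) x \<le> 1 * norm v"
          unfolding dist_norm using mult_right_mono[OF that(2), of "norm v"] that by simp
        then show ?thesis using y by (simp add: v_def)
      qed
      have "((\<lambda>s. f (x + s *\<^sub>R v)) has_real_derivative D (x + s *\<^sub>R v) v) (at s)"
        if "0 \<le> s" "s \<le> 1" for s
        using deriv[of "x + s *\<^sub>R v" v] near[OF that] r(2)
          DERIV_shift[of "\<lambda>s. f (x + s *\<^sub>R v)" "D (x + s *\<^sub>R v) v" 0 s]
        by (simp add: algebra_simps)
      from MVT2[OF zero_less_one this]
      obtain z where z: "0 < z" "z < 1"
        "f (x + 1 *\<^sub>R v) - f (x + 0 *\<^sub>R v) = (1 - 0) * D (x + z *\<^sub>R v) v" by blast
      have zS: "x + z *\<^sub>R v \<in> S" using near[of z] z r(2) by simp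
      have "f y - f x - D x v = D (x + z *\<^sub>R v) v - D x v" using z(3) by (simp add: v_def)
      also have "\<dots> = (\<Sum>b\<in>B. d b v * (D (x + z *\<^sub>R v) b - D x b))"
        unfolding D[OF zS, of v] D[OF assms(3), of v] by (simp add: sum_subtractf right_diff_distrib)
      finally have "\<bar>f y - f x - D x v\<bar> \<le> (\<Sum>b\<in>B. \<bar>d b v * (D (x + z *\<^sub>R v) b - D x b)\<bar>)"
        by (simp add: sum_abs)
      also have "\<dots> \<le> (\<Sum>b\<in>B. \<bar>d b v\<bar> * e')"
        using r(2)[OF near, of z] z
        by (intro sum_mono) (auto simp: abs_mult dist_real_def intro!: mult_left_mono intro: less_imp_le)
      also have "\<dots> \<le> (K * norm v) * e'"
        using K[of v] e' by (simp add: sum_distrib_right[symmetric] mult_right_mono)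
      also have "\<dots> \<le> ((K + 1) * norm v) * e'"
        using e' by (intro mult_right_mono) auto
      also have "\<dots> = e * norm v" using K0 by (simp add: e'_def)
      finally show ?thesis by (simp add: v_def)
    qed
    then show "\<exists>r>0. \<forall>y. norm (y - x) < r \<longrightarrow> norm (f y - f x - D x (y - x)) \<le> e * norm (y - x)"
      using r(1) by blast
  qed
qed

lemma continuous_on_parameter_integral:
  fixes h :: "real \<times> 'e::real_normed_vector \<Rightarrow> real"
  assumes "\<And>t x. 0 \<le> t \<Longrightarrow> t \<le> 1 \<Longrightarrow> x \<in> S \<Longrightarrow> smooth_at (t, x) h"
  shows "continuous_on S (\<lambda>x. integral {0..1} (\<lambda>t. h (t, x)))"
    and "x \<in> S \<Longrightarrow> continuous_on {0..1} (\<lambda>t. h (t, x))"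
proof -
  have h: "continuous_on ({0..1} \<times> S) h"
    by (intro continuous_at_imp_continuous_on ballI smooth_at_continuous) (auto intro: assms)
  have "continuous_on (S \<times> cbox 0 1) (\<lambda>p. h (snd p, fst p))"
    by (rule continuous_on_compose2[OF h]) (auto intro!: continuous_intros)
  then show "continuous_on S (\<lambda>x. integral {0..1} (\<lambda>t. h (t, x)))"
    using integral_continuous_on_param[of S 0 1 "\<lambda>x t. h (t, x)"] by (simp add: case_prod_beta')
  show "continuous_on {0..1} (\<lambda>t. h (t, x))" if "x \<in> S"
    by (rule continuous_on_compose2[OF h]) (use that in \<open>auto intro!: continuous_intros\<close>)
qed

lemma has_derivative_parameter_integral:
  fixes d :: "'e::real_normed_vector \<Rightarrow> 'e \<Rightarrow> real" and h :: "real \<times> 'e \<Rightarrow> real"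
  assumes "coordinates B d" "open S"
    and sm: "\<And>t x. 0 \<le> t \<Longrightarrow> t \<le> 1 \<Longrightarrow> x \<in> S \<Longrightarrow> smooth_at (t, x) h"
    and "x \<in> S"
  shows "((\<lambda>x. integral {0..1} (\<lambda>t. h (t, x))) has_derivative
    (\<lambda>v. integral {0..1} (\<lambda>t. frechet_derivative h (at (t, x)) (0, v)))) (at x)"
proof -
  have sm': "smooth_at (t, x) (\<lambda>z. frechet_derivative h (at z) (0, v))"
    if "0 \<le> t" "t \<le> 1" "x \<in> S" for t x v
    using sm[OF that] by (rule smooth_at_derivative)
  show ?thesis
  proof (rule has_derivative_from_directional[OF assms(1,2,4)])
    show "continuous_on S (\<lambda>y. integral {0..1} (\<lambda>t. frechet_derivative h (at (t, y)) (0, v)))" for v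
      by (rule continuous_on_parameter_integral(1)[OF sm'])
    fix y assume y: "y \<in> S"
    have int: "(\<lambda>t. frechet_derivative h (at (t, y)) (0, v)) integrable_on {0..1}" for v
      using continuous_on_parameter_integral(2)[OF sm' y] by (intro integrable_continuous_real)
    have l: "linear (frechet_derivative h (at (t, y)))" if "0 \<le> t" "t \<le> 1" for t
      using smooth_at_differentiable[OF sm[OF that y]] has_derivative_linear by blast
    show "linear (\<lambda>v. integral {0..1} (\<lambda>t. frechet_derivative h (at (t, y)) (0, v)))"
    proof (rule linearI)
      fix u v
      have "integral {0..1} (\<lambda>t. frechet_derivative h (at (t, y)) (0, u + v)) =
        integral {0..1} (\<lambda>t. frechet_derivative h (at (t, y)) (0, u) + frechet_derivative h (at (t, y)) (0, v))"
        using linear_add[OF l, of _ "(0, u)" "(0, v)"] by (intro integral_cong) auto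
      then show "integral {0..1} (\<lambda>t. frechet_derivative h (at (t, y)) (0, u + v)) =
        integral {0..1} (\<lambda>t. frechet_derivative h (at (t, y)) (0, u)) +
        integral {0..1} (\<lambda>t. frechet_derivative h (at (t, y)) (0, v))"
        by (simp add: integral_add[OF int int])
    next
      fix c u
      have "integral {0..1} (\<lambda>t. frechet_derivative h (at (t, y)) (0, c *\<^sub>R u)) =
        integral {0..1} (\<lambda>t. c * frechet_derivative h (at (t, y)) (0, u))"
        using linear_scale[OF l, of _ c "(0, u)"] by (intro integral_cong) auto
      then show "integral {0..1} (\<lambda>t. frechet_derivative h (at (t, y)) (0, c *\<^sub>R u)) =
        c *\<^sub>R integral {0..1} (\<lambda>t. frechet_derivative h (at (t, y)) (0, u))"
        by simp
    qed
  next
    fix y v assume y: "y \<in> S"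
    have "isCont (\<lambda>s. y + s *\<^sub>R v) 0" by (intro continuous_intros)
    then have "\<forall>\<^sub>F s in nhds 0. y + s *\<^sub>R v \<in> S"
      using assms(2) y
      by (auto simp: isCont_def eventually_nhds_conv_at dest!: topological_tendstoD)
    then obtain r :: real where r: "r > 0" "\<And>s. dist s 0 < r \<Longrightarrow> y + s *\<^sub>R v \<in> S"
      unfolding eventually_nhds_metric by blast
    \<comment> \<open>The Leibniz rule is applied to the single real parameter \<open>s\<close>, on
      an interval so small that the line through \<open>y\<close> stays in \<open>S\<close>.\<close>
    let ?U = "ball (0::real) r"
    have rU: "y + s *\<^sub>R v \<in> S" if "s \<in> ?U" for s using r(2) that by (simp add: dist_commute)
    have "continuous_on ({0..1} \<times> S) (\<lambda>z. frechet_derivative h (at z) (0, v))"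
      by (intro continuous_at_imp_continuous_on ballI smooth_at_continuous) (auto intro: sm')
    then have c: "continuous_on (?U \<times> cbox 0 1) (\<lambda>p. frechet_derivative h (at (snd p, y + fst p *\<^sub>R v)) (0, v))"
      by (rule continuous_on_compose2[of _ _ _ "\<lambda>p. (snd p, y + fst p *\<^sub>R v)"])
        (use rU in \<open>auto intro!: continuous_intros\<close>)
    have "((\<lambda>s. integral (cbox 0 1) (\<lambda>t. h (t, y + s *\<^sub>R v))) has_real_derivative
        integral (cbox 0 1) (\<lambda>t. frechet_derivative h (at (t, y + 0 *\<^sub>R v)) (0, v))) (at 0 within ?U)"
    proof (rule leibniz_rule_field_derivative[where f = "\<lambda>s t. h (t, y + s *\<^sub>R v)"
          and fx = "\<lambda>s t. frechet_derivative h (at (t, y + s *\<^sub>R v)) (0, v)"])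
      fix s t :: real assume st: "s \<in> ?U" "t \<in> cbox 0 1"
      have "smooth_at ((t, y) + s *\<^sub>R (0, v)) h" using sm[of t "y + s *\<^sub>R v"] st rU by simp
      from smooth_at_derivative_along_line[OF this]
      show "((\<lambda>s. h (t, y + s *\<^sub>R v)) has_real_derivative frechet_derivative h (at (t, y + s *\<^sub>R v)) (0, v)) (at s within ?U)"
        by (simp add: has_field_derivative_at_within)
    next
      fix s assume "s \<in> ?U"
      then show "(\<lambda>t. h (t, y + s *\<^sub>R v)) integrable_on cbox 0 1"
        using continuous_on_parameter_integral(2)[OF sm rU] integrable_continuous_real by (metis interval_cbox)
    next
      show "continuous_on (?U \<times> cbox 0 1) (\<lambda>(s, t). frechet_derivative h (at (t, y + s *\<^sub>R v)) (0, v))"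
        using c by (simp add: case_prod_beta')
    qed (use r in auto)
    then show "((\<lambda>s. integral {0..1} (\<lambda>t. h (t, y + s *\<^sub>R v))) has_real_derivative
        integral {0..1} (\<lambda>t. frechet_derivative h (at (t, y)) (0, v))) (at 0)"
      using r(1) by (simp add: at_within_open[of 0 ?U])
  qed
qed

text \<open>Differentiating under the integral produces an integral of the same shape, with
  \<open>h\<close> replaced by its derivative along \<open>(0, v)\<close>; hence the induction runs
  over all \<open>h\<close>.\<close>

lemma Ck_on_parameter_integral:
  fixes d :: "'e::real_normed_vector \<Rightarrow> 'e \<Rightarrow> real" and h :: "real \<times> 'e \<Rightarrow> real"
  assumes "coordinates B d" "open S"
    and "\<And>t x. 0 \<le> t \<Longrightarrow> t \<le> 1 \<Longrightarrow> x \<in> S \<Longrightarrow> smooth_at (t, x) h"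
  shows "Ck_on n S (\<lambda>x. integral {0..1} (\<lambda>t. h (t, x)))"
  using assms(3)
proof (induction n arbitrary: h)
  case 0
  show ?case unfolding Ck_on.simps by (rule continuous_on_parameter_integral(1)[OF 0])
next
  case (Suc n)
  show ?case
  proof (rule Ck_on_SucI[OF assms(2)])
    show "((\<lambda>x. integral {0..1} (\<lambda>t. h (t, x))) has_derivative
      (\<lambda>v. integral {0..1} (\<lambda>t. frechet_derivative h (at (t, x)) (0, v)))) (at x)" if "x \<in> S" for x
      using has_derivative_parameter_integral[OF assms(1,2) Suc.prems that] .
    show "Ck_on n S (\<lambda>x. integral {0..1} (\<lambda>t. frechet_derivative h (at (t, x)) (0, v)))" for v
      using Suc.IH[of "\<lambda>z. frechet_derivative h (at z) (0, v)"] Suc.prems smooth_at_derivative by blast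
  qed
qed

text \<open>Along the fibre through \<open>x\<close>, the potential is obtained by integrating the closed form on the
  segment from \<open>(x, y\<^sub>0)\<close> to \<open>(x, y)\<close>; smoothness in \<open>x\<close> is differentiation under the integral.\<close>

lemma fibrewise_Poincare:
  fixes d :: "'e::real_normed_vector \<times> (real ^ 'k::finite) \<Rightarrow> 'e \<times> (real ^ 'k) \<Rightarrow> real"
    and F :: "'k \<Rightarrow> 'e \<times> (real ^ 'k) \<Rightarrow> real"
  assumes crd: "coordinates B d" and "open S1"
    and sm: "\<And>z \<beta>. z \<in> S1 \<times> ball y0 r \<Longrightarrow> smooth_at z (F \<beta>)"
    and sym: "\<And>z \<beta> \<gamma>. z \<in> S1 \<times> ball y0 r \<Longrightarrow>
      frechet_derivative (F \<beta>) (at z) (0, axis \<gamma> 1) = frechet_derivative (F \<gamma>) (at z) (0, axis \<beta> 1)"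
  obtains L where "\<And>z. z \<in> S1 \<times> ball y0 r \<Longrightarrow> smooth_at z L"
    "\<And>z \<beta>. z \<in> S1 \<times> ball y0 r \<Longrightarrow> frechet_derivative L (at z) (0, axis \<beta> 1) = F \<beta> z"
proof -
  let ?S = "S1 \<times> ball y0 r"
  have oS: "open ?S" using assms(2) by (simp add: open_Times)
  \<comment> \<open>\<open>G t\<close> contracts only the fibre coordinate towards
    \<open>y0\<close>. On a ball this stays in the domain for \<open>t\<close> between 0 and 1, and
    the base coordinate is carried along as a parameter.\<close>
  define G where "G t z = (fst z, y0 + t *\<^sub>R (snd z - y0))" for t :: real and z :: "'e \<times> (real ^ 'k)"
  have GS: "G t z \<in> ?S" if "0 \<le> t" "t \<le> 1" "z \<in> ?S" for t z
  proof -
    have "\<bar>t\<bar> * norm (snd z - y0) \<le> 1 * norm (snd z - y0)"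
      using that by (intro mult_right_mono) auto
    moreover have "norm (snd z - y0) < r" using that by (auto simp: dist_norm norm_minus_commute)
    ultimately show ?thesis using that by (auto simp: G_def dist_norm)
  qed
  \<comment> \<open>The integrand of the homotopy formula: the form with coefficients
    \<open>F\<close>, evaluated on the velocity of the ray \<open>t \<mapsto> G t z\<close>.\<close>
  define h where "h p = (\<Sum>\<beta>\<in>UNIV. (snd (snd p) - y0) $ \<beta> * F \<beta> (G (fst p) (snd p)))" for p
  have smh: "smooth_at (t, z) h" if "0 \<le> t" "t \<le> 1" "z \<in> ?S" for t z
  proof -
    have s1: "smooth_at (t, z) (\<lambda>p. snd (snd p) - y0)"
      using smooth_at_add[OF smooth_at_bounded_linear[OF bounded_linear_compose[OF bounded_linear_snd bounded_linear_snd] smooth_at_id] smooth_at_const[of _ "- y0"]]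
      by simp
    have s2: "smooth_at (t, z) (\<lambda>p. G (fst p) (snd p))"
      unfolding G_def
      by (intro smooth_at_Pair smooth_at_add smooth_at_const smooth_at_scaleR s1
          smooth_at_bounded_linear[OF bounded_linear_fst smooth_at_id]
          smooth_at_bounded_linear[OF bounded_linear_compose[OF bounded_linear_fst bounded_linear_snd] smooth_at_id])
    have s3: "smooth_at (t, z) (\<lambda>p. F \<beta> (G (fst p) (snd p)))" for \<beta>
      by (rule smooth_at_compose[OF crd s2]) (use sm GS that in auto)
    show ?thesis
      unfolding h_def
      by (intro smooth_at_sum smooth_at_mult s3 smooth_at_bounded_linear[OF bounded_linear_vec_nth s1])
  qed
  define L where "L z = integral {0..1} (\<lambda>t. h (t, z))" for z
  show thesis
  proof (rule that)
    show "smooth_at z L" if "z \<in> ?S" for z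
      unfolding smooth_at_def smooth_on_def L_def
      using Ck_on_parameter_integral[OF crd oS smh] oS that by blast
    fix z \<gamma> assume z: "z \<in> ?S"
    let ?y = "snd z - y0"
    have expand: "(\<Sum>\<beta>\<in>UNIV. y $ \<beta> *\<^sub>R (0::'e, axis \<beta> (1::real))) = (0, y)" for y :: "real ^ 'k"
      using basis_expansion[of y] by (simp add: sum_prod scalar_mult_eq_scaleR)
    \<comment> \<open>By \<open>sym\<close>, the weighted sum of the derivatives of the
      \<open>F \<beta>\<close> in the direction \<open>\<gamma>\<close> becomes the derivative of
      \<open>F \<gamma>\<close> along the ray. The right-hand side is thus the
      \<open>t\<close>-derivative of \<open>t * F \<gamma> (G t z)\<close>.\<close>
    have Dh: "frechet_derivative h (at (t, z)) (0, 0, axis \<gamma> 1) =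
      F \<gamma> (G t z) + t * frechet_derivative (F \<gamma>) (at (G t z)) (0, ?y)" if t: "0 \<le> t" "t \<le> 1" for t
    proof -
      have dF: "(F \<beta> has_derivative frechet_derivative (F \<beta>) (at (G t z))) (at (G t z))" for \<beta>
        by (rule smooth_at_differentiable[OF sm[OF GS[OF t z]]])
      have lF: "linear (frechet_derivative (F \<beta>) (at (G t z)))" for \<beta>
        by (rule has_derivative_linear[OF dF])
      have "((\<lambda>z. (t, z)) has_derivative (\<lambda>v. (0, v))) (at z)"
        by (auto intro!: derivative_eq_intros)
      from has_derivative_compose[OF this smooth_at_differentiable[OF smh[OF t z]]]
      have 1: "((\<lambda>z. h (t, z)) has_derivative (\<lambda>v. frechet_derivative h (at (t, z)) (0, v))) (at z)" .
      have dG: "(G t has_derivative (\<lambda>v. (fst v, t *\<^sub>R snd v))) (at z)"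
        unfolding G_def by (auto intro!: derivative_eq_intros)
      have dy: "((\<lambda>z. (snd z - y0) $ \<beta>) has_derivative (\<lambda>v. snd v $ \<beta>)) (at z)" for \<beta>
        by (auto intro!: derivative_eq_intros bounded_linear.has_derivative[OF bounded_linear_vec_nth])
      have 2: "((\<lambda>z. h (t, z)) has_derivative (\<lambda>v. \<Sum>\<beta>\<in>UNIV. ?y $ \<beta> *
          frechet_derivative (F \<beta>) (at (G t z)) (fst v, t *\<^sub>R snd v) + snd v $ \<beta> * F \<beta> (G t z))) (at z)"
        unfolding h_def fst_conv snd_conv
        by (intro has_derivative_sum has_derivative_mult dy has_derivative_compose[OF dG dF])
      have "frechet_derivative h (at (t, z)) (0, 0, axis \<gamma> 1) = (\<Sum>\<beta>\<in>UNIV. ?y $ \<beta> *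
          frechet_derivative (F \<beta>) (at (G t z)) (0, t *\<^sub>R axis \<gamma> 1) + axis \<gamma> 1 $ \<beta> * F \<beta> (G t z))"
        using fun_cong[OF has_derivative_unique[OF 1 2], of "(0, axis \<gamma> 1)"] by simp
      also have "\<dots> = (\<Sum>\<beta>\<in>UNIV. ?y $ \<beta> * frechet_derivative (F \<beta>) (at (G t z)) (0, t *\<^sub>R axis \<gamma> 1)) +
          (\<Sum>\<beta>\<in>UNIV. (if \<beta> = \<gamma> then F \<beta> (G t z) else 0))"
        unfolding sum.distrib by (intro arg_cong2[where f = "(+)"] sum.cong) (auto simp: axis_def)
      also have "(\<Sum>\<beta>\<in>UNIV. (if \<beta> = \<gamma> then F \<beta> (G t z) else 0)) = F \<gamma> (G t z)" by simp
      also have "(\<Sum>\<beta>\<in>UNIV. ?y $ \<beta> * frechet_derivative (F \<beta>) (at (G t z)) (0, t *\<^sub>R axis \<gamma> 1)) =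
          t * (\<Sum>\<beta>\<in>UNIV. ?y $ \<beta> * frechet_derivative (F \<gamma>) (at (G t z)) (0, axis \<beta> 1))"
        unfolding sum_distrib_left
        using sym[OF GS[OF t z]] linear_scale[OF lF, of _ t "(0, axis \<gamma> 1)"] by (intro sum.cong) auto
      also have "(\<Sum>\<beta>\<in>UNIV. ?y $ \<beta> * frechet_derivative (F \<gamma>) (at (G t z)) (0, axis \<beta> 1)) =
          frechet_derivative (F \<gamma>) (at (G t z)) (\<Sum>\<beta>\<in>UNIV. ?y $ \<beta> *\<^sub>R (0, axis \<beta> 1))"
        by (simp add: linear_sum[OF lF] linear_scale[OF lF] del: scaleR_Pair)
      also have "(\<Sum>\<beta>\<in>UNIV. ?y $ \<beta> *\<^sub>R (0::'e, axis \<beta> (1::real))) = (0, ?y)"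
        by (rule expand)
      finally show ?thesis by simp
    qed
    have "((\<lambda>t. t * F \<gamma> (G t z)) has_vector_derivative
        F \<gamma> (G t z) + t * frechet_derivative (F \<gamma>) (at (G t z)) (0, ?y)) (at t within {0..1})"
      if t: "0 \<le> t" "t \<le> 1" for t
    proof -
      have G: "G s z = (fst z, y0) + s *\<^sub>R (0, ?y)" for s by (simp add: G_def)
      have "smooth_at ((fst z, y0) + t *\<^sub>R (0, ?y)) (F \<gamma>)" using sm[OF GS[OF t z]] by (simp only: G)
      from smooth_at_derivative_along_line[OF this]
      have "((\<lambda>t. F \<gamma> (G t z)) has_real_derivative frechet_derivative (F \<gamma>) (at (G t z)) (0, ?y)) (at t)"
        by (simp only: G)
      from DERIV_mult[OF DERIV_ident this]
      have "((\<lambda>t. t * F \<gamma> (G t z)) has_real_derivative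
        F \<gamma> (G t z) + t * frechet_derivative (F \<gamma>) (at (G t z)) (0, ?y)) (at t)"
        by (simp add: mult.commute)
      then show ?thesis
        by (simp add: has_real_derivative_iff_has_vector_derivative[symmetric] has_field_derivative_at_within)
    qed
    then have "((\<lambda>t. F \<gamma> (G t z) + t * frechet_derivative (F \<gamma>) (at (G t z)) (0, ?y)) has_integral
        1 * F \<gamma> (G 1 z) - 0 * F \<gamma> (G 0 z)) {0..1}"
      by (intro fundamental_theorem_of_calculus) auto
    then have "integral {0..1} (\<lambda>t. F \<gamma> (G t z) + t * frechet_derivative (F \<gamma>) (at (G t z)) (0, ?y)) = F \<gamma> z"
      by (simp add: G_def integral_unique)
    moreover have "frechet_derivative L (at z) (0, axis \<gamma> 1) =
        integral {0..1} (\<lambda>t. frechet_derivative h (at (t, z)) (0, 0, axis \<gamma> 1))"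
      using frechet_derivative_at[OF has_derivative_parameter_integral[OF crd oS smh z]]
      unfolding L_def[abs_def] by metis
    moreover have "integral {0..1} (\<lambda>t. frechet_derivative h (at (t, z)) (0, 0, axis \<gamma> 1)) =
        integral {0..1} (\<lambda>t. F \<gamma> (G t z) + t * frechet_derivative (F \<gamma>) (at (G t z)) (0, ?y))"
      using Dh by (intro integral_cong) auto
    ultimately show "frechet_derivative L (at z) (0, axis \<gamma> 1) = F \<gamma> z" by simp
  qed
qed

section \<open>Charts and tangent vectors\<close>

abbreviation chart_inv :: "('p, 'e) chart \<Rightarrow> 'e \<Rightarrow> 'p" where
  "chart_inv c \<equiv> inv_into (fst c) (snd c)"

lemma smooth_chartD:
  assumes "smooth_chart \<A> c"
  shows chart_open: "open (fst c)"
    and chart_image_open: "open (snd c ` fst c)"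
    and chart_inj: "inj_on (snd c) (fst c)"
    and chart_continuous: "continuous_on (fst c) (snd c)"
    and chart_inv_continuous: "continuous_on (snd c ` fst c) (chart_inv c)"
  using assms by (auto simp: smooth_chart_def topological_chart_def homeomorphism_def split: prod.splits)

lemma chart_inv_chart: "smooth_chart \<A> c \<Longrightarrow> p \<in> fst c \<Longrightarrow> chart_inv c (snd c p) = p"
  by (rule inv_into_f_f[OF chart_inj])

lemma chart_open_image:
  assumes "smooth_chart \<A> c" "open U"
  shows "open (snd c ` (U \<inter> fst c))"
proof -
  have "snd c ` (U \<inter> fst c) = snd c ` fst c \<inter> chart_inv c -` U"
    using chart_inv_chart[OF assms(1)] by force
  then show ?thesis
    using continuous_open_preimage[OF chart_inv_continuous[OF assms(1)] chart_image_open[OF assms(1)] assms(2)]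
    by simp
qed

lemma chart_open_preimage:
  "smooth_chart \<A> c \<Longrightarrow> open W \<Longrightarrow> open (fst c \<inter> snd c -` W)"
  by (rule continuous_open_preimage[OF chart_continuous chart_open])

lemma smooth_transition_smooth_at:
  assumes "smooth_chart \<A> c" "smooth_chart \<A> d" "smooth_transition c d" "p \<in> fst c" "p \<in> fst d"
  shows "smooth_at (snd c p) (\<lambda>z. snd d (chart_inv c z))"
proof -
  have o: "open (snd c ` (fst d \<inter> fst c))"
    by (rule chart_open_image[OF assms(1) chart_open[OF assms(2)]])
  have "smooth_on (snd c ` (fst d \<inter> fst c)) (\<lambda>z. snd d (chart_inv c z))"
    using assms(3) by (cases c, cases d) (simp add: smooth_transition_def o_def Int_commute)
  then show ?thesis using o assms(4,5) unfolding smooth_at_def by blast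
qed

lemma smooth_at_transition:
  fixes k :: "'e::real_normed_vector \<Rightarrow> 'e \<Rightarrow> real" and \<A> :: "('p::t2_space, 'e) atlas"
    and f :: "'p \<Rightarrow> 'f::real_normed_vector"
  assumes "coordinates B k" "smooth_chart \<A> c" "smooth_chart \<A> d" "smooth_transition c d"
    "p \<in> fst c" "p \<in> fst d" "smooth_at (snd d p) (\<lambda>z. f (chart_inv d z))"
  shows "smooth_at (snd c p) (\<lambda>z. f (chart_inv c z))"
proof (rule smooth_at_cong)
  show "smooth_at (snd c p) (\<lambda>z. f (chart_inv d (snd d (chart_inv c z))))"
    by (rule smooth_at_compose[OF assms(1) smooth_transition_smooth_at[OF assms(2-6)]])
      (use assms(7) chart_inv_chart[OF assms(2,5)] in simp)
  show "open (snd c ` (fst d \<inter> fst c))"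
    by (rule chart_open_image[OF assms(2) chart_open[OF assms(3)]])
  show "snd c p \<in> snd c ` (fst d \<inter> fst c)" using assms(5,6) by blast
  show "f (chart_inv d (snd d (chart_inv c z))) = f (chart_inv c z)"
    if "z \<in> snd c ` (fst d \<inter> fst c)" for z
    using that chart_inv_chart[OF assms(2)] chart_inv_chart[OF assms(3)] by auto
qed

text \<open>Used to shrink adapted charts until the base chart lies in the domain of a frame of
  \<open>A\<close>. The restricted chart has a different \<open>inv_into\<close>, which agrees with
  the old one on the smaller image, so transition maps are compared there.\<close>

lemma smooth_chart_restrict:
  assumes "smooth_chart \<A> c" "open U" and atlas: "\<forall>d\<in>\<A>. smooth_chart \<A> d"
  shows "smooth_chart \<A> (fst c \<inter> U, snd c)"
proof -
  let ?c = "(fst c \<inter> U, snd c)"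
  have inj: "inj_on (snd c) (fst c \<inter> U)"
    using chart_inj[OF assms(1)] by (rule inj_on_subset) auto
  have inv: "chart_inv ?c (snd c p) = chart_inv c (snd c p)" if "p \<in> fst c \<inter> U" for p
    using that inv_into_f_f[OF inj that] chart_inv_chart[OF assms(1)] by auto
  have o: "open (snd c ` (fst c \<inter> U))"
    using chart_open_image[OF assms(1,2)] by (simp add: Int_commute)
  have "continuous_on (snd c ` (fst c \<inter> U)) (chart_inv c)"
    using chart_inv_continuous[OF assms(1)] by (rule continuous_on_subset) auto
  then have "continuous_on (snd c ` (fst c \<inter> U)) (chart_inv ?c)"
    by (rule continuous_on_eq) (use inv in auto)
  moreover have "continuous_on (fst c \<inter> U) (snd c)"
    using chart_continuous[OF assms(1)] by (rule continuous_on_subset) auto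
  ultimately have "topological_chart ?c"
    using o inj chart_open[OF assms(1)] assms(2) inv_into_f_f[OF inj]
    by (auto simp: topological_chart_def homeomorphism_def image_image f_inv_into_f)
  moreover have "smooth_transition ?c d \<and> smooth_transition d ?c" if d: "d \<in> \<A>" for d
  proof
    have t: "smooth_transition c d" "smooth_transition d c"
      using assms(1) d by (auto simp: smooth_chart_def)
    have od: "open (fst d)" using atlas d chart_open by blast
    have "open (snd c ` ((U \<inter> fst d) \<inter> fst c))"
      using assms(2) od by (intro chart_open_image[OF assms(1)]) auto
    then have o': "open (snd c ` (fst c \<inter> U \<inter> fst d))" by (simp add: Int_ac)
    have "Ck_on n (snd c ` (fst c \<inter> U \<inter> fst d)) (snd d \<circ> chart_inv ?c)" for n
    proof (rule Ck_on_cong[OF o'])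
      show "Ck_on n (snd c ` (fst c \<inter> U \<inter> fst d)) (snd d \<circ> chart_inv c)"
        by (rule Ck_on_subset[of n "snd c ` (fst c \<inter> fst d)"])
          (use t(1) in \<open>auto simp: smooth_transition_def smooth_on_def split: prod.splits\<close>)
    qed (use inv in auto)
    then show "smooth_transition ?c d"
      by (cases d) (simp add: smooth_transition_def smooth_on_def)
    have "Ck_on n (snd d ` (fst d \<inter> (fst c \<inter> U))) (snd c \<circ> chart_inv d)" for n
      by (rule Ck_on_subset[of n "snd d ` (fst d \<inter> fst c)"])
        (use t(2) in \<open>auto simp: smooth_transition_def smooth_on_def split: prod.splits\<close>)
    then show "smooth_transition d ?c"
      by (cases d) (simp add: smooth_transition_def smooth_on_def)
  qed
  ultimately show ?thesis by (simp add: smooth_chart_def)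
qed

locale smooth_manifold =
  fixes \<A> :: "('p::t2_space, 'e::real_normed_vector) atlas"
  assumes manifold: "manifold \<A>"
begin

lemma model_coordinates:
  obtains B and k :: "'e \<Rightarrow> 'e \<Rightarrow> real" where "coordinates B k"
  using manifold coordinates_exist unfolding manifold_def by metis

lemma atlas_smooth_chart: "c \<in> \<A> \<Longrightarrow> smooth_chart \<A> c"
  using manifold by (simp add: manifold_def)

lemma atlas_chart_at:
  obtains c where "c \<in> \<A>" "p \<in> fst c" "smooth_chart \<A> c"
proof -
  have "p \<in> (\<Union>c\<in>\<A>. fst c)" using manifold by (simp add: manifold_def)
  then show thesis using that atlas_smooth_chart by blast
qed

text \<open>A chart of the maximal atlas is by definition compatible with the charts of
  \<open>\<A>\<close> itself, so the change from \<open>d\<close> to \<open>c\<close> passes through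
  an atlas chart around \<open>p\<close>.\<close>

lemma chart_change:
  fixes f :: "'p \<Rightarrow> 'f::real_normed_vector"
  assumes "smooth_chart \<A> c" "smooth_chart \<A> d" "p \<in> fst c" "p \<in> fst d"
    "smooth_at (snd d p) (\<lambda>z. f (chart_inv d z))"
  shows "smooth_at (snd c p) (\<lambda>z. f (chart_inv c z))"
proof -
  obtain B and k :: "'e \<Rightarrow> 'e \<Rightarrow> real" where k: "coordinates B k" by (rule model_coordinates)
  obtain a where a: "a \<in> \<A>" "p \<in> fst a" "smooth_chart \<A> a" by (rule atlas_chart_at)
  have "smooth_transition c a" "smooth_transition a d"
    using assms(1,2) a(1) by (auto simp: smooth_chart_def)
  then show ?thesis
    using smooth_at_transition[OF k assms(1) a(3) _ assms(3) a(2)]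
      smooth_at_transition[OF k a(3) assms(2) _ a(2) assms(4,5)] by blast
qed

lemma smooth_at_chart_map:
  assumes "smooth_chart \<A> c" "smooth_chart \<A> d" "p \<in> fst c" "p \<in> fst d"
  shows "smooth_at (snd c p) (\<lambda>z. snd d (chart_inv c z))"
proof (rule chart_change[OF assms])
  show "smooth_at (snd d p) (\<lambda>z. snd d (chart_inv d z))"
    by (rule smooth_at_cong[OF smooth_at_id chart_image_open[OF assms(2)]])
      (use assms in \<open>auto simp: f_inv_into_f\<close>)
qed

lemma smooth_near_iff:
  assumes c: "smooth_chart \<A> c" "p \<in> fst c"
  shows "smooth_near \<A> p f \<longleftrightarrow> smooth_at (snd c p) (\<lambda>z. f (chart_inv c z))"
proof
  assume "smooth_near \<A> p f"
  then obtain U where U: "open U" "p \<in> U" "smooth_fun \<A> U f" by (auto simp: smooth_near_def)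
  obtain d where d: "d \<in> \<A>" "p \<in> fst d" "smooth_chart \<A> d" by (rule atlas_chart_at)
  have "smooth_on (snd d ` (U \<inter> fst d)) (\<lambda>z. f (chart_inv d z))"
    using U(3) d(1) by (auto simp: smooth_fun_def o_def split: prod.splits)
  then have "smooth_at (snd d p) (\<lambda>z. f (chart_inv d z))"
    using chart_open_image[OF d(3) U(1)] U(2) d(2) unfolding smooth_at_def by blast
  then show "smooth_at (snd c p) (\<lambda>z. f (chart_inv c z))"
    by (rule chart_change[OF c(1) d(3) c(2) d(2)])
next
  assume "smooth_at (snd c p) (\<lambda>z. f (chart_inv c z))"
  then obtain W where W: "open W" "snd c p \<in> W" "\<And>z. z \<in> W \<Longrightarrow> smooth_at z (\<lambda>z. f (chart_inv c z))"
    using smooth_at_eventually by metis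
  define U where "U = fst c \<inter> snd c -` W"
  have oU: "open U" unfolding U_def by (rule chart_open_preimage[OF c(1) W(1)])
  have "smooth_on (snd d ` (U \<inter> fst d)) (f \<circ> chart_inv d)" if d: "d \<in> \<A>" for d
    using chart_open_image[OF atlas_smooth_chart[OF d] oU]
      chart_change[OF atlas_smooth_chart[OF d] c(1)] W(3)
    by (auto simp: smooth_on_iff_smooth_at U_def o_def)
  then have "smooth_fun \<A> U f" by (auto simp: smooth_fun_def)
  then show "smooth_near \<A> p f" using oU c(2) W(2) by (auto simp: smooth_near_def U_def)
qed

lemma smooth_fun_iff:
  assumes "open U"
  shows "smooth_fun \<A> U f \<longleftrightarrow> (\<forall>p\<in>U. smooth_near \<A> p f)"
proof
  assume "\<forall>p\<in>U. smooth_near \<A> p f"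
  then have "smooth_on (snd d ` (U \<inter> fst d)) (f \<circ> chart_inv d)" if d: "d \<in> \<A>" for d
    using chart_open_image[OF atlas_smooth_chart[OF d] assms] smooth_near_iff[OF atlas_smooth_chart[OF d]]
    by (auto simp: smooth_on_iff_smooth_at o_def)
  then show "smooth_fun \<A> U f" by (auto simp: smooth_fun_def)
qed (use assms in \<open>auto simp: smooth_near_def\<close>)

lemma smooth_near_eventually:
  assumes "smooth_near \<A> p f"
  obtains U where "open U" "p \<in> U" "\<And>q. q \<in> U \<Longrightarrow> smooth_near \<A> q f"
  using assms unfolding smooth_near_def by blast

lemma smooth_near_cong:
  assumes "smooth_near \<A> p f" "open U" "p \<in> U" "\<And>q. q \<in> U \<Longrightarrow> f q = g q"
  shows "smooth_near \<A> p g"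
proof -
  obtain c where c: "c \<in> \<A>" "p \<in> fst c" "smooth_chart \<A> c" by (rule atlas_chart_at)
  show ?thesis
    unfolding smooth_near_iff[OF c(3,2)]
    by (rule smooth_at_cong[OF assms(1)[unfolded smooth_near_iff[OF c(3,2)]] chart_open_image[OF c(3) assms(2)]])
      (use assms(3,4) c chart_inv_chart[OF c(3)] in auto)
qed

lemma smooth_near_const: "smooth_near \<A> p (\<lambda>q. c)"
  by (rule atlas_chart_at[of p]) (auto simp: smooth_near_iff smooth_at_const)

lemma smooth_near_add: "smooth_near \<A> p f \<Longrightarrow> smooth_near \<A> p g \<Longrightarrow> smooth_near \<A> p (\<lambda>q. f q + g q)"
  by (rule atlas_chart_at[of p]) (auto simp: smooth_near_iff smooth_at_add)

lemma smooth_near_mult: "smooth_near \<A> p f \<Longrightarrow> smooth_near \<A> p g \<Longrightarrow> smooth_near \<A> p (\<lambda>q. f q * g q)"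
  by (rule atlas_chart_at[of p]) (auto simp: smooth_near_iff smooth_at_mult)

lemma smooth_near_minus: "smooth_near \<A> p f \<Longrightarrow> smooth_near \<A> p (\<lambda>q. - f q)"
  using smooth_near_mult[OF smooth_near_const[of p "- 1"], of f] by simp

lemma smooth_near_diff: "smooth_near \<A> p f \<Longrightarrow> smooth_near \<A> p g \<Longrightarrow> smooth_near \<A> p (\<lambda>q. f q - g q)"
  using smooth_near_add[OF _ smooth_near_minus, of p f g] by simp

lemma smooth_near_sum:
  "(\<And>i. i \<in> I \<Longrightarrow> smooth_near \<A> p (f i)) \<Longrightarrow> smooth_near \<A> p (\<lambda>q. \<Sum>i\<in>I. f i q)"
  by (induction I rule: infinite_finite_induct) (auto intro: smooth_near_const smooth_near_add)

lemma smooth_near_prod: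
  "(\<And>i. i \<in> I \<Longrightarrow> smooth_near \<A> p (f i)) \<Longrightarrow> smooth_near \<A> p (\<lambda>q. \<Prod>i\<in>I. f i q)"
  by (induction I rule: infinite_finite_induct) (auto intro: smooth_near_const smooth_near_mult)

lemma smooth_near_inverse: "smooth_near \<A> p f \<Longrightarrow> f p \<noteq> 0 \<Longrightarrow> smooth_near \<A> p (\<lambda>q. inverse (f q))"
  by (rule atlas_chart_at[of p]) (auto simp: smooth_near_iff smooth_at_inverse chart_inv_chart)

section \<open>Tangent vectors as derivations\<close>

lemma tvec_apply:
  assumes "smooth_near \<A> p f"
  shows "tvec \<A> c p w f = frechet_derivative (\<lambda>z. f (chart_inv c z)) (at (snd c p)) w"
  using assms by (cases c) (simp add: tvec_def o_def)

lemma tvec_not_smooth: "\<not> smooth_near \<A> p f \<Longrightarrow> tvec \<A> c p w f = 0"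
  by (cases c) (simp add: tvec_def)

lemma has_derivative_in_chart:
  assumes "smooth_chart \<A> c" "p \<in> fst c" "smooth_near \<A> p f"
  shows "((\<lambda>z. f (chart_inv c z)) has_derivative (\<lambda>w. tvec \<A> c p w f)) (at (snd c p))"
  unfolding tvec_apply[OF assms(3)]
  using smooth_at_differentiable assms(3) unfolding smooth_near_iff[OF assms(1,2)] by blast

lemma tvec_eqI:
  assumes "\<And>f. smooth_near \<A> p f \<Longrightarrow> tvec \<A> c p w f = v f" "\<And>f. \<not> smooth_near \<A> p f \<Longrightarrow> v f = 0"
  shows "tvec \<A> c p w = v"
  using assms tvec_not_smooth by (metis ext)

lemma tvec_add:
  assumes "smooth_chart \<A> c" "p \<in> fst c"
  shows "tvec \<A> c p (w + w') = tvec \<A> c p w + tvec \<A> c p w'"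
proof (rule tvec_eqI)
  fix f assume "smooth_near \<A> p f"
  then have "linear (\<lambda>w. tvec \<A> c p w f)"
    by (rule has_derivative_linear[OF has_derivative_in_chart[OF assms]])
  then show "tvec \<A> c p (w + w') f = (tvec \<A> c p w + tvec \<A> c p w') f"
    by (simp add: linear_add[of "\<lambda>w. tvec \<A> c p w f"])
qed (simp add: tvec_not_smooth)

lemma tvec_scale:
  assumes "smooth_chart \<A> c" "p \<in> fst c"
  shows "tvec \<A> c p (r *\<^sub>R w) = r *\<^sub>R tvec \<A> c p w"
proof (rule tvec_eqI)
  fix f assume "smooth_near \<A> p f"
  then have "linear (\<lambda>w. tvec \<A> c p w f)"
    by (rule has_derivative_linear[OF has_derivative_in_chart[OF assms]])
  then show "tvec \<A> c p (r *\<^sub>R w) f = (r *\<^sub>R tvec \<A> c p w) f"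
    by (simp add: linear_scale[of "\<lambda>w. tvec \<A> c p w f"] scaleR_fun_def)
qed (simp add: tvec_not_smooth scaleR_fun_def)

lemma linear_tvec: "smooth_chart \<A> c \<Longrightarrow> p \<in> fst c \<Longrightarrow> linear (tvec \<A> c p)"
  by (intro linearI tvec_add tvec_scale)

lemma tvec_change:
  assumes "smooth_chart \<A> c" "smooth_chart \<A> d" "p \<in> fst c" "p \<in> fst d"
  shows "tvec \<A> c p w =
    tvec \<A> d p (frechet_derivative (\<lambda>z. snd d (chart_inv c z)) (at (snd c p)) w)"
proof (rule tvec_eqI)
  fix f assume f: "smooth_near \<A> p f"
  have T: "((\<lambda>z. snd d (chart_inv c z)) has_derivative
      frechet_derivative (\<lambda>z. snd d (chart_inv c z)) (at (snd c p))) (at (snd c p))"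
    by (rule smooth_at_differentiable[OF smooth_at_chart_map[OF assms]])
  have "((\<lambda>z. f (chart_inv d (snd d (chart_inv c z)))) has_derivative
      (\<lambda>w. tvec \<A> d p (frechet_derivative (\<lambda>z. snd d (chart_inv c z)) (at (snd c p)) w) f)) (at (snd c p))"
    by (rule has_derivative_compose[OF T])
      (use has_derivative_in_chart[OF assms(2,4) f] chart_inv_chart[OF assms(1,3)] in simp)
  then have "((\<lambda>z. f (chart_inv c z)) has_derivative
      (\<lambda>w. tvec \<A> d p (frechet_derivative (\<lambda>z. snd d (chart_inv c z)) (at (snd c p)) w) f)) (at (snd c p))"
    by (rule has_derivative_transform_within_open[OF _ chart_open_image[OF assms(1) chart_open[OF assms(2)]]])
      (use assms chart_inv_chart[OF assms(1)] chart_inv_chart[OF assms(2)] in auto)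
  from has_derivative_unique[OF has_derivative_in_chart[OF assms(1,3) f] this]
  show "tvec \<A> c p w f = tvec \<A> d p (frechet_derivative (\<lambda>z. snd d (chart_inv c z)) (at (snd c p)) w) f"
    by metis
qed (simp add: tvec_not_smooth)

text \<open>\<open>tangent_space\<close> is built from atlas charts; by the chain rule any single
  chart of the maximal atlas represents all tangent vectors at the point, in particular an adapted
  chart does.\<close>

lemma tangent_space_eq:
  assumes "smooth_chart \<A> c" "p \<in> fst c"
  shows "tangent_space \<A> p = range (tvec \<A> c p)"
proof -
  obtain a where a: "a \<in> \<A>" "p \<in> fst a" "smooth_chart \<A> a" by (rule atlas_chart_at)
  show ?thesis
    using tvec_change[OF assms(1) a(3) assms(2) a(2)] tvec_change[OF atlas_smooth_chart assms(1) _ assms(2)] a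
    unfolding tangent_space_def by blast
qed

lemma chart_coordinate:
  assumes "smooth_chart \<A> c" "p \<in> fst c" "bounded_linear l"
  shows smooth_near_chart_coordinate: "smooth_near \<A> p (\<lambda>q. l (snd c q))"
    and tvec_chart_coordinate: "tvec \<A> c p w (\<lambda>q. l (snd c q)) = l w"
proof -
  show s: "smooth_near \<A> p (\<lambda>q. l (snd c q))"
    unfolding smooth_near_iff[OF assms(1,2)]
    by (intro smooth_at_bounded_linear[OF assms(3)] smooth_at_chart_map assms)
  have "((\<lambda>z. l (snd c (chart_inv c z))) has_derivative l) (at (snd c p))"
    by (rule has_derivative_transform_within_open[OF bounded_linear_imp_has_derivative[OF assms(3)]
          chart_image_open[OF assms(1)]])
      (use assms in \<open>auto simp: f_inv_into_f\<close>)
  from has_derivative_unique[OF has_derivative_in_chart[OF assms(1,2) s] this]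
  show "tvec \<A> c p w (\<lambda>q. l (snd c q)) = l w" by metis
qed

text \<open>Coordinate functionals composed with the chart are smooth, and on them a tangent vector
  returns its components.\<close>

lemma tvec_inject:
  assumes "smooth_chart \<A> c" "p \<in> fst c" "tvec \<A> c p w = tvec \<A> c p w'"
  shows "w = w'"
proof -
  obtain B and k :: "'e \<Rightarrow> 'e \<Rightarrow> real" where k: "coordinates B k" by (rule model_coordinates)
  show ?thesis
    by (rule coordinates_eqD[OF k])
      (use k assms tvec_chart_coordinate[OF assms(1,2)] in \<open>metis coordinates_def\<close>)
qed

lemma components_tvec: "smooth_chart \<A> c \<Longrightarrow> p \<in> fst c \<Longrightarrow> components \<A> c p (tvec \<A> c p w) = w"
  unfolding components_def using tvec_inject by blast

lemma tvec_components:
  assumes "smooth_chart \<A> c" "p \<in> fst c" "v \<in> tangent_space \<A> p"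
  shows "tvec \<A> c p (components \<A> c p v) = v"
  using assms tangent_space_eq[OF assms(1,2)] components_tvec[OF assms(1,2)] by auto

lemma tangent_zero: "0 \<in> tangent_space \<A> p"
  by (rule atlas_chart_at[of p]) (metis linear_0 linear_tvec rangeI tangent_space_eq)

lemma tangent_plus: "u \<in> tangent_space \<A> p \<Longrightarrow> v \<in> tangent_space \<A> p \<Longrightarrow> u + v \<in> tangent_space \<A> p"
  by (rule atlas_chart_at[of p]) (auto simp: tangent_space_eq tvec_add[symmetric])

lemma tangent_scaleR: "v \<in> tangent_space \<A> p \<Longrightarrow> r *\<^sub>R v \<in> tangent_space \<A> p"
  by (rule atlas_chart_at[of p]) (auto simp: tangent_space_eq tvec_scale[symmetric])

lemma tangent_not_smooth: "v \<in> tangent_space \<A> p \<Longrightarrow> \<not> smooth_near \<A> p f \<Longrightarrow> v f = 0"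
  by (auto simp: tangent_space_def tvec_not_smooth)

lemma tangent_obtain:
  assumes "v \<in> tangent_space \<A> p"
  obtains c w where "smooth_chart \<A> c" "p \<in> fst c" "v = tvec \<A> c p w"
  using assms atlas_smooth_chart unfolding tangent_space_def by blast

lemma tangent_add:
  assumes "v \<in> tangent_space \<A> p" "smooth_near \<A> p f" "smooth_near \<A> p g"
  shows "v (\<lambda>q. f q + g q) = v f + v g"
proof -
  obtain c w where c: "smooth_chart \<A> c" "p \<in> fst c" and v: "v = tvec \<A> c p w"
    using assms(1) by (rule tangent_obtain)
  note d = has_derivative_in_chart[OF c]
  show ?thesis
    using has_derivative_unique[OF d[OF smooth_near_add[OF assms(2,3)]]
        has_derivative_add[OF d[OF assms(2)] d[OF assms(3)]]]
    unfolding v by metis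
qed

lemma tangent_mult:
  assumes "v \<in> tangent_space \<A> p" "smooth_near \<A> p f" "smooth_near \<A> p g"
  shows "v (\<lambda>q. f q * g q) = f p * v g + v f * g p"
proof -
  obtain c w where c: "smooth_chart \<A> c" "p \<in> fst c" and v: "v = tvec \<A> c p w"
    using assms(1) by (rule tangent_obtain)
  note d = has_derivative_in_chart[OF c]
  show ?thesis
    using fun_cong[OF has_derivative_unique[OF d[OF smooth_near_mult[OF assms(2,3)]]
        has_derivative_mult[OF d[OF assms(2)] d[OF assms(3)]]], of w]
    unfolding v by (simp add: chart_inv_chart[OF c])
qed

lemma tangent_const:
  assumes "v \<in> tangent_space \<A> p"
  shows "v (\<lambda>q. r) = 0"
proof -
  obtain c w where c: "smooth_chart \<A> c" "p \<in> fst c" and v: "v = tvec \<A> c p w"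
    using assms by (rule tangent_obtain)
  show ?thesis
    using has_derivative_unique[OF has_derivative_in_chart[OF c smooth_near_const] has_derivative_const]
    unfolding v by metis
qed

lemma tangent_cmult: "v \<in> tangent_space \<A> p \<Longrightarrow> smooth_near \<A> p f \<Longrightarrow> v (\<lambda>q. r * f q) = r * v f"
  using tangent_mult[of v p "\<lambda>q. r" f] by (simp add: smooth_near_const tangent_const)

lemma tangent_minus: "v \<in> tangent_space \<A> p \<Longrightarrow> smooth_near \<A> p f \<Longrightarrow> v (\<lambda>q. - f q) = - v f"
  using tangent_cmult[of v p f "- 1"] by simp

lemma tangent_diff:
  "v \<in> tangent_space \<A> p \<Longrightarrow> smooth_near \<A> p f \<Longrightarrow> smooth_near \<A> p g \<Longrightarrow> v (\<lambda>q. f q - g q) = v f - v g"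
  using tangent_add[of v p f "\<lambda>q. - g q"] by (simp add: tangent_minus smooth_near_minus)

lemma tangent_sum:
  assumes "v \<in> tangent_space \<A> p" "\<And>i. i \<in> I \<Longrightarrow> smooth_near \<A> p (f i)"
  shows "v (\<lambda>q. \<Sum>i\<in>I. f i q) = (\<Sum>i\<in>I. v (f i))"
  using assms(2)
  by (induction I rule: infinite_finite_induct)
    (auto simp: tangent_const[OF assms(1)] tangent_add[OF assms(1)] smooth_near_sum)

text \<open>When \<open>f\<close> fails to be smooth near \<open>p\<close>, so does
  \<open>g\<close>, and both values are the default zero; hence the rule can be applied before
  smoothness is known.\<close>

lemma tangent_cong:
  assumes "v \<in> tangent_space \<A> p" "open U" "p \<in> U" "\<And>q. q \<in> U \<Longrightarrow> f q = g q"
  shows "v f = v g"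
proof (cases "smooth_near \<A> p f")
  case True
  obtain c w where c: "smooth_chart \<A> c" "p \<in> fst c" and v: "v = tvec \<A> c p w"
    using assms(1) by (rule tangent_obtain)
  have g: "smooth_near \<A> p g" by (rule smooth_near_cong[OF True assms(2-4)])
  have "((\<lambda>z. g (chart_inv c z)) has_derivative (\<lambda>w. tvec \<A> c p w f)) (at (snd c p))"
    by (rule has_derivative_transform_within_open[OF has_derivative_in_chart[OF c True] chart_open_image[OF c(1) assms(2)]])
      (use c assms chart_inv_chart[OF c(1)] in auto)
  from has_derivative_unique[OF this has_derivative_in_chart[OF c g]]
  show ?thesis unfolding v by metis
next
  case False
  then have "\<not> smooth_near \<A> p g" using smooth_near_cong[OF _ assms(2,3), of g f] assms(4) by metis
  then show ?thesis using False tangent_not_smooth[OF assms(1)] by simp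
qed

lemma tvec_in_chart_eventually:
  assumes "smooth_chart \<A> c" "p \<in> fst c" "smooth_near \<A> p f"
  obtains W where "open W" "snd c p \<in> W" "\<And>z. z \<in> W \<Longrightarrow>
    chart_inv c z \<in> fst c \<and> snd c (chart_inv c z) = z \<and>
    tvec \<A> c (chart_inv c z) w f = frechet_derivative (\<lambda>z. f (chart_inv c z)) (at z) w"
proof -
  obtain U where U: "open U" "p \<in> U" "\<And>q. q \<in> U \<Longrightarrow> smooth_near \<A> q f"
    using smooth_near_eventually[OF assms(3)] by blast
  show thesis
    by (rule that[OF chart_open_image[OF assms(1) U(1)]])
      (use U assms chart_inv_chart[OF assms(1)] in \<open>auto simp: tvec_apply\<close>)
qed

lemma smooth_near_tvec:
  assumes "smooth_chart \<A> c" "p \<in> fst c" "smooth_near \<A> p f"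
  shows "smooth_near \<A> p (\<lambda>q. tvec \<A> c q w f)"
proof -
  obtain W where W: "open W" "snd c p \<in> W" "\<And>z. z \<in> W \<Longrightarrow>
    chart_inv c z \<in> fst c \<and> snd c (chart_inv c z) = z \<and>
    tvec \<A> c (chart_inv c z) w f = frechet_derivative (\<lambda>z. f (chart_inv c z)) (at z) w"
    using tvec_in_chart_eventually[OF assms] by blast
  have "smooth_at (snd c p) (\<lambda>z. frechet_derivative (\<lambda>z. f (chart_inv c z)) (at z) w)"
    using assms(3) unfolding smooth_near_iff[OF assms(1,2)] by (rule smooth_at_derivative)
  then show ?thesis
    unfolding smooth_near_iff[OF assms(1,2)] by (rule smooth_at_cong[OF _ W(1,2)]) (use W(3) in simp)
qed

text \<open>With components constant in one chart, both sides are iterated partial derivatives in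
  the model space.\<close>

lemma tvec_commute:
  assumes "smooth_chart \<A> c" "p \<in> fst c" "smooth_near \<A> p f"
  shows "tvec \<A> c p u (\<lambda>q. tvec \<A> c q w f) = tvec \<A> c p w (\<lambda>q. tvec \<A> c q u f)"
proof -
  let ?f = "\<lambda>z. f (chart_inv c z)"
  have sf: "smooth_at (snd c p) ?f" using assms(3) unfolding smooth_near_iff[OF assms(1,2)] .
  have *: "tvec \<A> c p u (\<lambda>q. tvec \<A> c q w f) =
    frechet_derivative (\<lambda>z. frechet_derivative ?f (at z) w) (at (snd c p)) u" for u w
  proof -
    obtain W where W: "open W" "snd c p \<in> W" "\<And>z. z \<in> W \<Longrightarrow>
      chart_inv c z \<in> fst c \<and> snd c (chart_inv c z) = z \<and>
      tvec \<A> c (chart_inv c z) w f = frechet_derivative ?f (at z) w"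
      using tvec_in_chart_eventually[OF assms] by blast
    have "((\<lambda>z. tvec \<A> c (chart_inv c z) w f) has_derivative
        frechet_derivative (\<lambda>z. frechet_derivative ?f (at z) w) (at (snd c p))) (at (snd c p))"
      by (rule has_derivative_transform_within_open[OF
            smooth_at_differentiable[OF smooth_at_derivative[OF sf]] W(1,2)]) (use W(3) in simp)
    from has_derivative_unique[OF has_derivative_in_chart[OF assms(1,2) smooth_near_tvec[OF assms]] this]
    show ?thesis by metis
  qed
  show ?thesis unfolding * by (rule second_derivative_symmetric[OF sf])
qed

end

section \<open>Sections of vector bundles\<close>

lemma is_basis_ofD:
  fixes b :: "'i::finite \<Rightarrow> 'v::real_vector"
  assumes "is_basis_of b W"
  shows is_basis_of_subspace: "subspace W"
    and is_basis_of_expand: "z \<in> W \<Longrightarrow> \<exists>c. z = (\<Sum>i\<in>UNIV. c i *\<^sub>R b i)"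
    and is_basis_of_zero: "(\<Sum>i\<in>UNIV. c i *\<^sub>R b i) = 0 \<Longrightarrow> c i = 0"
proof -
  have b: "inj b" "independent (range b)" "span (range b) = W"
    using assms by (auto simp: is_basis_of_def)
  show "subspace W" using b(3) by auto
  show "\<exists>c. z = (\<Sum>i\<in>UNIV. c i *\<^sub>R b i)" if "z \<in> W"
  proof -
    have "z \<in> range (\<lambda>u. \<Sum>v\<in>range b. u v *\<^sub>R v)"
      using that unfolding b(3)[symmetric] span_finite[OF finite_imageI[OF finite]] .
    then obtain u where u: "z = (\<Sum>v\<in>range b. u v *\<^sub>R v)" by blast
    then show ?thesis using b(1) by (auto simp: sum.reindex)
  qed
  show "c i = 0" if "(\<Sum>i\<in>UNIV. c i *\<^sub>R b i) = 0"
  proof -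
    have "(\<Sum>v\<in>range b. c (inv b v) *\<^sub>R v) = 0"
      using that b(1) by (simp add: sum.reindex)
    then have "\<forall>v\<in>range b. c (inv b v) = 0"
      using independentD[OF b(2) finite_imageI[OF finite] order_refl, of "\<lambda>v. c (inv b v)"] by blast
    then show ?thesis using b(1) by auto
  qed
qed

lemma is_basis_of_unique:
  fixes b :: "'i::finite \<Rightarrow> 'v::real_vector"
  assumes "is_basis_of b W" "(\<Sum>i\<in>UNIV. c i *\<^sub>R b i) = (\<Sum>i\<in>UNIV. c' i *\<^sub>R b i)"
  shows "c i = c' i"
  using is_basis_of_zero[OF assms(1), of "\<lambda>i. c i - c' i" i] assms(2)
  by (simp add: scaleR_diff_left sum_subtractf)

lemma is_basis_ofI:
  fixes b :: "'i::finite \<Rightarrow> 'v::real_vector"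
  assumes "subspace W" "\<And>i. b i \<in> W" "\<And>z. z \<in> W \<Longrightarrow> \<exists>c. z = (\<Sum>i\<in>UNIV. c i *\<^sub>R b i)"
    "\<And>c i. (\<Sum>i\<in>UNIV. c i *\<^sub>R b i) = 0 \<Longrightarrow> c i = 0"
  shows "is_basis_of b W"
proof -
  have inj: "inj b"
  proof (rule injI, rule ccontr)
    fix i j assume ij: "b i = b j" "i \<noteq> j"
    let ?c = "\<lambda>l. if l = i then 1 else if l = j then - 1 else (0::real)"
    have "(\<Sum>l\<in>UNIV. ?c l *\<^sub>R b l) = (\<Sum>l\<in>{i, j}. ?c l *\<^sub>R b l)"
      by (intro sum.mono_neutral_right) auto
    also have "\<dots> = 0" using ij by simp
    finally show False using assms(4)[of ?c i] by simp
  qed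
  have "independent (range b)"
  proof (rule independent_if_scalars_zero)
    fix f v assume f: "(\<Sum>x\<in>range b. f x *\<^sub>R x) = 0" and v: "v \<in> range b"
    then show "f v = 0" using assms(4)[of "\<lambda>i. f (b i)"] inj by (auto simp: sum.reindex)
  qed auto
  moreover have "span (range b) = W"
  proof
    show "span (range b) \<subseteq> W" using assms(1,2) by (intro span_minimal) auto
    show "W \<subseteq> span (range b)"
    proof
      fix z assume "z \<in> W"
      then obtain c where "z = (\<Sum>i\<in>UNIV. c i *\<^sub>R b i)" using assms(3) by blast
      then show "z \<in> span (range b)" by (simp add: span_sum span_scale span_base)
    qed
  qed
  ultimately show ?thesis using inj by (simp add: is_basis_of_def)
qed

locale smooth_bundle =
  fixes E :: "('i::finite, 'p::t2_space, 'e::real_normed_vector, 'v::real_vector) algebroid"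
  assumes vector_bundle: "vector_bundle E"
begin

sublocale smooth_manifold "base_atlas E"
  using vector_bundle by unfold_locales (simp add: vector_bundle_def)

lemma frame_at:
  obtains V e where "(V, e) \<in> frames E" "p \<in> V" "local_frame E V e" "open V"
proof -
  have "p \<in> (\<Union>F\<in>frames E. fst F)" using vector_bundle by (simp add: vector_bundle_def)
  then obtain V e where "(V, e) \<in> frames E" "p \<in> V" by auto
  then show thesis using that vector_bundle by (auto simp: vector_bundle_def local_frame_def)
qed

lemma frame_open: "(V, e) \<in> frames E \<Longrightarrow> open V"
  using vector_bundle by (auto simp: vector_bundle_def local_frame_def)

lemma fibre_subspace: "subspace (fibre E p)"
proof -
  obtain V e where "(V, e) \<in> frames E" "p \<in> V" "local_frame E V e" "open V" by (rule frame_at)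
  then show ?thesis using is_basis_of_subspace unfolding local_frame_def by blast
qed

lemma section_fibre: "smooth_section E U X \<Longrightarrow> p \<in> U \<Longrightarrow> X p \<in> fibre E p"
  by (simp add: smooth_section_def)

lemma smooth_section_iff:
  assumes "open U"
  shows "smooth_section E U X \<longleftrightarrow> (\<forall>p\<in>U. X p \<in> fibre E p) \<and>
    (\<forall>(V, e)\<in>frames E. \<exists>c. \<forall>p\<in>U \<inter> V. (\<forall>i. smooth_near (base_atlas E) p (c i)) \<and>
      X p = (\<Sum>i\<in>UNIV. c i p *\<^sub>R e i p))"
proof -
  have "(\<exists>c. (\<forall>i. smooth_fun (base_atlas E) (U \<inter> V) (c i)) \<and> (\<forall>p\<in>U \<inter> V. X p = (\<Sum>i\<in>UNIV. c i p *\<^sub>R e i p)))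
    \<longleftrightarrow> (\<exists>c. \<forall>p\<in>U \<inter> V. (\<forall>i. smooth_near (base_atlas E) p (c i)) \<and> X p = (\<Sum>i\<in>UNIV. c i p *\<^sub>R e i p))"
    if "(V, e) \<in> frames E" for V e
    by (intro ex_cong1) (auto simp: smooth_fun_iff[OF open_Int[OF assms frame_open[OF that]]])
  then show ?thesis
    unfolding smooth_section_def by (intro arg_cong2[where f = "(\<and>)"] refl ball_cong) (simp only: case_prod_beta prod.collapse)
qed

lemma smooth_sectionE:
  assumes "open U" "smooth_section E U X" "(V, e) \<in> frames E"
  obtains c where "\<And>p i. p \<in> U \<inter> V \<Longrightarrow> smooth_near (base_atlas E) p (c i)"
    "\<And>p. p \<in> U \<inter> V \<Longrightarrow> X p = (\<Sum>i\<in>UNIV. c i p *\<^sub>R e i p)"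
  using assms unfolding smooth_section_iff[OF assms(1)] by fast

lemma smooth_sectionI:
  assumes "open U" "\<And>p. p \<in> U \<Longrightarrow> X p \<in> fibre E p"
    "\<And>V e. (V, e) \<in> frames E \<Longrightarrow> \<exists>c. \<forall>p\<in>U \<inter> V. (\<forall>i. smooth_near (base_atlas E) p (c i)) \<and>
      X p = (\<Sum>i\<in>UNIV. c i p *\<^sub>R e i p)"
  shows "smooth_section E U X"
  using assms unfolding smooth_section_iff[OF assms(1)] by fast

lemma smooth_section_subset:
  assumes "smooth_section E U X" "open U" "open W" "W \<subseteq> U"
  shows "smooth_section E W X"
proof (rule smooth_sectionI[OF assms(3)])
  fix V e assume e: "(V, e) \<in> frames E"
  show "\<exists>c. \<forall>p\<in>W \<inter> V. (\<forall>i. smooth_near (base_atlas E) p (c i)) \<and> X p = (\<Sum>i\<in>UNIV. c i p *\<^sub>R e i p)"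
    by (rule smooth_sectionE[OF assms(2,1) e]) (use assms(4) in blast)
qed (use assms section_fibre in blast)

lemma smooth_section_cong:
  assumes "smooth_section E U X" "open U" "\<And>p. p \<in> U \<Longrightarrow> X p = Y p"
  shows "smooth_section E U Y"
  using assms unfolding smooth_section_iff[OF assms(2)] by (simp add: Ball_def)

lemma smooth_section_zero: "open U \<Longrightarrow> smooth_section E U (\<lambda>p. 0)"
  by (rule smooth_sectionI)
    (auto simp: subspace_0[OF fibre_subspace] intro!: exI[of _ "\<lambda>i p. 0"] smooth_near_const)

lemma smooth_section_add:
  assumes "open U" "smooth_section E U X" "smooth_section E U Y"
  shows "smooth_section E U (\<lambda>p. X p + Y p)"
proof (rule smooth_sectionI[OF assms(1)])
  fix V e assume e: "(V, e) \<in> frames E"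
  obtain c where c: "\<And>p i. p \<in> U \<inter> V \<Longrightarrow> smooth_near (base_atlas E) p (c i)"
    "\<And>p. p \<in> U \<inter> V \<Longrightarrow> X p = (\<Sum>i\<in>UNIV. c i p *\<^sub>R e i p)"
    using smooth_sectionE[OF assms(1,2) e] by blast
  obtain d where d: "\<And>p i. p \<in> U \<inter> V \<Longrightarrow> smooth_near (base_atlas E) p (d i)"
    "\<And>p. p \<in> U \<inter> V \<Longrightarrow> Y p = (\<Sum>i\<in>UNIV. d i p *\<^sub>R e i p)"
    using smooth_sectionE[OF assms(1,3) e] by blast
  show "\<exists>c. \<forall>p\<in>U \<inter> V. (\<forall>i. smooth_near (base_atlas E) p (c i)) \<and> X p + Y p = (\<Sum>i\<in>UNIV. c i p *\<^sub>R e i p)"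
    by (rule exI[of _ "\<lambda>i p. c i p + d i p"])
      (auto simp: c d scaleR_add_left sum.distrib intro!: smooth_near_add)
qed (use assms section_fibre fibre_subspace subspace_add in blast)

lemma smooth_section_scale:
  assumes "open U" "\<And>p. p \<in> U \<Longrightarrow> smooth_near (base_atlas E) p f" "smooth_section E U X"
  shows "smooth_section E U (\<lambda>p. f p *\<^sub>R X p)"
proof (rule smooth_sectionI[OF assms(1)])
  fix V e assume e: "(V, e) \<in> frames E"
  obtain c where c: "\<And>p i. p \<in> U \<inter> V \<Longrightarrow> smooth_near (base_atlas E) p (c i)"
    "\<And>p. p \<in> U \<inter> V \<Longrightarrow> X p = (\<Sum>i\<in>UNIV. c i p *\<^sub>R e i p)"
    using smooth_sectionE[OF assms(1,3) e] by blast
  show "\<exists>c. \<forall>p\<in>U \<inter> V. (\<forall>i. smooth_near (base_atlas E) p (c i)) \<and> f p *\<^sub>R X p = (\<Sum>i\<in>UNIV. c i p *\<^sub>R e i p)"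
    by (rule exI[of _ "\<lambda>i p. f p * c i p"])
      (auto simp: c scaleR_sum_right assms(2) intro!: smooth_near_mult)
qed (use assms section_fibre fibre_subspace subspace_scale in blast)

lemma smooth_section_minus:
  "open U \<Longrightarrow> smooth_section E U X \<Longrightarrow> smooth_section E U (\<lambda>p. - X p)"
  using smooth_section_scale[of U "\<lambda>p. - 1" X] by (simp add: smooth_near_const)

lemma smooth_section_diff:
  "open U \<Longrightarrow> smooth_section E U X \<Longrightarrow> smooth_section E U Y \<Longrightarrow> smooth_section E U (\<lambda>p. X p - Y p)"
  using smooth_section_add[OF _ _ smooth_section_minus] by simp

lemma smooth_section_sum:
  "open U \<Longrightarrow> (\<And>i. i \<in> I \<Longrightarrow> smooth_section E U (X i)) \<Longrightarrow> smooth_section E U (\<lambda>p. \<Sum>i\<in>I. X i p)"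
  by (induction I rule: infinite_finite_induct) (auto intro: smooth_section_zero smooth_section_add)

lemma section_through:
  assumes "z \<in> fibre E p"
  obtains U X where "open U" "p \<in> U" "smooth_section E U X" "X p = z"
proof -
  obtain V e where e: "(V, e) \<in> frames E" "p \<in> V" "local_frame E V e" "open V" by (rule frame_at)
  then obtain c where c: "z = (\<Sum>i\<in>UNIV. c i *\<^sub>R e i p)"
    using is_basis_of_expand assms unfolding local_frame_def by metis
  have "smooth_section E V (\<lambda>q. \<Sum>i\<in>UNIV. c i *\<^sub>R e i q)"
    using e(3) by (intro smooth_section_sum smooth_section_scale e(4) smooth_near_const) (auto simp: local_frame_def)
  then show thesis using that e(2,4) c by blast
qed

lemma smooth_near_det:
  fixes M :: "'p \<Rightarrow> real ^ 'n ^ 'n"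
  assumes "\<And>i j. smooth_near (base_atlas E) p (\<lambda>q. M q $ i $ j)"
  shows "smooth_near (base_atlas E) p (\<lambda>q. det (M q))"
  unfolding det_def
  by (intro smooth_near_sum smooth_near_mult smooth_near_const smooth_near_prod assms)

text \<open>By Cramer's rule, the coefficients are quotients of determinants of smooth functions.\<close>

lemma local_frame_coefficients:
  assumes "open U" "smooth_section E U X" "local_frame E U' e"
  obtains c where "\<And>p i. p \<in> U \<inter> U' \<Longrightarrow> smooth_near (base_atlas E) p (c i)"
    "\<And>p. p \<in> U \<inter> U' \<Longrightarrow> X p = (\<Sum>i\<in>UNIV. c i p *\<^sub>R e i p)"
proof -
  have U': "open U'" and se: "\<And>i. smooth_section E U' (e i)"
    and basis: "\<And>p. p \<in> U' \<Longrightarrow> is_basis_of (\<lambda>i. e i p) (fibre E p)"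
    using assms(3) by (auto simp: local_frame_def)
  have "\<forall>p\<in>U \<inter> U'. \<exists>c. X p = (\<Sum>i\<in>UNIV. c i *\<^sub>R e i p)"
    using is_basis_of_expand[OF basis] section_fibre[OF assms(2)] by blast
  then obtain c0 where c0: "\<And>p. p \<in> U \<inter> U' \<Longrightarrow> X p = (\<Sum>i\<in>UNIV. c0 p i *\<^sub>R e i p)" by metis
  define c where "c i p = c0 p i" for i p
  have c: "X p = (\<Sum>i\<in>UNIV. c i p *\<^sub>R e i p)" if "p \<in> U \<inter> U'" for p
    using c0[OF that] by (simp add: c_def)
  have "smooth_near (base_atlas E) p (c k)" if p: "p \<in> U \<inter> U'" for p k
  proof -
    obtain V f where f: "(V, f) \<in> frames E" "p \<in> V" "local_frame E V f" "open V" by (rule frame_at)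
    have bf: "is_basis_of (\<lambda>i. f i q) (fibre E q)" if "q \<in> V" for q
      using f(3) that by (simp add: local_frame_def)
    obtain b where b: "\<And>q i. q \<in> U \<inter> V \<Longrightarrow> smooth_near (base_atlas E) q (b i)"
      "\<And>q. q \<in> U \<inter> V \<Longrightarrow> X q = (\<Sum>i\<in>UNIV. b i q *\<^sub>R f i q)"
      using smooth_sectionE[OF assms(1,2) f(1)] by blast
    have "\<forall>i. \<exists>m. (\<forall>q\<in>U' \<inter> V. \<forall>j. smooth_near (base_atlas E) q (m j)) \<and>
      (\<forall>q\<in>U' \<inter> V. e i q = (\<Sum>j\<in>UNIV. m j q *\<^sub>R f j q))"
      using smooth_sectionE[OF U' se f(1)] by metis
    then obtain m where m: "\<And>i q j. q \<in> U' \<inter> V \<Longrightarrow> smooth_near (base_atlas E) q (m i j)"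
      "\<And>i q. q \<in> U' \<inter> V \<Longrightarrow> e i q = (\<Sum>j\<in>UNIV. m i j q *\<^sub>R f j q)" by metis
    \<comment> \<open>Column \<open>i\<close> of \<open>M q\<close> holds the components of
      \<open>e i q\<close> in the bundle frame \<open>f\<close>.\<close>
    define M where "M q = (\<chi> j i. m i j q)" for q
    have comb: "(\<Sum>i\<in>UNIV. x i *\<^sub>R e i q) = (\<Sum>j\<in>UNIV. (M q *v (\<chi> i. x i)) $ j *\<^sub>R f j q)"
      if "q \<in> U' \<inter> V" for x q
    proof -
      have "(\<Sum>i\<in>UNIV. x i *\<^sub>R e i q) = (\<Sum>i\<in>UNIV. \<Sum>j\<in>UNIV. (x i * m i j q) *\<^sub>R f j q)"
        by (simp add: m(2)[OF that] scaleR_sum_right)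
      also have "\<dots> = (\<Sum>j\<in>UNIV. \<Sum>i\<in>UNIV. (x i * m i j q) *\<^sub>R f j q)" by (rule sum.swap)
      also have "\<dots> = (\<Sum>j\<in>UNIV. (M q *v (\<chi> i. x i)) $ j *\<^sub>R f j q)"
        by (simp add: M_def matrix_vector_mult_def scaleR_sum_left mult.commute)
      finally show ?thesis .
    qed
    have det: "det (M q) \<noteq> 0" if q: "q \<in> U' \<inter> V" for q
    proof -
      have "x = 0" if x: "M q *v x = 0" for x
      proof -
        have "(\<Sum>i\<in>UNIV. (x $ i) *\<^sub>R e i q) = 0" using comb[OF q, of "\<lambda>i. x $ i"] x by simp
        then show ?thesis using is_basis_of_zero[OF basis] q by (auto simp: vec_eq_iff)
      qed
      then have "\<exists>B. B ** M q = mat 1" by (subst matrix_left_invertible_ker) blast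
      then have "invertible (M q)" by (simp add: invertible_left_inverse)
      then show ?thesis by (simp add: invertible_det_nz)
    qed
    \<comment> \<open>The numerator in Cramer's rule: column \<open>k\<close> is replaced by the
      components of \<open>X\<close>. Determinants are polynomials in smooth entries, and
      \<open>det (M q)\<close> does not vanish.\<close>
    define C where "C q = (\<chi> i j. if j = k then b i q else M q $ i $ j)" for q
    have "c k q = det (C q) * inverse (det (M q))" if q: "q \<in> U \<inter> U' \<inter> V" for q
    proof -
      have "(\<Sum>j\<in>UNIV. (M q *v (\<chi> i. c i q)) $ j *\<^sub>R f j q) = (\<Sum>j\<in>UNIV. b j q *\<^sub>R f j q)"
        using c[of q] b(2)[of q] comb[of q "\<lambda>i. c i q"] q by auto
      then have "M q *v (\<chi> i. c i q) = (\<chi> i. b i q)"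
        using is_basis_of_unique[OF bf] q by (auto simp: vec_eq_iff)
      then have "(\<chi> i. c i q) = (\<chi> k. det (\<chi> i j. if j = k then (\<chi> i. b i q) $ i else M q $ i $ j) / det (M q))"
        using cramer[OF det] q by blast
      then show ?thesis by (simp add: vec_eq_iff C_def divide_inverse cong: if_cong)
    qed
    moreover have "smooth_near (base_atlas E) p (\<lambda>q. C q $ i $ j)" for i j
      using p f(2) b(1) m(1) by (cases "j = k") (auto simp: C_def M_def)
    then have "smooth_near (base_atlas E) p (\<lambda>q. det (C q) * inverse (det (M q)))"
      using p f(2) det[of p] m(1)
      by (intro smooth_near_mult smooth_near_inverse smooth_near_det) (auto simp: M_def)
    ultimately show ?thesis
      by (elim smooth_near_cong[of p _ "U \<inter> U' \<inter> V"]) (use p f assms(1) U' in auto)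
  qed
  then show thesis using that c by blast
qed

end

section \<open>The canonical frames of the prolongation\<close>

lemma sum_fun_apply: "(\<Sum>i\<in>I. f i) x = (\<Sum>i\<in>I. f i x)"
  for f :: "'i \<Rightarrow> 'a \<Rightarrow> 'b::comm_monoid_add"
  by (induction I rule: infinite_finite_induct) auto

lemma sum_over_sum_type:
  fixes X :: "'k::finite \<Rightarrow> 'v::real_vector" and V :: "'l::finite \<Rightarrow> 'v"
  shows "(\<Sum>i\<in>UNIV. c i *\<^sub>R case_sum X V i) =
    (\<Sum>\<alpha>\<in>UNIV. c (Inl \<alpha>) *\<^sub>R X \<alpha>) + (\<Sum>\<beta>\<in>UNIV. c (Inr \<beta>) *\<^sub>R V \<beta>)"
  unfolding UNIV_Plus_UNIV[symmetric] by (subst sum.Plus) auto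

locale prolongation =
  fixes A :: "('k::finite, 'b::t2_space, 'e::real_normed_vector, 'v::real_vector) algebroid"
    and \<pi> :: "'p::t2_space \<Rightarrow> 'b"
    and P :: "('k + 'k, 'p, 'e \<times> (real ^ 'k), 'v \<times> 'p tangent) algebroid"
  assumes algebroid: "pre_lie_algebroid A"
    and fibred: "fibred_manifold (base_atlas A) (base_atlas P) \<pi>"
    and prolongation: "is_prolongation A (base_atlas P) \<pi> P"
begin

sublocale base: smooth_bundle A
  using algebroid by unfold_locales (simp add: pre_lie_algebroid_def)

sublocale smooth_manifold "base_atlas P"
  using fibred by unfold_locales (simp add: fibred_manifold_def)

abbreviation \<A> where "\<A> \<equiv> base_atlas P"

abbreviation \<B> where "\<B> \<equiv> base_atlas A"

abbreviation xframe where "xframe \<kappa> \<phi> e \<equiv> canonical_X A \<A> \<pi> \<kappa> \<phi> e"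

abbreviation vframe :: "('p, 'e \<times> (real ^ 'k)) chart \<Rightarrow> 'k \<Rightarrow> 'p \<Rightarrow> 'v \<times> 'p tangent" where
  "vframe \<phi> \<equiv> canonical_V \<A> \<phi>"

abbreviation rho where "rho \<kappa> e \<alpha> x \<equiv> components \<B> \<kappa> x (anchor A x (e \<alpha> x))"

abbreviation fibre_coordinate :: "('p, 'e \<times> (real ^ 'k)) chart \<Rightarrow> 'k \<Rightarrow> 'p \<Rightarrow> real" where
  "fibre_coordinate \<phi> \<gamma> q \<equiv> snd (snd \<phi> q) $ \<gamma>"

abbreviation adapted where "adapted \<kappa> \<phi> e \<equiv> adapted_frame A \<A> \<pi> \<kappa> \<phi> e"

lemma fibre_iff: "z \<in> fibre P m \<longleftrightarrow> fst z \<in> fibre A (\<pi> m) \<and> snd z \<in> tangent_space \<A> m \<and>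
    anchor A (\<pi> m) (fst z) = push_forward \<B> \<pi> m (snd z)"
  using prolongation by (cases z) (simp add: is_prolongation_def)

lemma anchor_P [simp]: "anchor P m z = snd z"
  using prolongation by (simp add: is_prolongation_def)

lemma almost_lie_P: "almost_lie_bracket P"
  using prolongation by (simp add: is_prolongation_def)

lemma frames_P: "frames P = {(fst \<phi>, case_sum (xframe \<kappa> \<phi> e) (vframe \<phi>)) | \<kappa> \<phi> e. adapted \<kappa> \<phi> e}"
  using prolongation unfolding is_prolongation_def by (elim conjE) assumption

lemma section_tangent: "smooth_section P U X \<Longrightarrow> p \<in> U \<Longrightarrow> snd (X p) \<in> tangent_space \<A> p"
  by (simp add: smooth_section_def fibre_iff)

lemma anchored_A: "anchored A"
  using algebroid by (simp add: pre_lie_algebroid_def)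

lemma anchor_A_add: "b \<in> fibre A x \<Longrightarrow> b' \<in> fibre A x \<Longrightarrow> anchor A x (b + b') = anchor A x b + anchor A x b'"
  and anchor_A_scale: "b \<in> fibre A x \<Longrightarrow> anchor A x (c *\<^sub>R b) = c *\<^sub>R anchor A x b"
  and anchor_A_tangent: "b \<in> fibre A x \<Longrightarrow> anchor A x b \<in> tangent_space \<B> x"
  using anchored_A by (simp_all add: anchored_def)

lemma anchor_A_zero: "anchor A x 0 = 0"
  using anchor_A_scale[OF subspace_0[OF base.fibre_subspace], of x 0] by simp

lemma anchor_A_sum:
  assumes "\<And>i. i \<in> I \<Longrightarrow> b i \<in> fibre A x"
  shows "anchor A x (\<Sum>i\<in>I. c i *\<^sub>R b i) = (\<Sum>i\<in>I. c i *\<^sub>R anchor A x (b i))"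
  using assms
proof (induction I rule: infinite_finite_induct)
  case (insert i I)
  have "(\<Sum>i\<in>I. c i *\<^sub>R b i) \<in> fibre A x"
    using insert.prems base.fibre_subspace by (intro subspace_sum subspace_scale) auto
  then show ?case
    using insert subspace_scale[OF base.fibre_subspace] by (simp add: anchor_A_add anchor_A_scale)
qed (simp_all add: anchor_A_zero)

lemma push_forward_linear: "linear (push_forward \<B> \<pi> m)"
  by (rule linearI) (auto simp: push_forward_def scaleR_fun_def)

lemma fibre_P_subspace: "subspace (fibre P m)"
proof (rule subspaceI)
  show "0 \<in> fibre P m"
    by (simp add: fibre_iff subspace_0[OF base.fibre_subspace] tangent_zero anchor_A_zero
        linear_0[OF push_forward_linear])
  show "x + y \<in> fibre P m" if "x \<in> fibre P m" "y \<in> fibre P m" for x y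
    using that by (simp add: fibre_iff subspace_add[OF base.fibre_subspace] tangent_plus anchor_A_add
        linear_add[OF push_forward_linear])
  show "c *\<^sub>R x \<in> fibre P m" if "x \<in> fibre P m" for c x
    using that by (simp add: fibre_iff subspace_scale[OF base.fibre_subspace] tangent_scaleR anchor_A_scale
        linear_scale[OF push_forward_linear])
qed

section \<open>Adapted charts and pullback along the projection\<close>

lemma adapted_chartsD:
  assumes "adapted_charts \<B> \<A> \<pi> \<kappa> \<phi>"
  shows "smooth_chart \<B> \<kappa>" "smooth_chart \<A> \<phi>" "q \<in> fst \<phi> \<Longrightarrow> \<pi> q \<in> fst \<kappa>"
    "q \<in> fst \<phi> \<Longrightarrow> fst (snd \<phi> q) = snd \<kappa> (\<pi> q)"
  using assms by (auto simp: adapted_charts_def)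

text \<open>In adapted charts \<open>\<pi>\<close> is the linear projection onto the base
  coordinates, so preimages are cut out by product sets. This supplies the continuity of
  \<open>\<pi>\<close>.\<close>

lemma projection_preimage_open:
  assumes "adapted_charts \<B> \<A> \<pi> \<kappa> \<phi>" "open U"
  shows "open (fst \<phi> \<inter> \<pi> -` U)"
proof -
  note ac = adapted_chartsD[OF assms(1)]
  have "fst \<phi> \<inter> \<pi> -` U = fst \<phi> \<inter> snd \<phi> -` ((snd \<kappa> ` (U \<inter> fst \<kappa>)) \<times> UNIV)"
  proof (intro set_eqI iffI)
    fix q assume "q \<in> fst \<phi> \<inter> snd \<phi> -` ((snd \<kappa> ` (U \<inter> fst \<kappa>)) \<times> UNIV)"
    then obtain x where q: "q \<in> fst \<phi>" and x: "x \<in> U" "x \<in> fst \<kappa>" "snd \<kappa> (\<pi> q) = snd \<kappa> x"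
      using ac(4) by (auto simp: mem_Times_iff)
    from inj_onD[OF chart_inj[OF ac(1)] x(3) ac(3)[OF q] x(2)] show "q \<in> fst \<phi> \<inter> \<pi> -` U"
      using q x(1) by simp
  qed (use ac(3,4) in \<open>auto simp: mem_Times_iff\<close>)
  then show ?thesis
    using chart_open_preimage[OF ac(2)] chart_open_image[OF ac(1) assms(2)] by (simp add: open_Times)
qed

lemma pullback_in_chart:
  assumes "adapted_charts \<B> \<A> \<pi> \<kappa> \<phi>" "z \<in> snd \<phi> ` fst \<phi>"
  shows "h (\<pi> (chart_inv \<phi> z)) = h (chart_inv \<kappa> (fst z))"
proof -
  obtain q where q: "q \<in> fst \<phi>" "z = snd \<phi> q" using assms(2) by blast
  note ad = adapted_chartsD[OF assms(1)]
  show ?thesis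
    using q ad(3,4)[OF q(1)] chart_inv_chart[OF ad(2) q(1)] chart_inv_chart[OF ad(1)] by simp
qed

lemma smooth_near_pullback:
  assumes "smooth_near \<B> (\<pi> m) h"
  shows "smooth_near \<A> m (\<lambda>q. h (\<pi> q))"
proof -
  obtain \<kappa> \<phi> where m: "m \<in> fst \<phi>" and ac: "adapted_charts \<B> \<A> \<pi> \<kappa> \<phi>"
    using fibred unfolding fibred_manifold_def by blast
  note ad = adapted_chartsD[OF ac]
  obtain B and k :: "'e \<Rightarrow> 'e \<Rightarrow> real" where k: "coordinates B k" by (rule base.model_coordinates)
  have "smooth_at (snd \<phi> m) (\<lambda>z. h (chart_inv \<kappa> (fst z)))"
    by (rule smooth_at_compose[OF k smooth_at_bounded_linear[OF bounded_linear_fst smooth_at_id]])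
      (use assms base.smooth_near_iff[OF ad(1,3)] ad(4) m in simp)
  then show ?thesis
    unfolding smooth_near_iff[OF ad(2) m]
    by (rule smooth_at_cong[OF _ chart_image_open[OF ad(2)]])
      (use m in blast, rule pullback_in_chart[OF ac, where h = h, symmetric])
qed

lemma tvec_pullback:
  assumes "adapted_charts \<B> \<A> \<pi> \<kappa> \<phi>" "m \<in> fst \<phi>" "smooth_near \<B> (\<pi> m) h"
  shows "tvec \<A> \<phi> m w (\<lambda>q. h (\<pi> q)) = tvec \<B> \<kappa> (\<pi> m) (fst w) h"
proof -
  note ad = adapted_chartsD[OF assms(1)]
  have "((\<lambda>z. h (chart_inv \<kappa> (fst z))) has_derivative (\<lambda>w. tvec \<B> \<kappa> (\<pi> m) (fst w) h)) (at (snd \<phi> m))"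
    by (rule has_derivative_compose[OF bounded_linear_imp_has_derivative[OF bounded_linear_fst]])
      (use base.has_derivative_in_chart[OF ad(1,3) assms(3)] ad(4) assms(2) in simp)
  then have "((\<lambda>z. h (\<pi> (chart_inv \<phi> z))) has_derivative (\<lambda>w. tvec \<B> \<kappa> (\<pi> m) (fst w) h)) (at (snd \<phi> m))"
    by (rule has_derivative_transform_within_open[OF _ chart_image_open[OF ad(2)]])
      (use assms(2) in blast, rule pullback_in_chart[OF assms(1), where h = h, symmetric])
  from has_derivative_unique[OF has_derivative_in_chart[OF ad(2) assms(2) smooth_near_pullback[OF assms(3)]] this]
  show ?thesis by metis
qed

lemma push_forward_tvec:
  assumes "adapted_charts \<B> \<A> \<pi> \<kappa> \<phi>" "m \<in> fst \<phi>"
  shows "push_forward \<B> \<pi> m (tvec \<A> \<phi> m w) = tvec \<B> \<kappa> (\<pi> m) (fst w)"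
  by (rule base.tvec_eqI[symmetric])
    (auto simp: push_forward_def o_def tvec_pullback[OF assms])

lemma adapted_frame_at:
  obtains \<kappa> \<phi> e where "adapted \<kappa> \<phi> e" "m \<in> fst \<phi>"
proof -
  obtain \<kappa> \<phi> where m: "m \<in> fst \<phi>" and ac: "adapted_charts \<B> \<A> \<pi> \<kappa> \<phi>"
    using fibred unfolding fibred_manifold_def by blast
  note ad = adapted_chartsD[OF ac]
  obtain U e where e: "(U, e) \<in> frames A" "\<pi> m \<in> U" "local_frame A U e" "open U" by (rule base.frame_at)
  define \<kappa>' where "\<kappa>' = (fst \<kappa> \<inter> U, snd \<kappa>)"
  \<comment> \<open>The preimage of \<open>U\<close> has been shown to be open only inside an
    adapted chart, hence the repeated intersection with \<open>fst \<phi>\<close>.\<close>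
  define \<phi>' where "\<phi>' = (fst \<phi> \<inter> (fst \<phi> \<inter> \<pi> -` U), snd \<phi>)"
  have "smooth_chart \<B> \<kappa>'"
    unfolding \<kappa>'_def by (rule smooth_chart_restrict[OF ad(1) e(4)]) (simp add: base.atlas_smooth_chart)
  moreover have "smooth_chart \<A> \<phi>'"
    unfolding \<phi>'_def
    by (rule smooth_chart_restrict[OF ad(2) projection_preimage_open[OF ac e(4)]]) (simp add: atlas_smooth_chart)
  ultimately have "adapted_charts \<B> \<A> \<pi> \<kappa>' \<phi>'"
    using ad(3,4) by (auto simp: adapted_charts_def \<kappa>'_def \<phi>'_def)
  moreover have "local_frame A (fst \<kappa>') e"
    using e(3,4) chart_open[OF ad(1)] base.smooth_section_subset[OF _ e(4), of _ "fst \<kappa> \<inter> U"]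
    by (auto simp: local_frame_def \<kappa>'_def)
  ultimately have "adapted \<kappa>' \<phi>' e" by (simp add: adapted_frame_def)
  moreover have "m \<in> fst \<phi>'" using m e(2) by (simp add: \<phi>'_def)
  ultimately show thesis by (rule that)
qed

section \<open>The canonical basis over one adapted chart\<close>

context
  fixes \<kappa> \<phi> e
  assumes adapted: "adapted \<kappa> \<phi> e"
begin

lemma adaptedD:
  shows adapted_charts: "adapted_charts \<B> \<A> \<pi> \<kappa> \<phi>"
    and adapted_base_chart: "smooth_chart \<B> \<kappa>"
    and adapted_chart: "smooth_chart \<A> \<phi>"
    and adapted_projection: "q \<in> fst \<phi> \<Longrightarrow> \<pi> q \<in> fst \<kappa>"
    and adapted_local_frame: "local_frame A (fst \<kappa>) e"
    and adapted_section: "smooth_section A (fst \<kappa>) (e \<alpha>)"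
    and adapted_basis: "x \<in> fst \<kappa> \<Longrightarrow> is_basis_of (\<lambda>\<alpha>. e \<alpha> x) (fibre A x)"
    and adapted_member: "x \<in> fst \<kappa> \<Longrightarrow> e \<alpha> x \<in> fibre A x"
  using adapted by (simp_all add: adapted_frame_def adapted_charts_def local_frame_def smooth_section_def image_subset_iff)

lemma adapted_open: "open (fst \<phi>)" "open (fst \<kappa>)"
  using chart_open adapted_chart adapted_base_chart by blast+

lemma tvec_rho: "x \<in> fst \<kappa> \<Longrightarrow> tvec \<B> \<kappa> x (rho \<kappa> e \<alpha> x) = anchor A x (e \<alpha> x)"
  by (rule base.tvec_components[OF adapted_base_chart _ anchor_A_tangent[OF adapted_member]])

text \<open>\<open>components\<close> is a definite description, which carries no smoothness by
  itself. Applying the anchor of \<open>e \<alpha>\<close> to the coordinate functions of the base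
  chart returns the components, and the anchor preserves smoothness.\<close>

lemma smooth_near_rho:
  assumes "x \<in> fst \<kappa>" "bounded_linear l"
  shows "smooth_near \<B> x (\<lambda>y. l (rho \<kappa> e \<alpha> y))"
proof -
  have "smooth_fun \<B> (fst \<kappa>) (\<lambda>y. l (snd \<kappa> y))"
    unfolding base.smooth_fun_iff[OF adapted_open(2)]
    using base.smooth_near_chart_coordinate[OF adapted_base_chart _ assms(2)] by blast
  then have "smooth_fun \<B> (fst \<kappa>) (\<lambda>y. anchor A y (e \<alpha> y) (\<lambda>y. l (snd \<kappa> y)))"
    using anchored_A adapted_open(2) adapted_section by (simp add: anchored_def)
  then have "smooth_near \<B> x (\<lambda>y. anchor A y (e \<alpha> y) (\<lambda>y. l (snd \<kappa> y)))"
    using assms(1) by (simp add: base.smooth_fun_iff[OF adapted_open(2)])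
  then show ?thesis
    by (rule base.smooth_near_cong[OF _ adapted_open(2) assms(1)])
      (metis base.tvec_chart_coordinate[OF adapted_base_chart _ assms(2)] tvec_rho)
qed

lemma snd_xframe: "snd (xframe \<kappa> \<phi> e \<alpha> q) = tvec \<A> \<phi> q (rho \<kappa> e \<alpha> (\<pi> q), 0)"
  by (simp add: canonical_X_def)

lemma snd_vframe: "snd (vframe \<phi> \<alpha> q) = tvec \<A> \<phi> q (0, axis \<alpha> 1)"
  by (simp add: canonical_V_def d_dy_def)

lemma fst_xframe: "fst (xframe \<kappa> \<phi> e \<alpha> q) = e \<alpha> (\<pi> q)"
  by (simp add: canonical_X_def)

lemma fst_vframe: "fst (vframe \<phi> \<alpha> q) = 0"
  by (simp add: canonical_V_def)

lemma xframe_fibre: "q \<in> fst \<phi> \<Longrightarrow> xframe \<kappa> \<phi> e \<alpha> q \<in> fibre P q"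
  by (simp add: fibre_iff fst_xframe snd_xframe adapted_member adapted_projection push_forward_tvec[OF adapted_charts]
      tvec_rho tangent_space_eq[OF adapted_chart])

lemma vframe_fibre: "q \<in> fst \<phi> \<Longrightarrow> vframe \<phi> \<alpha> q \<in> fibre P q"
  by (simp add: fibre_iff fst_vframe snd_vframe push_forward_tvec[OF adapted_charts] anchor_A_zero
      tangent_space_eq[OF adapted_chart] subspace_0[OF base.fibre_subspace] adapted_projection
      linear_0[OF base.linear_tvec[OF adapted_base_chart]])

lemma vframe_vertical: "q \<in> fst \<phi> \<Longrightarrow> vframe \<phi> \<alpha> q \<in> vertical P q"
  by (simp add: vertical_def vframe_fibre fst_vframe)

lemma fibre_coordinate_smooth: "q \<in> fst \<phi> \<Longrightarrow> smooth_near \<A> q (fibre_coordinate \<phi> \<gamma>)"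
  and tvec_fibre_coordinate: "q \<in> fst \<phi> \<Longrightarrow> tvec \<A> \<phi> q w (fibre_coordinate \<phi> \<gamma>) = snd w $ \<gamma>"
  using chart_coordinate[OF adapted_chart _ bounded_linear_compose[OF bounded_linear_vec_nth bounded_linear_snd]]
  by auto

text \<open>Agreement of anchor and push-forward forces the base part of the tangent vector once
  \<open>fst z\<close> is given. Only its fibre part is free, and it is read off by applying the
  vector to the fibre coordinates.\<close>

lemma fibre_expansion:
  assumes q: "q \<in> fst \<phi>" and z: "z \<in> fibre P q" and a: "fst z = (\<Sum>\<beta>\<in>UNIV. a \<beta> *\<^sub>R e \<beta> (\<pi> q))"
  shows "z = (\<Sum>\<beta>\<in>UNIV. a \<beta> *\<^sub>R xframe \<kappa> \<phi> e \<beta> q) +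
    (\<Sum>\<gamma>\<in>UNIV. snd z (fibre_coordinate \<phi> \<gamma>) *\<^sub>R vframe \<phi> \<gamma> q)"
proof -
  note \<pi>q = adapted_projection[OF q]
  have "snd z \<in> range (tvec \<A> \<phi> q)"
    using z tangent_space_eq[OF adapted_chart q] by (simp add: fibre_iff)
  then obtain w where w: "snd z = tvec \<A> \<phi> q w" by blast
  have "tvec \<B> \<kappa> (\<pi> q) (fst w) = anchor A (\<pi> q) (fst z)"
    using z by (simp add: fibre_iff w push_forward_tvec[OF adapted_charts q])
  also have "\<dots> = (\<Sum>\<beta>\<in>UNIV. a \<beta> *\<^sub>R tvec \<B> \<kappa> (\<pi> q) (rho \<kappa> e \<beta> (\<pi> q)))"
    unfolding a using anchor_A_sum[of UNIV "\<lambda>\<beta>. e \<beta> (\<pi> q)" "\<pi> q" a] adapted_member[OF \<pi>q]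
    by (simp add: tvec_rho[OF \<pi>q])
  also have "\<dots> = tvec \<B> \<kappa> (\<pi> q) (\<Sum>\<beta>\<in>UNIV. a \<beta> *\<^sub>R rho \<kappa> e \<beta> (\<pi> q))"
    using base.linear_tvec[OF adapted_base_chart \<pi>q] by (simp add: linear_sum linear_scale)
  finally have w1: "fst w = (\<Sum>\<beta>\<in>UNIV. a \<beta> *\<^sub>R rho \<kappa> e \<beta> (\<pi> q))"
    by (rule base.tvec_inject[OF adapted_base_chart \<pi>q])
  have w2: "snd w = (\<Sum>\<gamma>\<in>UNIV. (snd w $ \<gamma>) *\<^sub>R axis \<gamma> 1)"
    using basis_expansion[of "snd w"] by (simp add: scalar_mult_eq_scaleR)
  have weq: "w = (\<Sum>\<beta>\<in>UNIV. a \<beta> *\<^sub>R (rho \<kappa> e \<beta> (\<pi> q), 0)) + (\<Sum>\<gamma>\<in>UNIV. (snd w $ \<gamma>) *\<^sub>R (0, axis \<gamma> 1))"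
    by (rule prod_eqI) (use w1 w2 in \<open>simp_all add: fst_sum snd_sum\<close>)
  note L = linear_tvec[OF adapted_chart q]
  have sz: "snd z = (\<Sum>\<beta>\<in>UNIV. a \<beta> *\<^sub>R tvec \<A> \<phi> q (rho \<kappa> e \<beta> (\<pi> q), 0)) +
      (\<Sum>\<gamma>\<in>UNIV. (snd w $ \<gamma>) *\<^sub>R tvec \<A> \<phi> q (0, axis \<gamma> 1))"
    unfolding w
    by (rule trans[OF arg_cong[OF weq, of "tvec \<A> \<phi> q"]])
      (simp only: linear_add[OF L] linear_sum[OF L] linear_scale[OF L])
  have y: "snd z (fibre_coordinate \<phi> \<gamma>) = snd w $ \<gamma>" for \<gamma>
    by (simp add: w tvec_fibre_coordinate[OF q])
  show ?thesis
    unfolding y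
    by (rule prod_eqI) (simp_all add: fst_sum snd_sum fst_xframe fst_vframe snd_xframe snd_vframe a sz)
qed

lemma vertical_expansion:
  assumes "q \<in> fst \<phi>" "z \<in> vertical P q"
  shows "z = (\<Sum>\<gamma>\<in>UNIV. snd z (fibre_coordinate \<phi> \<gamma>) *\<^sub>R vframe \<phi> \<gamma> q)"
  using fibre_expansion[OF assms(1), of z "\<lambda>_. 0"] assms(2) by (simp add: vertical_def)

lemma canonical_basis:
  assumes q: "q \<in> fst \<phi>"
  shows "is_basis_of (\<lambda>i. case_sum (xframe \<kappa> \<phi> e) (vframe \<phi>) i q) (fibre P q)"
proof (rule is_basis_ofI[OF fibre_P_subspace])
  have cs: "case_sum (xframe \<kappa> \<phi> e) (vframe \<phi>) i q =
    case_sum (\<lambda>\<alpha>. xframe \<kappa> \<phi> e \<alpha> q) (\<lambda>\<alpha>. vframe \<phi> \<alpha> q) i" for i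
    by (cases i) auto
  show "case_sum (xframe \<kappa> \<phi> e) (vframe \<phi>) i q \<in> fibre P q" for i
    using xframe_fibre[OF q] vframe_fibre[OF q] by (cases i) auto
  show "\<exists>c. z = (\<Sum>i\<in>UNIV. c i *\<^sub>R case_sum (xframe \<kappa> \<phi> e) (vframe \<phi>) i q)" if z: "z \<in> fibre P q" for z
  proof -
    obtain a where "fst z = (\<Sum>\<beta>\<in>UNIV. a \<beta> *\<^sub>R e \<beta> (\<pi> q))"
      using is_basis_of_expand[OF adapted_basis[OF adapted_projection[OF q]]] z by (auto simp: fibre_iff)
    from fibre_expansion[OF q z this] show ?thesis
      by (intro exI[of _ "case_sum a (\<lambda>\<gamma>. snd z (fibre_coordinate \<phi> \<gamma>))"])
        (simp add: cs sum_over_sum_type)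
  qed
  show "c i = 0" if "(\<Sum>i\<in>UNIV. c i *\<^sub>R case_sum (xframe \<kappa> \<phi> e) (vframe \<phi>) i q) = 0" for c i
  proof -
    have 0: "(\<Sum>\<alpha>\<in>UNIV. c (Inl \<alpha>) *\<^sub>R xframe \<kappa> \<phi> e \<alpha> q) + (\<Sum>\<beta>\<in>UNIV. c (Inr \<beta>) *\<^sub>R vframe \<phi> \<beta> q) = 0"
      using that by (simp add: cs sum_over_sum_type)
    from arg_cong[OF 0, of fst] have "(\<Sum>\<alpha>\<in>UNIV. c (Inl \<alpha>) *\<^sub>R e \<alpha> (\<pi> q)) = 0"
      by (simp add: fst_sum fst_xframe fst_vframe)
    then have l: "c (Inl \<alpha>) = 0" for \<alpha>
      by (rule is_basis_of_zero[OF adapted_basis[OF adapted_projection[OF q]]])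
    have "c (Inr \<gamma>) = 0" for \<gamma>
    proof -
      have "0 = snd (\<Sum>\<beta>\<in>UNIV. c (Inr \<beta>) *\<^sub>R vframe \<phi> \<beta> q) (fibre_coordinate \<phi> \<gamma>)"
        using 0 l by simp
      also have "\<dots> = (\<Sum>\<beta>\<in>UNIV. c (Inr \<beta>) * (axis \<beta> 1 $ \<gamma>))"
        by (simp add: snd_sum sum_fun_apply scaleR_fun_def snd_vframe tvec_fibre_coordinate[OF q])
      also have "\<dots> = (\<Sum>\<beta>\<in>UNIV. if \<beta> = \<gamma> then c (Inr \<beta>) else 0)"
        by (intro sum.cong) (auto simp: axis_def)
      finally show ?thesis by simp
    qed
    with l show ?thesis by (cases i) auto
  qed
qed

lemma smooth_near_vframe: "q \<in> fst \<phi> \<Longrightarrow> smooth_near \<A> q f \<Longrightarrow> smooth_near \<A> q (\<lambda>q. snd (vframe \<phi> \<alpha> q) f)"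
  unfolding snd_vframe by (rule smooth_near_tvec[OF adapted_chart])

text \<open>Smoothness and commutation of \<open>tvec\<close> are known for constant components.
  Splitting the varying components over a fixed basis separates coefficients pulled back from the
  base, which vertical derivatives kill, from constant directions.\<close>

lemma snd_xframe_coordinates:
  fixes k :: "'e \<Rightarrow> 'e \<Rightarrow> real"
  assumes "coordinates B k" "q \<in> fst \<phi>"
  shows "snd (xframe \<kappa> \<phi> e \<alpha> q) f = (\<Sum>b\<in>B. k b (rho \<kappa> e \<alpha> (\<pi> q)) * tvec \<A> \<phi> q (b, 0) f)"
proof -
  have "linear (\<lambda>x. tvec \<A> \<phi> q (x, 0))"
    using linear_compose[OF _ linear_tvec[OF adapted_chart assms(2)], of "\<lambda>x. (x, 0)"]
    by (simp add: o_def bounded_linear.linear[OF bounded_linear_Pair[OF bounded_linear_ident bounded_linear_zero]])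
  from fun_cong[OF linear_coordinates[OF assms(1) this, of "rho \<kappa> e \<alpha> (\<pi> q)"], of f] show ?thesis
    unfolding snd_xframe sum_fun_apply scaleR_fun_def by simp
qed

lemma smooth_near_xframe:
  assumes "q \<in> fst \<phi>" "smooth_near \<A> q f"
  shows "smooth_near \<A> q (\<lambda>q. snd (xframe \<kappa> \<phi> e \<alpha> q) f)"
proof -
  obtain B and k :: "'e \<Rightarrow> 'e \<Rightarrow> real" where k: "coordinates B k" by (rule base.model_coordinates)
  have bl: "bounded_linear (k b)" if "b \<in> B" for b using k that by (simp add: coordinates_def)
  have "smooth_near \<A> q (\<lambda>q. \<Sum>b\<in>B. k b (rho \<kappa> e \<alpha> (\<pi> q)) * tvec \<A> \<phi> q (b, 0) f)"
    by (intro smooth_near_sum smooth_near_mult smooth_near_tvec[OF adapted_chart assms]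
        smooth_near_pullback[OF smooth_near_rho[OF adapted_projection[OF assms(1)] bl]])
  then show ?thesis
    by (rule smooth_near_cong[OF _ adapted_open(1) assms(1)]) (rule snd_xframe_coordinates[OF k, symmetric])
qed

end

text \<open>The coefficients on the \<open>X\<close> part come from the component in
  \<open>A\<close>, those on the \<open>V\<close> part from the action on fibre coordinates.
  Smoothness of a section is thus reduced to these two conditions.\<close>

lemma canonical_section_expansion:
  assumes "adapted \<kappa> \<phi> e" "open U" "\<And>q. q \<in> U \<Longrightarrow> X q \<in> fibre P q"
    and a: "\<And>q \<beta>. q \<in> U \<inter> fst \<phi> \<Longrightarrow> smooth_near \<A> q (a \<beta>)"
      "\<And>q. q \<in> U \<inter> fst \<phi> \<Longrightarrow> fst (X q) = (\<Sum>\<beta>\<in>UNIV. a \<beta> q *\<^sub>R e \<beta> (\<pi> q))"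
    and X: "\<And>q f. q \<in> U \<Longrightarrow> smooth_near \<A> q f \<Longrightarrow> smooth_near \<A> q (\<lambda>q. snd (X q) f)"
  shows "\<exists>c. (\<forall>i. smooth_fun \<A> (U \<inter> fst \<phi>) (c i)) \<and>
    (\<forall>q\<in>U \<inter> fst \<phi>. X q = (\<Sum>i\<in>UNIV. c i q *\<^sub>R case_sum (xframe \<kappa> \<phi> e) (vframe \<phi>) i q))"
proof (intro exI conjI allI ballI)
  let ?c = "case_sum a (\<lambda>\<gamma> q. snd (X q) (fibre_coordinate \<phi> \<gamma>))"
  have o: "open (U \<inter> fst \<phi>)" using assms(2) adapted_open[OF assms(1)] by blast
  show "smooth_fun \<A> (U \<inter> fst \<phi>) (?c i)" for i
    unfolding smooth_fun_iff[OF o] using a(1) X fibre_coordinate_smooth[OF assms(1)] by (cases i) auto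
  fix q assume q: "q \<in> U \<inter> fst \<phi>"
  have cs: "case_sum (xframe \<kappa> \<phi> e) (vframe \<phi>) i q =
    case_sum (\<lambda>\<alpha>. xframe \<kappa> \<phi> e \<alpha> q) (\<lambda>\<alpha>. vframe \<phi> \<alpha> q) i" for i
    by (cases i) auto
  show "X q = (\<Sum>i\<in>UNIV. ?c i q *\<^sub>R case_sum (xframe \<kappa> \<phi> e) (vframe \<phi>) i q)"
    using fibre_expansion[OF assms(1) _ assms(3) a(2)[OF q]] q by (simp add: cs sum_over_sum_type)
qed

text \<open>In another adapted frame, the \<open>X\<close> coefficients of \<open>xframe\<close> are
  those of \<open>e\<close> relative to \<open>e'\<close>, pulled back by \<open>\<pi>\<close>;
  those of \<open>vframe\<close> are zero.\<close>

lemma canonical_sections: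
  assumes ad: "adapted \<kappa> \<phi> e"
  shows xframe_section: "smooth_section P (fst \<phi>) (xframe \<kappa> \<phi> e \<alpha>)"
    and vframe_section: "smooth_section P (fst \<phi>) (vframe \<phi> \<alpha>)"
proof -
  have x: "\<exists>c. (\<forall>i. smooth_fun \<A> (fst \<phi> \<inter> fst \<phi>') (c i)) \<and> (\<forall>q\<in>fst \<phi> \<inter> fst \<phi>'.
      xframe \<kappa> \<phi> e \<alpha> q = (\<Sum>i\<in>UNIV. c i q *\<^sub>R case_sum (xframe \<kappa>' \<phi>' e') (vframe \<phi>') i q))"
    if ad': "adapted \<kappa>' \<phi>' e'" for \<kappa>' \<phi>' e'
  proof -
    obtain c where c: "\<And>x i. x \<in> fst \<kappa> \<inter> fst \<kappa>' \<Longrightarrow> smooth_near \<B> x (c i)"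
      "\<And>x. x \<in> fst \<kappa> \<inter> fst \<kappa>' \<Longrightarrow> e \<alpha> x = (\<Sum>i\<in>UNIV. c i x *\<^sub>R e' i x)"
      using base.local_frame_coefficients[OF adapted_open(2)[OF ad] adapted_section[OF ad] adapted_local_frame[OF ad']]
      by blast
    show ?thesis
    proof (rule canonical_section_expansion[OF ad' adapted_open(1)[OF ad], where a = "\<lambda>\<beta> q. c \<beta> (\<pi> q)"])
      show "smooth_near \<A> q (\<lambda>q. c \<beta> (\<pi> q))" if "q \<in> fst \<phi> \<inter> fst \<phi>'" for q \<beta>
        using that c(1) adapted_projection[OF ad] adapted_projection[OF ad'] by (intro smooth_near_pullback) auto
    qed (use c(2) adapted_projection[OF ad] adapted_projection[OF ad'] xframe_fibre[OF ad]
        smooth_near_xframe[OF ad] fst_xframe[OF ad] in auto)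
  qed
  have v: "\<exists>c. (\<forall>i. smooth_fun \<A> (fst \<phi> \<inter> fst \<phi>') (c i)) \<and> (\<forall>q\<in>fst \<phi> \<inter> fst \<phi>'.
      vframe \<phi> \<alpha> q = (\<Sum>i\<in>UNIV. c i q *\<^sub>R case_sum (xframe \<kappa>' \<phi>' e') (vframe \<phi>') i q))"
    if ad': "adapted \<kappa>' \<phi>' e'" for \<kappa>' \<phi>' e'
    by (rule canonical_section_expansion[OF ad' adapted_open(1)[OF ad], where a = "\<lambda>\<beta> q. 0"])
      (auto simp: vframe_fibre[OF ad] smooth_near_vframe[OF ad] fst_vframe[OF ad] smooth_near_const)
  show "smooth_section P (fst \<phi>) (xframe \<kappa> \<phi> e \<alpha>)" "smooth_section P (fst \<phi>) (vframe \<phi> \<alpha>)"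
    using x v xframe_fibre[OF ad] vframe_fibre[OF ad] unfolding smooth_section_def frames_P by fastforce+
qed

text \<open>\<open>is_prolongation\<close> prescribes the family of frames; that these fit together
  to a vector bundle follows from \<open>canonical_basis\<close> and from the smoothness of
  canonical sections in each other's frames.\<close>

sublocale smooth_bundle P
proof unfold_locales
  have "local_frame P (fst \<phi>) (case_sum (xframe \<kappa> \<phi> e) (vframe \<phi>))" if ad: "adapted \<kappa> \<phi> e" for \<kappa> \<phi> e
  proof -
    have "smooth_section P (fst \<phi>) (case_sum (xframe \<kappa> \<phi> e) (vframe \<phi>) i)" for i
      using canonical_sections[OF ad] by (cases i) auto
    then show ?thesis
      using adapted_open[OF ad] canonical_basis[OF ad] unfolding local_frame_def by blast
  qed
  moreover have "(\<Union>F\<in>frames P. fst F) = UNIV"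
  proof (intro equalityI subsetI UNIV_I)
    fix m :: 'p
    obtain \<kappa> \<phi> e where "adapted \<kappa> \<phi> e" "m \<in> fst \<phi>" by (rule adapted_frame_at)
    moreover have "(fst \<phi>, case_sum (xframe \<kappa> \<phi> e) (vframe \<phi>)) \<in> frames P"
      unfolding frames_P using calculation by blast
    ultimately show "m \<in> (\<Union>F\<in>frames P. fst F)" by (intro UN_I) auto
  qed
  ultimately show "vector_bundle P"
    using manifold by (auto simp: vector_bundle_def frames_P)
qed

text \<open>Smoothness of the anchor of \<open>P\<close>, read off from the canonical frame.\<close>

lemma section_apply_smooth:
  assumes "open U" "smooth_section P U X" "q \<in> U" "smooth_near \<A> q f"
  shows "smooth_near \<A> q (\<lambda>q. snd (X q) f)"
proof -
  obtain \<kappa> \<phi> e where ad: "adapted \<kappa> \<phi> e" "q \<in> fst \<phi>" by (rule adapted_frame_at)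
  have "(fst \<phi>, case_sum (xframe \<kappa> \<phi> e) (vframe \<phi>)) \<in> frames P" unfolding frames_P using ad by blast
  then obtain c where c: "\<And>p i. p \<in> U \<inter> fst \<phi> \<Longrightarrow> smooth_near \<A> p (c i)"
    "\<And>p. p \<in> U \<inter> fst \<phi> \<Longrightarrow> X p = (\<Sum>i\<in>UNIV. c i p *\<^sub>R case_sum (xframe \<kappa> \<phi> e) (vframe \<phi>) i p)"
    using smooth_sectionE[OF assms(1,2)] by blast
  have "smooth_near \<A> q (\<lambda>q. snd (case_sum (xframe \<kappa> \<phi> e) (vframe \<phi>) i q) f)" for i
    using smooth_near_xframe[OF ad assms(4)] smooth_near_vframe[OF ad assms(4)] by (cases i) auto
  then have "smooth_near \<A> q (\<lambda>p. \<Sum>i\<in>UNIV. c i p * snd (case_sum (xframe \<kappa> \<phi> e) (vframe \<phi>) i p) f)"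
    using c(1) assms(3) ad(2) by (intro smooth_near_sum smooth_near_mult) auto
  then show ?thesis
    by (rule smooth_near_cong[of _ _ "U \<inter> fst \<phi>"])
      (use assms ad adapted_open[OF ad(1)] c(2) in \<open>auto simp: snd_sum sum_fun_apply scaleR_fun_def\<close>)
qed

lemma vertical_subspace: "subspace (vertical P m)"
proof -
  have "subspace {z \<in> fibre P m. fst z = 0}"
    using fibre_subspace[of m] by (auto simp: subspace_def)
  then show ?thesis by (simp add: vertical_def)
qed

lemma vertical_section_through:
  assumes "z \<in> vertical P p"
  obtains U X where "open U" "p \<in> U" "vertical_section P U X" "X p = z"
proof -
  obtain \<kappa> \<phi> e where ad: "adapted \<kappa> \<phi> e" "p \<in> fst \<phi>" by (rule adapted_frame_at)
  define X where "X q = (\<Sum>\<gamma>\<in>UNIV. snd z (fibre_coordinate \<phi> \<gamma>) *\<^sub>R vframe \<phi> \<gamma> q)" for q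
  have "smooth_section P (fst \<phi>) X"
    unfolding X_def
    by (intro smooth_section_sum smooth_section_scale adapted_open[OF ad(1)] smooth_near_const vframe_section[OF ad(1)])
  moreover have "X q \<in> vertical P q" if "q \<in> fst \<phi>" for q
    unfolding X_def using vframe_vertical[OF ad(1) that] vertical_subspace
    by (intro subspace_sum subspace_scale) auto
  ultimately have "vertical_section P (fst \<phi>) X" by (simp add: vertical_section_def)
  moreover have "X p = z" unfolding X_def using vertical_expansion[OF ad assms] by simp
  ultimately show thesis using that adapted_open[OF ad(1)] ad(2) by blast
qed

end

section \<open>The bracket of the prolongation\<close>

context prolongation
begin

context
  fixes W X Y
  assumes W: "open W" and X: "smooth_section P W X" and Y: "smooth_section P W Y"
begin

lemmas bracket_axioms = almost_lie_P[unfolded almost_lie_bracket_def, THEN spec, THEN spec, THEN spec, THEN mp,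
  OF conjI, OF W conjI, OF X Y, unfolded anchor_P]

lemma bracket_section: "smooth_section P W (bracket P X Y)"
  and bracket_antisym: "q \<in> W \<Longrightarrow> bracket P X Y q = - bracket P Y X q"
  and bracket_cong: "(\<And>q. q \<in> W \<Longrightarrow> X' q = X q) \<Longrightarrow> (\<And>q. q \<in> W \<Longrightarrow> Y' q = Y q) \<Longrightarrow> q \<in> W \<Longrightarrow>
    bracket P X' Y' q = bracket P X Y q"
  by (rule bracket_axioms[THEN conjunct1],
      erule bracket_axioms[THEN conjunct2, THEN conjunct1, THEN bspec],
      rule bracket_axioms[THEN conjunct2, THEN conjunct2, THEN conjunct2, THEN conjunct2, THEN conjunct2,
        THEN spec, THEN spec, THEN mp, THEN bspec], auto)

lemma bracket_add_right:
  "smooth_section P W Y' \<Longrightarrow> q \<in> W \<Longrightarrow> bracket P X (\<lambda>q. Y q + Y' q) q = bracket P X Y q + bracket P X Y' q"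
  by (rule bracket_axioms[THEN conjunct2, THEN conjunct2, THEN conjunct2, THEN conjunct2, THEN conjunct1,
        THEN spec, THEN mp, THEN bspec])

lemma bracket_scale_right:
  assumes "\<And>q. q \<in> W \<Longrightarrow> smooth_near \<A> q f" "q \<in> W"
  shows "bracket P X (\<lambda>q. f q *\<^sub>R Y q) q = f q *\<^sub>R bracket P X Y q + snd (X q) f *\<^sub>R Y q"
proof -
  have "smooth_fun \<A> W f" using assms(1) by (simp add: smooth_fun_iff[OF W])
  then show ?thesis
    by (rule bracket_axioms[THEN conjunct2, THEN conjunct2, THEN conjunct2, THEN conjunct1,
          THEN spec, THEN mp, THEN bspec]) (rule assms(2))
qed

end

lemma bracket_scale_left:
  assumes "open W" "smooth_section P W X" "smooth_section P W Y" "\<And>q. q \<in> W \<Longrightarrow> smooth_near \<A> q f" "q \<in> W"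
  shows "bracket P (\<lambda>q. f q *\<^sub>R X q) Y q = f q *\<^sub>R bracket P X Y q - snd (Y q) f *\<^sub>R X q"
  using bracket_antisym[OF assms(1) smooth_section_scale[OF assms(1,4,2)] assms(3,5)]
    bracket_scale_right[OF assms(1,3,2,4,5)] bracket_antisym[OF assms(1,2,3,5)] by simp

lemma bracket_add_left:
  assumes "open W" "smooth_section P W X" "smooth_section P W X'" "smooth_section P W Y" "q \<in> W"
  shows "bracket P (\<lambda>q. X q + X' q) Y q = bracket P X Y q + bracket P X' Y q"
  using bracket_antisym[OF assms(1) smooth_section_add[OF assms(1-3)] assms(4,5)]
    bracket_add_right[OF assms(1,4,2,3,5)] bracket_antisym[OF assms(1,2,4,5)]
    bracket_antisym[OF assms(1,3,4,5)] by simp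

lemma bracket_minus_right:
  assumes "open W" "smooth_section P W X" "smooth_section P W Y" "q \<in> W"
  shows "bracket P X (\<lambda>q. - Y q) q = - bracket P X Y q"
  using bracket_scale_right[OF assms(1-3), of "\<lambda>_. - 1"] assms(4)
    tangent_const[OF section_tangent[OF assms(2,4)]] by (simp add: smooth_near_const)

lemma bracket_diff_right:
  assumes "open W" "smooth_section P W X" "smooth_section P W Y" "smooth_section P W Y'" "q \<in> W"
  shows "bracket P X (\<lambda>q. Y q - Y' q) q = bracket P X Y q - bracket P X Y' q"
  using bracket_add_right[OF assms(1-3) smooth_section_minus[OF assms(1,4)] assms(5)]
    bracket_minus_right[OF assms(1,2,4,5)] by simp

lemma bracket_zero_right:
  assumes "open W" "smooth_section P W X" "\<And>q. q \<in> W \<Longrightarrow> Y q = 0" "q \<in> W"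
  shows "bracket P X Y q = 0"
  using bracket_cong[OF assms(1,2) smooth_section_zero[OF assms(1)], of X Y q] assms
    bracket_scale_right[OF assms(1,2) smooth_section_zero[OF assms(1)], of "\<lambda>_. 0" q]
    tangent_const[OF section_tangent[OF assms(2,4)]]
  by (simp add: smooth_near_const)

lemma bracket_sum_right:
  assumes "open W" "smooth_section P W X" "\<And>i. i \<in> I \<Longrightarrow> smooth_section P W (Y i)" "q \<in> W"
  shows "bracket P X (\<lambda>q. \<Sum>i\<in>I. Y i q) q = (\<Sum>i\<in>I. bracket P X (Y i) q)"
  using assms(3)
proof (induction I rule: infinite_finite_induct)
  case (insert i I)
  then show ?case
    using bracket_add_right[OF assms(1,2), of "Y i" "\<lambda>q. \<Sum>i\<in>I. Y i q" q] assms(1,4)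
    by (simp add: smooth_section_sum)
qed (simp_all add: bracket_zero_right[OF assms(1,2) _ assms(4)])

text \<open>A local section is a combination of the canonical basis with smooth coefficients, so a
  property stable under sums and smooth multiples need only be checked on the basis. The clause
  \<open>cong\<close> is there because sections are total functions whose values outside
  \<open>W\<close> are arbitrary.\<close>

lemma section_induct:
  assumes "open W" "smooth_section P W X" "adapted \<kappa> \<phi> e" "W \<subseteq> fst \<phi>"
    and x: "\<And>\<alpha>. Q (xframe \<kappa> \<phi> e \<alpha>)" and v: "\<And>\<alpha>. Q (vframe \<phi> \<alpha>)"
    and add: "\<And>X Y. smooth_section P W X \<Longrightarrow> smooth_section P W Y \<Longrightarrow> Q X \<Longrightarrow> Q Y \<Longrightarrow> Q (\<lambda>q. X q + Y q)"
    and scale: "\<And>f X. (\<And>q. q \<in> W \<Longrightarrow> smooth_near \<A> q f) \<Longrightarrow> smooth_section P W X \<Longrightarrow> Q X \<Longrightarrow> Q (\<lambda>q. f q *\<^sub>R X q)"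
    and cong: "\<And>X Y. smooth_section P W X \<Longrightarrow> (\<And>q. q \<in> W \<Longrightarrow> X q = Y q) \<Longrightarrow> Q X \<Longrightarrow> Q Y"
  shows "Q X"
proof -
  let ?E = "case_sum (xframe \<kappa> \<phi> e) (vframe \<phi>)"
  have "(fst \<phi>, ?E) \<in> frames P" unfolding frames_P using assms(3) by blast
  then obtain c where c: "\<And>p i. p \<in> W \<inter> fst \<phi> \<Longrightarrow> smooth_near \<A> p (c i)"
    "\<And>p. p \<in> W \<inter> fst \<phi> \<Longrightarrow> X p = (\<Sum>i\<in>UNIV. c i p *\<^sub>R ?E i p)"
    using smooth_sectionE[OF assms(1,2)] by blast
  have sE: "smooth_section P W (?E i)" for i
    using canonical_sections[OF assms(3)] adapted_open[OF assms(3)] assms(1,4)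
    by (cases i) (auto intro: smooth_section_subset)
  have QE: "Q (?E i)" for i using x v by (cases i) auto
  have "Q (\<lambda>p. 0 *\<^sub>R ?E undefined p)"
    by (rule scale[OF smooth_near_const sE QE])
  then have Q0: "Q (\<lambda>p. 0)" by simp
  have "Q (\<lambda>p. \<Sum>i\<in>I. c i p *\<^sub>R ?E i p) \<and> smooth_section P W (\<lambda>p. \<Sum>i\<in>I. c i p *\<^sub>R ?E i p)" if "finite I" for I
    using that
  proof induction
    case (insert i I)
    have "smooth_section P W (\<lambda>p. c i p *\<^sub>R ?E i p)" "Q (\<lambda>p. c i p *\<^sub>R ?E i p)"
      using c(1) assms(4) by (auto intro!: smooth_section_scale[OF assms(1)] scale sE QE)
    then show ?case using insert by (auto intro!: add smooth_section_add[OF assms(1)])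
  qed (use Q0 smooth_section_zero[OF assms(1)] in auto)
  from this[of UNIV] have 1: "Q (\<lambda>p. \<Sum>i\<in>UNIV. c i p *\<^sub>R ?E i p)"
    "smooth_section P W (\<lambda>p. \<Sum>i\<in>UNIV. c i p *\<^sub>R ?E i p)" by simp_all
  show ?thesis
    by (rule cong[OF 1(2) _ 1(1)]) (rule c(2)[symmetric], use assms(4) in blast)
qed

lemma vertical_section_scale:
  assumes "open W" "\<And>q. q \<in> W \<Longrightarrow> smooth_near \<A> q f" "vertical_section P W X"
  shows "vertical_section P W (\<lambda>q. f q *\<^sub>R X q)"
  using assms smooth_section_scale[OF assms(1,2)] subspace_scale[OF vertical_subspace]
  by (simp add: vertical_section_def)

lemma vertical_section_add:
  assumes "open W" "vertical_section P W X" "vertical_section P W Y"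
  shows "vertical_section P W (\<lambda>q. X q + Y q)"
  using assms smooth_section_add[OF assms(1)] subspace_add[OF vertical_subspace]
  by (simp add: vertical_section_def)

lemma vertical_sectionD:
  assumes "vertical_section P W X"
  shows "smooth_section P W X" "q \<in> W \<Longrightarrow> X q \<in> vertical P q"
  using assms by (auto simp: vertical_section_def)

lemma vertical_section_subset:
  "vertical_section P U X \<Longrightarrow> open U \<Longrightarrow> open W \<Longrightarrow> W \<subseteq> U \<Longrightarrow> vertical_section P W X"
  using smooth_section_subset by (auto simp: vertical_section_def)

lemma vertical_section_vframe: "adapted \<kappa> \<phi> e \<Longrightarrow> open W \<Longrightarrow> W \<subseteq> fst \<phi> \<Longrightarrow> vertical_section P W (vframe \<phi> \<alpha>)"
  using smooth_section_subset[OF vframe_section adapted_open(1)] vframe_vertical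
  unfolding vertical_section_def by blast

text \<open>The partial sums remain vertical: the coefficients are derivatives of fibre coordinates
  and no \<open>X\<close> term occurs, so the closure clauses may assume vertical sections.\<close>

lemma vertical_section_induct:
  assumes "open W" "vertical_section P W X" "adapted \<kappa> \<phi> e" "W \<subseteq> fst \<phi>"
    and v: "\<And>\<alpha>. Q (vframe \<phi> \<alpha>)"
    and add: "\<And>X Y. vertical_section P W X \<Longrightarrow> vertical_section P W Y \<Longrightarrow> Q X \<Longrightarrow> Q Y \<Longrightarrow> Q (\<lambda>q. X q + Y q)"
    and scale: "\<And>f X. (\<And>q. q \<in> W \<Longrightarrow> smooth_near \<A> q f) \<Longrightarrow> vertical_section P W X \<Longrightarrow> Q X \<Longrightarrow> Q (\<lambda>q. f q *\<^sub>R X q)"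
    and cong: "\<And>X Y. vertical_section P W X \<Longrightarrow> (\<And>q. q \<in> W \<Longrightarrow> X q = Y q) \<Longrightarrow> Q X \<Longrightarrow> Q Y"
  shows "Q X"
proof -
  let ?c = "\<lambda>\<gamma> q. snd (X q) (fibre_coordinate \<phi> \<gamma>)"
  have c: "smooth_near \<A> q (?c \<gamma>)" if "q \<in> W" for q \<gamma>
    using that assms(4) fibre_coordinate_smooth[OF assms(3)]
    by (intro section_apply_smooth[OF assms(1) vertical_sectionD(1)[OF assms(2)]]) auto
  note sV = vertical_section_vframe[OF assms(3,1,4)]
  have "Q (\<lambda>p. 0 *\<^sub>R vframe \<phi> undefined p)" "vertical_section P W (\<lambda>p. 0 *\<^sub>R vframe \<phi> undefined p)"
    by (rule scale[OF smooth_near_const sV v]) (rule vertical_section_scale[OF assms(1) smooth_near_const sV])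
  then have Q0: "Q (\<lambda>p. 0)" "vertical_section P W (\<lambda>p. 0)" by simp_all
  have "Q (\<lambda>p. \<Sum>i\<in>I. ?c i p *\<^sub>R vframe \<phi> i p) \<and> vertical_section P W (\<lambda>p. \<Sum>i\<in>I. ?c i p *\<^sub>R vframe \<phi> i p)"
    if "finite I" for I
    using that
  proof induction
    case (insert i I)
    have "vertical_section P W (\<lambda>p. ?c i p *\<^sub>R vframe \<phi> i p)" "Q (\<lambda>p. ?c i p *\<^sub>R vframe \<phi> i p)"
      by (rule vertical_section_scale[OF assms(1) c sV], assumption) (rule scale[OF c sV v])
    then show ?case using insert by (auto intro!: add vertical_section_add[OF assms(1)])
  qed (use Q0 in auto)
  from this[OF finite] have 1: "Q (\<lambda>p. \<Sum>i\<in>UNIV. ?c i p *\<^sub>R vframe \<phi> i p)"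
    "vertical_section P W (\<lambda>p. \<Sum>i\<in>UNIV. ?c i p *\<^sub>R vframe \<phi> i p)" by blast+
  show ?thesis
    by (rule cong[OF 1(2) _ 1(1)])
      (rule vertical_expansion[OF assms(3) _ vertical_sectionD(2)[OF assms(2)], symmetric], use assms(4) in auto)
qed

section \<open>Canonical brackets and their action on functions\<close>

lemma bracket_frames:
  assumes "adapted \<kappa> \<phi> e" "q \<in> fst \<phi>"
  shows bracket_xv: "bracket P (xframe \<kappa> \<phi> e \<alpha>) (vframe \<phi> \<beta>) q = 0"
    and bracket_vv: "bracket P (vframe \<phi> \<alpha>) (vframe \<phi> \<beta>) q = 0"
    and bracket_xx: "bracket A (e \<alpha>) (e \<beta>) (\<pi> q) = (\<Sum>\<gamma>\<in>UNIV. C \<gamma> *\<^sub>R e \<gamma> (\<pi> q)) \<Longrightarrow>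
      bracket P (xframe \<kappa> \<phi> e \<alpha>) (xframe \<kappa> \<phi> e \<beta>) q = (\<Sum>\<gamma>\<in>UNIV. C \<gamma> *\<^sub>R xframe \<kappa> \<phi> e \<gamma> q)"
  using prolongation assms unfolding is_prolongation_def by blast+

lemma bracket_vx:
  assumes "adapted \<kappa> \<phi> e" "q \<in> fst \<phi>"
  shows "bracket P (vframe \<phi> \<beta>) (xframe \<kappa> \<phi> e \<alpha>) q = 0"
  using bracket_antisym[OF adapted_open(1)[OF assms(1)] vframe_section[OF assms(1)] xframe_section[OF assms(1)] assms(2)]
    bracket_xv[OF assms] by simp

lemma vframe_pullback:
  assumes "adapted \<kappa> \<phi> e" "q \<in> fst \<phi>" "smooth_near \<B> (\<pi> q) h"
  shows "snd (vframe \<phi> \<beta> q) (\<lambda>q. h (\<pi> q)) = 0"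
  using assms tvec_pullback[OF adapted_charts[OF assms(1)] assms(2,3)]
    linear_0[OF base.linear_tvec[OF adapted_base_chart adapted_projection], OF assms(1) assms(1,2)]
  by (simp add: snd_vframe[OF assms(1)])

text \<open>The coefficients of the \<open>X\<close> frame are pulled back from the base, so a
  vertical derivative passes them by; what is left is the commutation of partial
  derivatives.\<close>

lemma vframe_xframe_commute:
  assumes ad: "adapted \<kappa> \<phi> e" and q: "q \<in> fst \<phi>" and f: "smooth_near \<A> q f"
  shows "snd (vframe \<phi> \<beta> q) (\<lambda>q. snd (xframe \<kappa> \<phi> e \<alpha> q) f) =
    snd (xframe \<kappa> \<phi> e \<alpha> q) (\<lambda>q. snd (vframe \<phi> \<beta> q) f)"
proof -
  note ch = adapted_chart[OF ad]
  obtain B and k :: "'e \<Rightarrow> 'e \<Rightarrow> real" where k: "coordinates B k" by (rule base.model_coordinates)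
  have bl: "bounded_linear (k b)" if "b \<in> B" for b using k that by (simp add: coordinates_def)
  let ?r = "\<lambda>b q. k b (rho \<kappa> e \<alpha> (\<pi> q))"
  note vt = section_tangent[OF vframe_section[OF ad] q]
  have r: "smooth_near \<B> (\<pi> q) (\<lambda>y. k b (rho \<kappa> e \<alpha> y))" if "b \<in> B" for b
    by (rule smooth_near_rho[OF ad adapted_projection[OF ad q] bl[OF that]])
  have s: "smooth_near \<A> q (\<lambda>q. tvec \<A> \<phi> q (b, 0) f)" for b by (rule smooth_near_tvec[OF ch q f])
  have "snd (vframe \<phi> \<beta> q) (\<lambda>q. snd (xframe \<kappa> \<phi> e \<alpha> q) f) =
      snd (vframe \<phi> \<beta> q) (\<lambda>q. \<Sum>b\<in>B. ?r b q * tvec \<A> \<phi> q (b, 0) f)"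
    by (rule tangent_cong[OF vt adapted_open(1)[OF ad] q]) (rule snd_xframe_coordinates[OF ad k])
  also have "\<dots> = (\<Sum>b\<in>B. snd (vframe \<phi> \<beta> q) (\<lambda>q. ?r b q * tvec \<A> \<phi> q (b, 0) f))"
    by (intro tangent_sum[OF vt] smooth_near_mult smooth_near_pullback[OF r] s)
  also have "\<dots> = (\<Sum>b\<in>B. ?r b q * tvec \<A> \<phi> q (b, 0) (\<lambda>q. snd (vframe \<phi> \<beta> q) f))"
  proof (rule sum.cong[OF refl])
    fix b assume b: "b \<in> B"
    show "snd (vframe \<phi> \<beta> q) (\<lambda>q. ?r b q * tvec \<A> \<phi> q (b, 0) f) =
        ?r b q * tvec \<A> \<phi> q (b, 0) (\<lambda>q. snd (vframe \<phi> \<beta> q) f)"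
      using tangent_mult[OF vt smooth_near_pullback[OF r[OF b]] s] vframe_pullback[OF ad q r[OF b]]
        tvec_commute[OF ch q f, of "(0, axis \<beta> 1)" "(b, 0)"]
      by (simp add: snd_vframe[OF ad])
  qed
  also have "\<dots> = snd (xframe \<kappa> \<phi> e \<alpha> q) (\<lambda>q. snd (vframe \<phi> \<beta> q) f)"
    by (rule snd_xframe_coordinates[OF ad k q, symmetric])
  finally show ?thesis .
qed

lemma vframe_vframe_commute:
  assumes ad: "adapted \<kappa> \<phi> e" and q: "q \<in> fst \<phi>" and f: "smooth_near \<A> q f"
  shows "snd (vframe \<phi> \<beta> q) (\<lambda>q. snd (vframe \<phi> \<alpha> q) f) =
    snd (vframe \<phi> \<alpha> q) (\<lambda>q. snd (vframe \<phi> \<beta> q) f)"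
  unfolding snd_vframe[OF ad] by (rule tvec_commute[OF adapted_chart[OF ad] q f])

text \<open>Both sides obey the same Leibniz rule in each argument, so their difference is tensorial
  and may be tested on the canonical basis, where brackets with vertical elements are zero and the
  anchors commute.\<close>

lemma anchor_bracket_vertical:
  assumes "open U" "vertical_section P U V" "smooth_section P U X" "m \<in> U" "smooth_near \<A> m f"
  shows "snd (bracket P V X m) f = snd (V m) (\<lambda>q. snd (X q) f) - snd (X m) (\<lambda>q. snd (V q) f)"
proof -
  obtain \<kappa> \<phi> e where ad: "adapted \<kappa> \<phi> e" "m \<in> fst \<phi>" by (rule adapted_frame_at)
  obtain U' where U': "open U'" "m \<in> U'" "\<And>q. q \<in> U' \<Longrightarrow> smooth_near \<A> q f"
    using smooth_near_eventually[OF assms(5)] by blast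
  define W where "W = U \<inter> fst \<phi> \<inter> U'"
  have W: "open W" "m \<in> W" "W \<subseteq> fst \<phi>" "W \<subseteq> U" "\<And>q. q \<in> W \<Longrightarrow> smooth_near \<A> q f"
    using assms U' ad adapted_open(1)[OF ad(1)] by (auto simp: W_def)
  have V: "vertical_section P W V" using vertical_section_subset[OF assms(2,1) W(1,4)] .
  have X: "smooth_section P W X" using smooth_section_subset[OF assms(3,1) W(1,4)] .
  define H where "H V X \<longleftrightarrow> (\<forall>q\<in>W. snd (bracket P V X q) f =
    snd (V q) (\<lambda>q. snd (X q) f) - snd (X q) (\<lambda>q. snd (V q) f))" for V X
  note sf = section_apply_smooth[OF W(1) _ _ W(5)]
  have add: "H V (\<lambda>q. X q + Y q)" if V: "smooth_section P W V" and X: "smooth_section P W X"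
    and Y: "smooth_section P W Y" and H: "H V X" "H V Y" for V X Y
    unfolding H_def
  proof
    fix q assume q: "q \<in> W"
    show "snd (bracket P V (\<lambda>q. X q + Y q) q) f =
      snd (V q) (\<lambda>q. snd (X q + Y q) f) - snd (X q + Y q) (\<lambda>q. snd (V q) f)"
      using H q by (simp add: H_def bracket_add_right[OF W(1) V X Y q]
          tangent_add[OF section_tangent[OF V q] sf[OF X q q] sf[OF Y q q]])
  qed
  have scale: "H V (\<lambda>q. g q *\<^sub>R X q)" if V: "smooth_section P W V" and X: "smooth_section P W X"
    and g: "\<And>q. q \<in> W \<Longrightarrow> smooth_near \<A> q g" and H: "H V X" for V X g
    unfolding H_def
  proof
    fix q assume q: "q \<in> W"
    show "snd (bracket P V (\<lambda>q. g q *\<^sub>R X q) q) f =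
      snd (V q) (\<lambda>q. snd (g q *\<^sub>R X q) f) - snd (g q *\<^sub>R X q) (\<lambda>q. snd (V q) f)"
    proof -
      have "snd (bracket P V X q) f = snd (V q) (\<lambda>q. snd (X q) f) - snd (X q) (\<lambda>q. snd (V q) f)"
        using H q by (simp add: H_def)
      then show ?thesis
        by (simp add: bracket_scale_right[OF W(1) V X g q] scaleR_fun_def
            tangent_mult[OF section_tangent[OF V q] g[OF q] sf[OF X q q]] right_diff_distrib)
    qed
  qed
  have cong: "H V Y" if V: "smooth_section P W V" and X: "smooth_section P W X"
    and eq: "\<And>q. q \<in> W \<Longrightarrow> X q = Y q" and H: "H V X" for V X Y
    unfolding H_def
  proof
    fix q assume q: "q \<in> W"
    have "snd (V q) (\<lambda>q. snd (X q) f) = snd (V q) (\<lambda>q. snd (Y q) f)"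
      by (rule tangent_cong[OF section_tangent[OF V q] W(1) q]) (simp add: eq)
    then show "snd (bracket P V Y q) f = snd (V q) (\<lambda>q. snd (Y q) f) - snd (Y q) (\<lambda>q. snd (V q) f)"
      using H q bracket_cong[OF W(1) V X, of V Y q] eq by (simp add: H_def)
  qed
  have swap: "H V X \<longleftrightarrow> H X V" if "smooth_section P W V" "smooth_section P W X" for V X
  proof -
    have "snd (bracket P V X q) f = - snd (bracket P X V q) f" if "q \<in> W" for q
      using bracket_antisym[OF W(1) \<open>smooth_section P W V\<close> \<open>smooth_section P W X\<close> that] by simp
    then show ?thesis by (auto simp: H_def)
  qed
  have sv: "smooth_section P W (vframe \<phi> \<beta>)" for \<beta>
    using vertical_section_vframe[OF ad(1) W(1,3)] vertical_sectionD(1) by blast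
  \<comment> \<open>One argument at a time: \<open>X\<close> varies against a fixed vertical basis
    element, and after a swap the vertical argument varies.\<close>
  have 1: "H (vframe \<phi> \<beta>) X" for \<beta>
  proof (rule section_induct[OF W(1) X ad(1) W(3)])
    show "H (vframe \<phi> \<beta>) (xframe \<kappa> \<phi> e \<alpha>)" for \<alpha>
      using W(3,5) by (auto simp: H_def bracket_vx[OF ad(1)] vframe_xframe_commute[OF ad(1)])
    show "H (vframe \<phi> \<beta>) (vframe \<phi> \<alpha>)" for \<alpha>
      using W(3,5) by (auto simp: H_def bracket_vv[OF ad(1)] vframe_vframe_commute[OF ad(1), of _ f \<beta> \<alpha>])
  qed (auto intro: add[OF sv] scale[OF sv] cong[OF sv])
  have "H X V"
  proof (rule vertical_section_induct[OF W(1) V ad(1) W(3)])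
    show "H X (vframe \<phi> \<beta>)" for \<beta> using 1 swap[OF X sv] by blast
  qed (auto intro: add[OF X] scale[OF X] cong[OF X] dest: vertical_sectionD(1))
  then have "H V X" using swap[OF X vertical_sectionD(1)[OF V]] by blast
  then show ?thesis using W(2) by (simp add: H_def)
qed

text \<open>Brackets of the vertical basis vanish, and the Leibniz terms are multiples of the
  vertical arguments.\<close>

lemma vertical_bracket:
  assumes "open U" "vertical_section P U V" "vertical_section P U V'" "m \<in> U"
  shows "bracket P V V' m \<in> vertical P m"
proof -
  obtain \<kappa> \<phi> e where ad: "adapted \<kappa> \<phi> e" "m \<in> fst \<phi>" by (rule adapted_frame_at)
  define W where "W = U \<inter> fst \<phi>"
  have W: "open W" "m \<in> W" "W \<subseteq> fst \<phi>" "W \<subseteq> U"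
    using assms ad adapted_open(1)[OF ad(1)] by (auto simp: W_def)
  note vs = vertical_section_subset[OF _ assms(1) W(1,4)]
  note va = subspace_add[OF vertical_subspace] and vc = subspace_scale[OF vertical_subspace]
  define H where "H V V' \<longleftrightarrow> (\<forall>q\<in>W. bracket P V V' q \<in> vertical P q)" for V V'
  have ind: "H V X" if V: "vertical_section P W V" and X: "vertical_section P W X"
    and v: "\<And>\<beta>. H V (vframe \<phi> \<beta>)" for V X
  proof (rule vertical_section_induct[OF W(1) X ad(1) W(3), where Q = "H V"])
    show "H V (vframe \<phi> \<alpha>)" for \<alpha> by (rule v)
  next
    note D = vertical_sectionD
    show "H V (\<lambda>q. X q + Y q)" if "vertical_section P W X" "vertical_section P W Y" "H V X" "H V Y" for X Y
      using that bracket_add_right[OF W(1) D(1)[OF V] D(1) D(1)] va by (simp add: H_def)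
    show "H V (\<lambda>q. f q *\<^sub>R X q)" if "\<And>q. q \<in> W \<Longrightarrow> smooth_near \<A> q f" "vertical_section P W X" "H V X" for f X
      using that bracket_scale_right[OF W(1) D(1)[OF V] D(1)] va vc D(2) by (simp add: H_def)
    show "H V Y" if "vertical_section P W X" "\<And>q. q \<in> W \<Longrightarrow> X q = Y q" "H V X" for X Y
      using that bracket_cong[OF W(1) D(1)[OF V] D(1)[OF that(1)], of V Y] by (simp add: H_def)
  qed
  have swap: "H V X" if "vertical_section P W V" "vertical_section P W X" "H X V" for V X
    using that bracket_antisym[OF W(1) vertical_sectionD(1)[OF that(1)] vertical_sectionD(1)[OF that(2)]]
      subspace_neg[OF vertical_subspace] by (simp add: H_def)
  note vv = vertical_section_vframe[OF ad(1) W(1,3)]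
  have "H (vframe \<phi> \<alpha>) (vframe \<phi> \<beta>)" for \<alpha> \<beta>
    using W(3) by (auto simp: H_def bracket_vv[OF ad(1)] subspace_0[OF vertical_subspace])
  then have "H (vframe \<phi> \<alpha>) V" for \<alpha> using ind[OF vv vs[OF assms(2)]] by blast
  then have "H V V'" using ind[OF vs[OF assms(2)] vs[OF assms(3)]] swap[OF vs[OF assms(2)] vv] by blast
  then show ?thesis using W(2) by (simp add: H_def)
qed

section \<open>The Jacobiator with a vertical entry\<close>

definition jacobiator where
  "jacobiator X Y Z q = bracket P X (bracket P Y Z) q + bracket P Y (bracket P Z X) q + bracket P Z (bracket P X Y) q"

context
  fixes W :: "'p set"
  assumes W: "open W"
begin

lemma bracket_bracket_antisym:
  assumes "smooth_section P W X" "smooth_section P W Y" "smooth_section P W Z" "q \<in> W"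
  shows "bracket P X (bracket P Y Z) q = - bracket P X (bracket P Z Y) q"
  using bracket_cong[OF W assms(1) smooth_section_minus[OF W bracket_section[OF W assms(3,2)]], of X "bracket P Y Z" q]
    bracket_antisym[OF W assms(2,3)] bracket_minus_right[OF W assms(1) bracket_section[OF W assms(3,2)] assms(4)] assms(4)
  by simp

lemma jacobiator_swap:
  assumes "smooth_section P W X" "smooth_section P W Y" "smooth_section P W Z" "q \<in> W"
  shows "jacobiator X Z Y q = - jacobiator X Y Z q"
  unfolding jacobiator_def
  using bracket_bracket_antisym[OF assms(1-4)] bracket_bracket_antisym[OF assms(2,3,1,4)]
    bracket_bracket_antisym[OF assms(3,1,2,4)] by simp

lemma jacobiator_add:
  assumes X: "smooth_section P W X" and Y: "smooth_section P W Y" and Y': "smooth_section P W Y'"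
    and Z: "smooth_section P W Z" and q: "q \<in> W"
  shows "jacobiator X (\<lambda>q. Y q + Y' q) Z q = jacobiator X Y Z q + jacobiator X Y' Z q"
proof -
  note b = bracket_section[OF W]
  have "bracket P X (bracket P (\<lambda>q. Y q + Y' q) Z) q = bracket P X (\<lambda>q. bracket P Y Z q + bracket P Y' Z q) q"
    by (rule bracket_cong[OF W X smooth_section_add[OF W b[OF Y Z] b[OF Y' Z]]])
      (auto simp: bracket_add_left[OF W Y Y' Z] q)
  moreover have "bracket P Z (bracket P X (\<lambda>q. Y q + Y' q)) q = bracket P Z (\<lambda>q. bracket P X Y q + bracket P X Y' q) q"
    by (rule bracket_cong[OF W Z smooth_section_add[OF W b[OF X Y] b[OF X Y']]])
      (auto simp: bracket_add_right[OF W X Y Y'] q)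
  ultimately show ?thesis
    by (simp add: jacobiator_def bracket_add_right[OF W X b[OF Y Z] b[OF Y' Z] q]
        bracket_add_right[OF W Z b[OF X Y] b[OF X Y'] q] bracket_add_left[OF W Y Y' b[OF Z X] q])
qed

lemma jacobiator_cong:
  assumes X: "smooth_section P W X" and Y: "smooth_section P W Y" and Z: "smooth_section P W Z" and q: "q \<in> W"
    and "\<And>q. q \<in> W \<Longrightarrow> X' q = X q" "\<And>q. q \<in> W \<Longrightarrow> Y' q = Y q" "\<And>q. q \<in> W \<Longrightarrow> Z' q = Z q"
  shows "jacobiator X' Y' Z' q = jacobiator X Y Z q"
  unfolding jacobiator_def
  using assms(4-7) bracket_section[OF W] X Y Z
  by (intro arg_cong2[where f = "(+)"]; intro bracket_cong[OF W]) (auto intro: bracket_cong[OF W])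

text \<open>The terms with first derivatives of \<open>g\<close> cancel, and the remaining
  coefficient of \<open>X\<close> is the failure of the anchor to respect the bracket of
  \<open>Y\<close> and \<open>V\<close>, which is zero as \<open>V\<close> is vertical.\<close>

lemma jacobiator_scale_middle:
  assumes V: "vertical_section P W V" and X: "smooth_section P W X" and Y: "smooth_section P W Y"
    and g: "\<And>q. q \<in> W \<Longrightarrow> smooth_near \<A> q g" and q: "q \<in> W"
  shows "jacobiator V (\<lambda>q. g q *\<^sub>R X q) Y q = g q *\<^sub>R jacobiator V X Y q"
proof -
  note Vs = vertical_sectionD(1)[OF V]
  note b = bracket_section[OF W] and sc = smooth_section_scale[OF W]
  have Yg: "smooth_near \<A> q (\<lambda>q. snd (Y q) g)" and Vg: "smooth_near \<A> q (\<lambda>q. snd (V q) g)" if "q \<in> W" for q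
    using section_apply_smooth[OF W] Y Vs that g by blast+
  have "bracket P V (bracket P (\<lambda>q. g q *\<^sub>R X q) Y) q =
      bracket P V (\<lambda>q. g q *\<^sub>R bracket P X Y q - snd (Y q) g *\<^sub>R X q) q"
    by (rule bracket_cong[OF W Vs smooth_section_diff[OF W sc[OF g b[OF X Y]] sc[OF Yg X]]])
      (auto simp: bracket_scale_left[OF W X Y g] q)
  also have "\<dots> = g q *\<^sub>R bracket P V (bracket P X Y) q + snd (V q) g *\<^sub>R bracket P X Y q -
      (snd (Y q) g *\<^sub>R bracket P V X q + snd (V q) (\<lambda>q. snd (Y q) g) *\<^sub>R X q)"
    by (simp add: bracket_diff_right[OF W Vs sc[OF g b[OF X Y]] sc[OF Yg X] q]
        bracket_scale_right[OF W Vs b[OF X Y] g q] bracket_scale_right[OF W Vs X Yg q])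
  finally have 1: "bracket P V (bracket P (\<lambda>q. g q *\<^sub>R X q) Y) q = \<dots>" .
  have 2: "bracket P (\<lambda>q. g q *\<^sub>R X q) (bracket P Y V) q =
      g q *\<^sub>R bracket P X (bracket P Y V) q - snd (bracket P Y V q) g *\<^sub>R X q"
    by (rule bracket_scale_left[OF W X b[OF Y Vs] g q])
  have "bracket P Y (bracket P V (\<lambda>q. g q *\<^sub>R X q)) q =
      bracket P Y (\<lambda>q. g q *\<^sub>R bracket P V X q + snd (V q) g *\<^sub>R X q) q"
    by (rule bracket_cong[OF W Y smooth_section_add[OF W sc[OF g b[OF Vs X]] sc[OF Vg X]]])
      (auto simp: bracket_scale_right[OF W Vs X g] q)
  also have "\<dots> = g q *\<^sub>R bracket P Y (bracket P V X) q + snd (Y q) g *\<^sub>R bracket P V X q +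
      (snd (V q) g *\<^sub>R bracket P Y X q + snd (Y q) (\<lambda>q. snd (V q) g) *\<^sub>R X q)"
    by (simp add: bracket_add_right[OF W Y sc[OF g b[OF Vs X]] sc[OF Vg X] q]
        bracket_scale_right[OF W Y b[OF Vs X] g q] bracket_scale_right[OF W Y X Vg q])
  finally have 3: "bracket P Y (bracket P V (\<lambda>q. g q *\<^sub>R X q)) q = \<dots>" .
  have 4: "snd (bracket P Y V q) g = snd (Y q) (\<lambda>q. snd (V q) g) - snd (V q) (\<lambda>q. snd (Y q) g)"
    using bracket_antisym[OF W Y Vs q] anchor_bracket_vertical[OF W V Y q g[OF q]] by simp
  show ?thesis
    unfolding jacobiator_def 1 2 3 4 bracket_antisym[OF W Y X q]
    by (simp add: algebra_simps)
qed

text \<open>The coefficient \<open>r\<close> is the failure of the anchor on the pair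
  \<open>X\<close>, \<open>Y\<close>. It multiplies \<open>V\<close>, so verticality of the
  Jacobiator is preserved even where tensoriality is not claimed.\<close>

lemma jacobiator_scale_left:
  assumes V: "vertical_section P W V" and X: "smooth_section P W X" and Y: "smooth_section P W Y"
    and g: "\<And>q. q \<in> W \<Longrightarrow> smooth_near \<A> q g" and q: "q \<in> W"
  obtains r where "jacobiator (\<lambda>q. g q *\<^sub>R V q) X Y q = g q *\<^sub>R jacobiator V X Y q + r *\<^sub>R V q"
proof -
  note Vs = vertical_sectionD(1)[OF V]
  note b = bracket_section[OF W] and sc = smooth_section_scale[OF W]
  have Yg: "smooth_near \<A> q (\<lambda>q. snd (Y q) g)" and Xg: "smooth_near \<A> q (\<lambda>q. snd (X q) g)" if "q \<in> W" for q
    using section_apply_smooth[OF W] Y X that g by blast+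
  have 1: "bracket P (\<lambda>q. g q *\<^sub>R V q) (bracket P X Y) q =
      g q *\<^sub>R bracket P V (bracket P X Y) q - snd (bracket P X Y q) g *\<^sub>R V q"
    by (rule bracket_scale_left[OF W Vs b[OF X Y] g q])
  have "bracket P X (bracket P Y (\<lambda>q. g q *\<^sub>R V q)) q =
      bracket P X (\<lambda>q. g q *\<^sub>R bracket P Y V q + snd (Y q) g *\<^sub>R V q) q"
    by (rule bracket_cong[OF W X smooth_section_add[OF W sc[OF g b[OF Y Vs]] sc[OF Yg Vs]]])
      (auto simp: bracket_scale_right[OF W Y Vs g] q)
  also have "\<dots> = g q *\<^sub>R bracket P X (bracket P Y V) q + snd (X q) g *\<^sub>R bracket P Y V q +
      (snd (Y q) g *\<^sub>R bracket P X V q + snd (X q) (\<lambda>q. snd (Y q) g) *\<^sub>R V q)"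
    by (simp add: bracket_add_right[OF W X sc[OF g b[OF Y Vs]] sc[OF Yg Vs] q]
        bracket_scale_right[OF W X b[OF Y Vs] g q] bracket_scale_right[OF W X Vs Yg q])
  finally have 2: "bracket P X (bracket P Y (\<lambda>q. g q *\<^sub>R V q)) q = \<dots>" .
  have "bracket P Y (bracket P (\<lambda>q. g q *\<^sub>R V q) X) q =
      bracket P Y (\<lambda>q. g q *\<^sub>R bracket P V X q - snd (X q) g *\<^sub>R V q) q"
    by (rule bracket_cong[OF W Y smooth_section_diff[OF W sc[OF g b[OF Vs X]] sc[OF Xg Vs]]])
      (auto simp: bracket_scale_left[OF W Vs X g] q)
  also have "\<dots> = g q *\<^sub>R bracket P Y (bracket P V X) q + snd (Y q) g *\<^sub>R bracket P V X q -
      (snd (X q) g *\<^sub>R bracket P Y V q + snd (Y q) (\<lambda>q. snd (X q) g) *\<^sub>R V q)"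
    by (simp add: bracket_diff_right[OF W Y sc[OF g b[OF Vs X]] sc[OF Xg Vs] q]
        bracket_scale_right[OF W Y b[OF Vs X] g q] bracket_scale_right[OF W Y Vs Xg q])
  finally have 3: "bracket P Y (bracket P (\<lambda>q. g q *\<^sub>R V q) X) q = \<dots>" .
  show thesis
    by (rule that[of "snd (X q) (\<lambda>q. snd (Y q) g) - snd (Y q) (\<lambda>q. snd (X q) g) - snd (bracket P X Y q) g"])
      (simp add: jacobiator_def 1 2 3 bracket_antisym[OF W X Vs q] algebra_simps)
qed

end

text \<open>Inner brackets containing the vertical element vanish on the whole chart, which leaves
  \<open>[V, [X, Y]]\<close>. There \<open>[X, Y]\<close> is zero or a combination of the
  \<open>X\<close> frame with coefficients pulled back from the base.\<close>

lemma jacobiator_canonical: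
  assumes ad: "adapted \<kappa> \<phi> e" and q: "q \<in> fst \<phi>"
    and X: "X \<in> range (xframe \<kappa> \<phi> e) \<union> range (vframe \<phi>)"
    and Y: "Y \<in> range (xframe \<kappa> \<phi> e) \<union> range (vframe \<phi>)"
  shows "jacobiator (vframe \<phi> \<beta>) X Y q = 0"
proof -
  note W = adapted_open(1)[OF ad] and sv = vframe_section[OF ad] and sx = xframe_section[OF ad]
  have z: "bracket P Z (vframe \<phi> \<beta>) q = 0" "bracket P (vframe \<phi> \<beta>) Z q = 0"
    if "Z \<in> range (xframe \<kappa> \<phi> e) \<union> range (vframe \<phi>)" "q \<in> fst \<phi>" for Z q \<beta>
    using that bracket_xv[OF ad] bracket_vv[OF ad] bracket_vx[OF ad] by auto
  have sZ: "smooth_section P (fst \<phi>) Z" if "Z \<in> range (xframe \<kappa> \<phi> e) \<union> range (vframe \<phi>)" for Z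
    using that sv sx by auto
  have "bracket P X (bracket P Y (vframe \<phi> \<beta>)) q = 0" "bracket P Y (bracket P (vframe \<phi> \<beta>) X) q = 0"
    using z X Y by (auto intro!: bracket_zero_right[OF W sZ _ q])
  moreover have "bracket P (vframe \<phi> \<beta>) (bracket P X Y) q = 0"
  proof (cases "X \<in> range (vframe \<phi>) \<or> Y \<in> range (vframe \<phi>)")
    case True
    then have "bracket P X Y q = 0" if "q \<in> fst \<phi>" for q
      using z[OF X that] z[OF Y that] by auto
    then show ?thesis by (intro bracket_zero_right[OF W sv _ q])
  next
    case False
    then obtain \<alpha> \<alpha>' where [simp]: "X = xframe \<kappa> \<phi> e \<alpha>" "Y = xframe \<kappa> \<phi> e \<alpha>'" using X Y by blast
    obtain C where C: "\<And>x \<gamma>. x \<in> fst \<kappa> \<Longrightarrow> smooth_near \<B> x (C \<gamma>)"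
      "\<And>x. x \<in> fst \<kappa> \<Longrightarrow> bracket A (e \<alpha>) (e \<alpha>') x = (\<Sum>\<gamma>\<in>UNIV. C \<gamma> x *\<^sub>R e \<gamma> x)"
    proof -
      have "smooth_section A (fst \<kappa>) (bracket A (e \<alpha>) (e \<alpha>'))"
        using algebroid adapted_open(2)[OF ad] adapted_section[OF ad]
        by (simp add: pre_lie_algebroid_def almost_lie_bracket_def)
      then show thesis
        using base.local_frame_coefficients[OF adapted_open(2)[OF ad] _ adapted_local_frame[OF ad], of _ thesis] that
        by auto
    qed
    have sC: "smooth_near \<A> p (\<lambda>p. C \<gamma> (\<pi> p))" if "p \<in> fst \<phi>" for p \<gamma>
      by (rule smooth_near_pullback[OF C(1)[OF adapted_projection[OF ad that]]])
    have s: "smooth_section P (fst \<phi>) (\<lambda>p. C \<gamma> (\<pi> p) *\<^sub>R xframe \<kappa> \<phi> e \<gamma> p)" for \<gamma>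
      by (rule smooth_section_scale[OF W sC sx])
    have "bracket P (vframe \<phi> \<beta>) (bracket P X Y) q =
        bracket P (vframe \<phi> \<beta>) (\<lambda>p. \<Sum>\<gamma>\<in>UNIV. C \<gamma> (\<pi> p) *\<^sub>R xframe \<kappa> \<phi> e \<gamma> p) q"
      by (rule bracket_cong[OF W sv smooth_section_sum[OF W s]])
        (auto simp: q bracket_xx[OF ad _ C(2)[OF adapted_projection[OF ad]]])
    also have "\<dots> = (\<Sum>\<gamma>\<in>UNIV. bracket P (vframe \<phi> \<beta>) (\<lambda>p. C \<gamma> (\<pi> p) *\<^sub>R xframe \<kappa> \<phi> e \<gamma> p) q)"
      by (rule bracket_sum_right[OF W sv s q])
    also have "\<dots> = 0"
      using vframe_pullback[OF ad q C(1)[OF adapted_projection[OF ad q]]]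
      by (simp add: bracket_scale_right[OF W sv sx sC q] bracket_vx[OF ad q])
    finally show ?thesis .
  qed
  ultimately show ?thesis by (simp add: jacobiator_def)
qed

text \<open>The Jacobi identity may fail in \<open>A\<close>, but the structure functions of the canonical frame are
  constant along the fibres.\<close>

lemma jacobiator_vertical:
  assumes "open U" "vertical_section P U V" "smooth_section P U X" "smooth_section P U Y" "m \<in> U"
  shows "jacobiator V X Y m \<in> vertical P m"
proof -
  obtain \<kappa> \<phi> e where ad: "adapted \<kappa> \<phi> e" "m \<in> fst \<phi>" by (rule adapted_frame_at)
  define W where "W = U \<inter> fst \<phi>"
  have W: "open W" "m \<in> W" "W \<subseteq> fst \<phi>" "W \<subseteq> U"
    using assms ad adapted_open(1)[OF ad(1)] by (auto simp: W_def)
  note ss = smooth_section_subset[OF _ assms(1) W(1,4)]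
  note va = subspace_add[OF vertical_subspace] and vc = subspace_scale[OF vertical_subspace]
  note sv = vertical_section_vframe[OF ad(1) W(1,3)]
  have sx: "smooth_section P W (xframe \<kappa> \<phi> e \<alpha>)" for \<alpha>
    using smooth_section_subset[OF xframe_section[OF ad(1)] adapted_open(1)[OF ad(1)] W(1,3)] .
  define H where "H V X Y \<longleftrightarrow> (\<forall>q\<in>W. jacobiator V X Y q \<in> vertical P q)" for V X Y
  have ind: "H V X Y" if V: "vertical_section P W V" and X: "smooth_section P W X" and Y: "smooth_section P W Y"
    and x: "\<And>\<alpha>. H V (xframe \<kappa> \<phi> e \<alpha>) Y" and v: "\<And>\<alpha>. H V (vframe \<phi> \<alpha>) Y" for V X Y
  proof (rule section_induct[OF W(1) X ad(1) W(3), where Q = "\<lambda>X. H V X Y"])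
    show "H V (xframe \<kappa> \<phi> e \<alpha>) Y" "H V (vframe \<phi> \<alpha>) Y" for \<alpha> by (rule x v)+
  next
    note Vs = vertical_sectionD(1)[OF V]
    show "H V (\<lambda>q. X q + X' q) Y" if "smooth_section P W X" "smooth_section P W X'" "H V X Y" "H V X' Y" for X X'
      using that jacobiator_add[OF W(1) Vs that(1,2) Y] va by (simp add: H_def)
    show "H V (\<lambda>q. f q *\<^sub>R X q) Y" if "\<And>q. q \<in> W \<Longrightarrow> smooth_near \<A> q f" "smooth_section P W X" "H V X Y" for f X
      using that jacobiator_scale_middle[OF W(1) V that(2) Y that(1)] vc by (simp add: H_def)
    show "H V X' Y" if "smooth_section P W X" "\<And>q. q \<in> W \<Longrightarrow> X q = X' q" "H V X Y" for X X'
      using that jacobiator_cong[OF W(1) Vs that(1) Y, of _ V X' Y] by (simp add: H_def)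
  qed
  have swap: "H V X Y" if "vertical_section P W V" "smooth_section P W X" "smooth_section P W Y" "H V Y X" for V X Y
    using that jacobiator_swap[OF W(1) vertical_sectionD(1)[OF that(1)] that(3,2)]
      subspace_neg[OF vertical_subspace] by (simp add: H_def)
  have canon: "H (vframe \<phi> \<beta>) X Y" if "X \<in> range (xframe \<kappa> \<phi> e) \<union> range (vframe \<phi>)"
    "Y \<in> range (xframe \<kappa> \<phi> e) \<union> range (vframe \<phi>)" for \<beta> X Y
    using that W(3) jacobiator_canonical[OF ad(1)] subspace_0[OF vertical_subspace] by (simp add: H_def subset_eq)
  \<comment> \<open>\<open>ind\<close> varies only the middle entry; swapping gives access to the
    last one, so the two arguments pass from the basis to arbitrary sections in turn.\<close>
  have 1: "H (vframe \<phi> \<beta>) X Z" if "Z \<in> range (xframe \<kappa> \<phi> e) \<union> range (vframe \<phi>)" for \<beta> Z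
    using that sx vertical_sectionD(1)[OF sv]
    by (intro ind[OF sv ss[OF assms(3)]] canon) auto
  have 2: "H (vframe \<phi> \<beta>) Y X" for \<beta>
    by (rule ind[OF sv ss[OF assms(4)] ss[OF assms(3)]];
        rule swap[OF sv _ ss[OF assms(3)]]; (rule sx vertical_sectionD(1)[OF sv] 1 | blast)+)
  then have 3: "H (vframe \<phi> \<beta>) X Y" for \<beta> using swap[OF sv ss[OF assms(3)] ss[OF assms(4)]] by blast
  have "H V X Y"
  proof (rule vertical_section_induct[OF W(1) vertical_section_subset[OF assms(2,1) W(1,4)] ad(1) W(3),
        where Q = "\<lambda>V. H V X Y"])
    show "H (vframe \<phi> \<beta>) X Y" for \<beta> by (rule 3)
  next
    note D = vertical_sectionD
    \<comment> \<open>Additivity is available in the middle entry; a cyclic shift and a swap bring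
      \<open>V\<close> there.\<close>
    have cyc: "jacobiator V X Y q = jacobiator X Y V q" for V q
      by (simp add: jacobiator_def)
    have sw: "jacobiator V X Y q = - jacobiator X V Y q" if "vertical_section P W V" "q \<in> W" for V q
      using jacobiator_swap[OF W(1) ss[OF assms(3)] D(1)[OF that(1)] ss[OF assms(4)] that(2)] by (simp add: cyc)
    show "H (\<lambda>q. V q + V' q) X Y" if V: "vertical_section P W V" "vertical_section P W V'" "H V X Y" "H V' X Y" for V V'
    proof -
      have "jacobiator (\<lambda>q. V q + V' q) X Y q = jacobiator V X Y q + jacobiator V' X Y q" if q: "q \<in> W" for q
        using sw[OF vertical_section_add[OF W(1) V(1,2)] q] sw[OF V(1) q] sw[OF V(2) q]
          jacobiator_add[OF W(1) ss[OF assms(3)] D(1)[OF V(1)] D(1)[OF V(2)] ss[OF assms(4)] q]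
        by simp
      then show ?thesis using V(3,4) va by (simp add: H_def)
    qed
    show "H (\<lambda>q. f q *\<^sub>R V q) X Y" if f: "\<And>q. q \<in> W \<Longrightarrow> smooth_near \<A> q f" and V: "vertical_section P W V" "H V X Y" for f V
      unfolding H_def
    proof
      fix q assume q: "q \<in> W"
      obtain r where "jacobiator (\<lambda>q. f q *\<^sub>R V q) X Y q = f q *\<^sub>R jacobiator V X Y q + r *\<^sub>R V q"
        using jacobiator_scale_left[OF W(1) V(1) ss[OF assms(3)] ss[OF assms(4)] f q] by blast
      then show "jacobiator (\<lambda>q. f q *\<^sub>R V q) X Y q \<in> vertical P q"
        using V(2) q va vc D(2)[OF V(1) q] by (simp add: H_def)
    qed
    show "H V' X Y" if "vertical_section P W V" "\<And>q. q \<in> W \<Longrightarrow> V q = V' q" "H V X Y" for V V'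
      using that jacobiator_cong[OF W(1) D(1)[OF that(1)] ss[OF assms(3)] ss[OF assms(4)], of _ V' X Y]
      by (simp add: H_def)
  qed
  then show ?thesis using W(2) by (simp add: H_def)
qed

end

section \<open>Semisprays and semi-Hamiltonian structures\<close>

lemma is_minus_diff1D:
  assumes "is_minus_diff1 E U \<omega> \<eta>" "open W" "W \<subseteq> U" "smooth_section E W X" "smooth_section E W Y" "x \<in> W"
  shows "\<omega> x (X x) (Y x) = - diff1 E \<eta> X Y x"
  using assms(1)[unfolded is_minus_diff1_def, THEN spec, THEN spec, THEN spec, THEN mp, THEN bspec] assms(2-6)
  by blast

text \<open>The form \<open>\<theta>\<close> is global, but its differential is required to vanish
  on vertical pairs only; the potentials \<open>L\<close> are constructed from it locally.\<close>

locale dynamics = prolongation A \<pi> P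
  for A :: "('k::finite, 'b::t2_space, 'e::real_normed_vector, 'v::real_vector) algebroid"
    and \<pi> :: "'p::t2_space \<Rightarrow> 'b"
    and P :: "('k + 'k, 'p, 'e \<times> (real ^ 'k), 'v \<times> 'p tangent) algebroid" +
  fixes S :: "'p \<Rightarrow> 'v \<times> 'p tangent"
    and J :: "'p \<Rightarrow> 'v \<times> 'p tangent \<Rightarrow> 'v \<times> 'p tangent"
    and \<Omega> :: "'p \<Rightarrow> 'v \<times> 'p tangent \<Rightarrow> 'v \<times> 'p tangent \<Rightarrow> real"
    and \<theta> :: "'p \<Rightarrow> 'v \<times> 'p tangent \<Rightarrow> real"
  assumes S_global: "smooth_section P UNIV S"
    and tangent_structure: "almost_tangent_structure P J"
    and compatible: "compatible P S J"
    and cotangent_structure: "almost_cotangent_structure P \<Omega>"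
    and \<theta>_form: "one_form P UNIV \<theta>"
    and \<theta>_closed: "open U \<Longrightarrow> vertical_section P U V \<Longrightarrow> vertical_section P U V' \<Longrightarrow> m \<in> U \<Longrightarrow> diff1 P \<theta> V V' m = 0"
    and \<Omega>_\<theta>: "is_minus_diff1 P UNIV \<Omega> (pullback J \<theta>)"
begin

lemma S_section: "open W \<Longrightarrow> smooth_section P W S"
  using smooth_section_subset[OF S_global] by simp

lemma vertical_fibre: "z \<in> vertical P m \<Longrightarrow> z \<in> fibre P m"
  by (simp add: vertical_def)

lemma J_endo: "endomorphism P J"
  using tangent_structure by (simp add: almost_tangent_structure_def)

lemma J_add: "z \<in> fibre P m \<Longrightarrow> z' \<in> fibre P m \<Longrightarrow> J m (z + z') = J m z + J m z'"
  and J_scale: "z \<in> fibre P m \<Longrightarrow> J m (c *\<^sub>R z) = c *\<^sub>R J m z"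
  and J_section: "open W \<Longrightarrow> smooth_section P W X \<Longrightarrow> smooth_section P W (\<lambda>q. J q (X q))"
  using J_endo unfolding endomorphism_def by simp_all

lemma J_image: "J m ` fibre P m = vertical P m"
  and J_kernel: "{z \<in> fibre P m. J m z = 0} = vertical P m"
  using tangent_structure by (simp_all add: almost_tangent_structure_def)

lemma J_vertical: "z \<in> fibre P m \<Longrightarrow> J m z \<in> vertical P m"
  using J_image by blast

lemma J_zero_iff: "z \<in> fibre P m \<Longrightarrow> J m z = 0 \<longleftrightarrow> z \<in> vertical P m"
  using J_kernel by blast

lemma J_on_vertical: "z \<in> vertical P m \<Longrightarrow> J m z = 0"
  using J_kernel by blast

lemma J_minus: "z \<in> fibre P m \<Longrightarrow> J m (- z) = - J m z"
  using J_scale[of z m "- 1"] by simp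

lemma J_diff: "z \<in> fibre P m \<Longrightarrow> z' \<in> fibre P m \<Longrightarrow> J m (z - z') = J m z - J m z'"
  using J_add[of z m "- z'"] J_minus[of z' m] subspace_neg[OF fibre_subspace] by simp

lemma J_vertical_section: "open W \<Longrightarrow> smooth_section P W X \<Longrightarrow> vertical_section P W (\<lambda>q. J q (X q))"
  by (simp add: vertical_section_def J_section J_vertical section_fibre)

lemma J_bracket_S: "open W \<Longrightarrow> vertical_section P W V \<Longrightarrow> q \<in> W \<Longrightarrow> J q (bracket P S V q) = - V q"
  using compatible unfolding compatible_def by blast

lemma \<Omega>_form: "two_form P \<Omega>"
  using cotangent_structure by (simp add: almost_cotangent_structure_def)

lemma \<Omega>_add_right: "u \<in> fibre P m \<Longrightarrow> z \<in> fibre P m \<Longrightarrow> z' \<in> fibre P m \<Longrightarrow> \<Omega> m u (z + z') = \<Omega> m u z + \<Omega> m u z'"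
  and \<Omega>_scale_right: "u \<in> fibre P m \<Longrightarrow> z \<in> fibre P m \<Longrightarrow> \<Omega> m u (c *\<^sub>R z) = c * \<Omega> m u z"
  and \<Omega>_antisym: "u \<in> fibre P m \<Longrightarrow> z \<in> fibre P m \<Longrightarrow> \<Omega> m u z = - \<Omega> m z u"
  using \<Omega>_form unfolding two_form_def by blast+

lemma \<Omega>_smooth:
  assumes "open W" "smooth_section P W X" "smooth_section P W Y" "q \<in> W"
  shows "smooth_near \<A> q (\<lambda>q. \<Omega> q (X q) (Y q))"
  using \<Omega>_form assms smooth_fun_iff[OF assms(1)] unfolding two_form_def by blast

lemma \<Omega>_add_left:
  assumes "u \<in> fibre P m" "z \<in> fibre P m" "z' \<in> fibre P m"
  shows "\<Omega> m (z + z') u = \<Omega> m z u + \<Omega> m z' u"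
  using \<Omega>_add_right[OF assms] \<Omega>_antisym[OF assms(1) subspace_add[OF fibre_subspace assms(2,3)]]
    \<Omega>_antisym[OF assms(1,2)] \<Omega>_antisym[OF assms(1,3)] by simp

lemma \<Omega>_scale_left:
  assumes "u \<in> fibre P m" "z \<in> fibre P m"
  shows "\<Omega> m (c *\<^sub>R z) u = c * \<Omega> m z u"
  using \<Omega>_scale_right[OF assms, of c] \<Omega>_antisym[OF assms(1) subspace_scale[OF fibre_subspace assms(2)], of c]
    \<Omega>_antisym[OF assms] by simp

lemma \<Omega>_minus_left: "u \<in> fibre P m \<Longrightarrow> z \<in> fibre P m \<Longrightarrow> \<Omega> m (- z) u = - \<Omega> m z u"
  using \<Omega>_scale_left[of u m z "- 1"] by simp

lemma \<Omega>_diff_left: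
  "u \<in> fibre P m \<Longrightarrow> z \<in> fibre P m \<Longrightarrow> z' \<in> fibre P m \<Longrightarrow> \<Omega> m (z - z') u = \<Omega> m z u - \<Omega> m z' u"
  using \<Omega>_add_left[of u m z "- z'"] \<Omega>_minus_left[of u m z'] subspace_neg[OF fibre_subspace] by simp

lemma \<Omega>_vertical_iff: "z \<in> vertical P m \<longleftrightarrow> z \<in> fibre P m \<and> (\<forall>w\<in>vertical P m. \<Omega> m z w = 0)"
proof -
  have "vertical P m = {z \<in> fibre P m. \<forall>w\<in>vertical P m. \<Omega> m z w = 0}"
    using cotangent_structure by (simp add: almost_cotangent_structure_def lagrangian_subspace_def)
  then show ?thesis by blast
qed

lemma \<Omega>_vertical: "z \<in> vertical P m \<Longrightarrow> w \<in> vertical P m \<Longrightarrow> \<Omega> m z w = 0"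
  using \<Omega>_vertical_iff by blast

lemma \<Omega>_nondegenerate: "z \<in> fibre P m \<Longrightarrow> (\<And>w. w \<in> fibre P m \<Longrightarrow> \<Omega> m z w = 0) \<Longrightarrow> z = 0"
  using cotangent_structure unfolding almost_cotangent_structure_def by blast

lemma \<theta>_add: "z \<in> fibre P m \<Longrightarrow> z' \<in> fibre P m \<Longrightarrow> \<theta> m (z + z') = \<theta> m z + \<theta> m z'"
  and \<theta>_scale: "z \<in> fibre P m \<Longrightarrow> \<theta> m (c *\<^sub>R z) = c * \<theta> m z"
  using \<theta>_form unfolding one_form_def by blast+

lemma \<theta>_smooth: "open W \<Longrightarrow> smooth_section P W X \<Longrightarrow> q \<in> W \<Longrightarrow> smooth_near \<A> q (\<lambda>q. \<theta> q (X q))"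
  using \<theta>_form smooth_fun_iff unfolding one_form_def by blast

lemma \<theta>_zero: "\<theta> m 0 = 0"
  using \<theta>_scale[OF subspace_0[OF fibre_subspace], of m 0] by simp

lemma \<theta>_minus: "z \<in> fibre P m \<Longrightarrow> \<theta> m (- z) = - \<theta> m z"
  using \<theta>_scale[of z m "- 1"] by simp

lemma \<theta>_sum:
  assumes "\<And>i. i \<in> I \<Longrightarrow> b i \<in> fibre P m"
  shows "\<theta> m (\<Sum>i\<in>I. c i *\<^sub>R b i) = (\<Sum>i\<in>I. c i * \<theta> m (b i))"
  using assms
proof (induction I rule: infinite_finite_induct)
  case (insert i I)
  have "(\<Sum>i\<in>I. c i *\<^sub>R b i) \<in> fibre P m"
    using insert.prems fibre_subspace by (intro subspace_sum subspace_scale) auto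
  then show ?case
    using insert subspace_scale[OF fibre_subspace] by (simp add: \<theta>_add \<theta>_scale)
qed (simp_all add: \<theta>_zero)

subsection \<open>Local potentials\<close>

text \<open>As the vertical frame commutes, closedness of \<open>\<theta>\<close> on vertical
  sections becomes the symmetry hypothesis of the fibrewise Poincare lemma.\<close>

lemma fibre_derivative_\<theta>:
  assumes ad: "adapted \<kappa> \<phi> e" and q: "q \<in> fst \<phi>"
  shows "snd (vframe \<phi> \<gamma> q) (\<lambda>p. \<theta> p (vframe \<phi> \<beta> p)) = snd (vframe \<phi> \<beta> q) (\<lambda>p. \<theta> p (vframe \<phi> \<gamma> p))"
  using \<theta>_closed[OF adapted_open(1)[OF ad] vertical_section_vframe[OF ad adapted_open(1)[OF ad] order_refl]
      vertical_section_vframe[OF ad adapted_open(1)[OF ad] order_refl] q, of \<gamma> \<beta>]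
  by (simp add: diff1_def bracket_vv[OF ad q] \<theta>_zero)

text \<open>\<open>J\<close> takes values in the vertical bundle, so \<open>pullback J\<close> sees
  only vertical vectors: a function whose differential agrees with \<open>\<theta>\<close> on them
  has the same pulled back form, hence yields the same \<open>\<Omega>\<close>.\<close>

lemma local_potential_exists:
  obtains U L where "m \<in> U" "local_potential P J \<Omega> U L"
proof -
  obtain \<kappa> \<phi> e where ad: "adapted \<kappa> \<phi> e" and m: "m \<in> fst \<phi>" by (rule adapted_frame_at)
  note ch = adapted_chart[OF ad]
  obtain B and k :: "'e \<times> (real ^ 'k) \<Rightarrow> 'e \<times> (real ^ 'k) \<Rightarrow> real" where k: "coordinates B k"
    by (rule model_coordinates)
  define a where "a \<beta> q = \<theta> q (vframe \<phi> \<beta> q)" for \<beta> q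
  define F where "F \<beta> z = a \<beta> (chart_inv \<phi> z)" for \<beta> z
  have a: "smooth_near \<A> q (a \<beta>)" if "q \<in> fst \<phi>" for q \<beta>
    unfolding a_def by (rule \<theta>_smooth[OF adapted_open(1)[OF ad] vframe_section[OF ad] that])
  \<comment> \<open>The Poincare lemma contracts the fibres towards \<open>y0\<close>, so the chart
    image is cut down to a product whose second factor is a ball.\<close>
  obtain S1 S2 where S12: "open S1" "open S2" "snd \<phi> m \<in> S1 \<times> S2" "S1 \<times> S2 \<subseteq> snd \<phi> ` fst \<phi>"
    using open_prod_elim[OF chart_image_open[OF ch], of "snd \<phi> m"] m by blast
  obtain x0 y0 where xy: "snd \<phi> m = (x0, y0)" by (cases "snd \<phi> m")
  have "y0 \<in> S2" using S12(3) xy by simp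
  then obtain r where r: "r > 0" "ball y0 r \<subseteq> S2" using openE[OF S12(2)] by blast
  let ?S = "S1 \<times> ball y0 r"
  have oS: "open ?S" using S12(1) by (simp add: open_Times)
  have S: "\<exists>q\<in>fst \<phi>. z = snd \<phi> q \<and> chart_inv \<phi> z = q" if "z \<in> ?S" for z
  proof -
    have "z \<in> snd \<phi> ` fst \<phi>" using that S12(4) r(2) by blast
    then show ?thesis using chart_inv_chart[OF ch] by blast
  qed
  have D: "frechet_derivative (F \<beta>) (at (snd \<phi> q)) (0, axis \<gamma> 1) = snd (vframe \<phi> \<gamma> q) (a \<beta>)"
    if "q \<in> fst \<phi>" for q \<beta> \<gamma>
    unfolding snd_vframe[OF ad] tvec_apply[OF a[OF that]] F_def[abs_def] ..
  obtain L0 where L0: "\<And>z. z \<in> ?S \<Longrightarrow> smooth_at z L0"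
    "\<And>z \<beta>. z \<in> ?S \<Longrightarrow> frechet_derivative L0 (at z) (0, axis \<beta> 1) = F \<beta> z"
  proof (rule fibrewise_Poincare[OF k S12(1), of y0 r F])
    fix z \<beta> \<gamma> assume z: "z \<in> ?S"
    obtain q where q: "q \<in> fst \<phi>" "z = snd \<phi> q" using S[OF z] by blast
    show "smooth_at z (F \<beta>)"
      using a[OF q(1), of \<beta>] unfolding q(2) smooth_near_iff[OF ch q(1)] F_def[abs_def] .
    show "frechet_derivative (F \<beta>) (at z) (0, axis \<gamma> 1) = frechet_derivative (F \<gamma>) (at z) (0, axis \<beta> 1)"
      unfolding q(2) D[OF q(1)] using fibre_derivative_\<theta>[OF ad q(1), of \<gamma> \<beta>] by (simp add: a_def[abs_def])
  qed blast
  define U where "U = fst \<phi> \<inter> snd \<phi> -` ?S"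
  define L where "L q = L0 (snd \<phi> q)" for q
  have U: "open U" unfolding U_def by (rule chart_open_preimage[OF ch oS])
  have LL0: "L (chart_inv \<phi> z) = L0 z" if "z \<in> ?S" for z using S[OF that] by (auto simp: L_def)
  have L: "smooth_near \<A> q L" if "q \<in> U" for q
  proof -
    have q: "q \<in> fst \<phi>" "snd \<phi> q \<in> ?S" using that by (auto simp: U_def)
    show ?thesis
      unfolding smooth_near_iff[OF ch q(1)]
      by (rule smooth_at_cong[OF L0(1)[OF q(2)] oS q(2)]) (rule LL0[symmetric])
  qed
  have dL: "snd z L = \<theta> q z" if "q \<in> U" "z \<in> vertical P q" for q z
  proof -
    have q: "q \<in> fst \<phi>" "snd \<phi> q \<in> ?S" using that by (auto simp: U_def)
    have "snd (vframe \<phi> \<beta> q) L = \<theta> q (vframe \<phi> \<beta> q)" for \<beta>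
    proof -
      have "frechet_derivative L0 (at (snd \<phi> q)) = frechet_derivative (\<lambda>z. L (chart_inv \<phi> z)) (at (snd \<phi> q))"
        by (rule frechet_derivative_cong[OF oS q(2) LL0[symmetric]])
          (use smooth_at_differentiable[OF L0(1)[OF q(2)]] in \<open>auto simp: differentiable_def\<close>)
      then show ?thesis
        using L0(2)[OF q(2), of \<beta>]
        by (simp add: snd_vframe[OF ad] tvec_apply[OF L[OF that(1)]] F_def a_def chart_inv_chart[OF ch q(1)])
    qed
    then have comb: "snd (\<Sum>\<beta>\<in>UNIV. c \<beta> *\<^sub>R vframe \<phi> \<beta> q) L = \<theta> q (\<Sum>\<beta>\<in>UNIV. c \<beta> *\<^sub>R vframe \<phi> \<beta> q)" for c
      using vframe_fibre[OF ad q(1)] by (simp add: snd_sum sum_fun_apply scaleR_fun_def \<theta>_sum)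
    obtain c where "z = (\<Sum>\<beta>\<in>UNIV. c \<beta> *\<^sub>R vframe \<phi> \<beta> q)"
      by (rule that) (rule vertical_expansion[OF ad q(1) \<open>z \<in> vertical P q\<close>])
    then show ?thesis using comb by simp
  qed
  have "is_minus_diff1 P U \<Omega> (pullback J (diff0 P L))"
    unfolding is_minus_diff1_def
  proof (intro allI impI ballI; elim conjE)
    fix W X Y q
    assume W: "open W" "W \<subseteq> U" "smooth_section P W X" "smooth_section P W Y" and q: "q \<in> W"
    have eq: "pullback J \<theta> p (Z p) = pullback J (diff0 P L) p (Z p)" if "smooth_section P W Z" "p \<in> W" for Z p
      using dL[of p "J p (Z p)"] that W(2) J_vertical section_fibre
      by (simp add: pullback_def diff0_def subset_iff)
    have "diff1 P (pullback J \<theta>) X Y q = diff1 P (pullback J (diff0 P L)) X Y q"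
      unfolding diff1_def anchor_P eq[OF bracket_section[OF W(1,3,4)] q]
      by (intro arg_cong2[where f = "(-)"] refl tangent_cong[OF section_tangent[OF W(3) q] W(1) q]
          tangent_cong[OF section_tangent[OF W(4) q] W(1) q]) (rule eq[OF W(4)] eq[OF W(3)]; assumption)+
    moreover have "\<Omega> q (X q) (Y q) = - diff1 P (pullback J \<theta>) X Y q"
      by (rule is_minus_diff1D[OF \<Omega>_\<theta> W(1) subset_UNIV W(3,4) q])
    ultimately show "\<Omega> q (X q) (Y q) = - diff1 P (pullback J (diff0 P L)) X Y q" by simp
  qed
  then have "local_potential P J \<Omega> U L"
    using U L by (simp add: local_potential_def smooth_fun_iff[OF U])
  moreover have "m \<in> U" using m S12(3) r(1) xy by (simp add: U_def)
  ultimately show thesis using that by blast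
qed

subsection \<open>The induced metric\<close>

abbreviation g where "g \<equiv> induced_metric P J \<Omega>"

text \<open>Two \<open>J\<close>-preimages of the same vector differ by a vertical one, and the
  vertical spaces are isotropic, so the choice made by \<open>SOME\<close> does not matter.\<close>

lemma metric_eq:
  assumes "z \<in> fibre P m" "w \<in> vertical P m"
  shows "g m (J m z) w = \<Omega> m z w"
proof -
  define z' where "z' = (SOME z'. z' \<in> fibre P m \<and> J m z' = J m z)"
  have "z' \<in> fibre P m \<and> J m z' = J m z"
    unfolding z'_def by (rule someI[of _ z]) (use assms in simp)
  then have z': "z' \<in> fibre P m" "J m (z' - z) = 0" using assms(1) by (auto simp: J_diff)
  then have "z' - z \<in> vertical P m"
    using J_zero_iff subspace_diff[OF fibre_subspace] assms(1) by blast
  then have "\<Omega> m (z' - z) w = 0" using \<Omega>_vertical assms(2) by blast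
  then have "\<Omega> m z' w = \<Omega> m z w"
    using \<Omega>_diff_left[OF vertical_fibre[OF assms(2)] z'(1) assms(1)] by simp
  then show ?thesis by (simp add: induced_metric_def z'_def)
qed

text \<open>With \<open>\<Omega> = - d(J\<^sup>* \<theta>)\<close>, the antisymmetric part of the metric is \<open>d\<theta>\<close> on the vertical bundle
  up to a term with the Nijenhuis tensor of \<open>J\<close>, which vanishes by the Jacobi identity for \<open>S\<close>
  and two vertical sections.\<close>

lemma \<Omega>_bracket_S_symmetric:
  assumes U: "open U" and V: "vertical_section P U V" and V': "vertical_section P U V'" and q: "q \<in> U"
  shows "\<Omega> q (bracket P S V q) (V' q) = \<Omega> q (bracket P S V' q) (V q)"
proof -
  note D = vertical_sectionD and Ss = S_section[OF U]
  note b = bracket_section[OF U]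
  \<comment> \<open>In the differential of \<open>pullback J \<theta>\<close>, \<open>J\<close>
    kills \<open>V'\<close> and sends \<open>[S, V]\<close> to \<open>- V\<close>, so the only
    derivative term left is the one along \<open>V'\<close>.\<close>
  have *: "\<Omega> q (bracket P S V q) (V' q) =
      - snd (V' q) (\<lambda>p. \<theta> p (V p)) + \<theta> q (J q (bracket P (bracket P S V) V' q))"
    if V: "vertical_section P U V" and V': "vertical_section P U V'" for V V'
  proof -
    have sv: "smooth_near \<A> q (\<lambda>p. \<theta> p (V p))" by (rule \<theta>_smooth[OF U D(1)[OF V] q])
    have "snd (bracket P S V q) (\<lambda>p. pullback J \<theta> p (V' p)) = snd (bracket P S V q) (\<lambda>p. 0)"
      by (rule tangent_cong[OF section_tangent[OF b[OF Ss D(1)[OF V]] q] U q])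
        (simp add: pullback_def J_on_vertical D(2)[OF V'] \<theta>_zero)
    then have 1: "snd (bracket P S V q) (\<lambda>p. pullback J \<theta> p (V' p)) = 0"
      using tangent_const[OF section_tangent[OF b[OF Ss D(1)[OF V]] q]] by simp
    have "snd (V' q) (\<lambda>p. pullback J \<theta> p (bracket P S V p)) = snd (V' q) (\<lambda>p. - \<theta> p (V p))"
      by (rule tangent_cong[OF section_tangent[OF D(1)[OF V'] q] U q])
        (simp add: pullback_def J_bracket_S[OF U V] \<theta>_minus vertical_fibre D(2)[OF V])
    then have 2: "snd (V' q) (\<lambda>p. pullback J \<theta> p (bracket P S V p)) = - snd (V' q) (\<lambda>p. \<theta> p (V p))"
      by (simp add: tangent_minus[OF section_tangent[OF D(1)[OF V'] q] sv])
    have "\<Omega> q (bracket P S V q) (V' q) = - diff1 P (pullback J \<theta>) (bracket P S V) V' q"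
      by (rule is_minus_diff1D[OF \<Omega>_\<theta> U subset_UNIV b[OF Ss D(1)[OF V]] D(1)[OF V'] q])
    then show ?thesis by (simp add: diff1_def 1 2) (simp add: pullback_def)
  qed
  have f: "bracket P V (bracket P S V') q \<in> fibre P q" "bracket P S (bracket P V' V) q \<in> fibre P q"
    "bracket P V' (bracket P S V) q \<in> fibre P q"
    by (intro section_fibre[OF _ q] b Ss D(1)[OF V] D(1)[OF V'])+
  have vv: "vertical_section P U (bracket P V' V)"
    using b[OF D(1)[OF V'] D(1)[OF V]] vertical_bracket[OF U V' V] by (simp add: vertical_section_def)
  have "jacobiator V S V' q = bracket P V (bracket P S V') q + bracket P S (bracket P V' V) q - bracket P V' (bracket P S V) q"
    using bracket_bracket_antisym[OF U D(1)[OF V'] D(1)[OF V] Ss q] by (simp add: jacobiator_def)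
  \<comment> \<open>A vertical Jacobiator is as good as the Jacobi identity after applying
    \<open>J\<close>. Compatibility turns \<open>J [S, [V', V]]\<close> into
    \<open>- [V', V]\<close>, which supplies the bracket term of the differential of
    \<open>\<theta>\<close>.\<close>
  moreover have "J q (jacobiator V S V' q) = 0"
    by (rule J_on_vertical[OF jacobiator_vertical[OF U V Ss D(1)[OF V'] q]])
  ultimately have "J q (bracket P V (bracket P S V') q) - bracket P V' V q = J q (bracket P V' (bracket P S V) q)"
    using f by (simp add: J_add J_diff subspace_add[OF fibre_subspace] J_bracket_S[OF U vv q])
  then have j: "J q (bracket P (bracket P S V) V' q) = J q (bracket P (bracket P S V') V q) + - bracket P V V' q"
    using f bracket_antisym[OF U b[OF Ss D(1)[OF V]] D(1)[OF V'] q] bracket_antisym[OF U b[OF Ss D(1)[OF V']] D(1)[OF V] q]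
      bracket_antisym[OF U D(1)[OF V'] D(1)[OF V] q]
    by (simp add: J_minus algebra_simps)
  have "J q (bracket P (bracket P S V') V q) \<in> fibre P q" "bracket P V V' q \<in> fibre P q"
    by (intro vertical_fibre J_vertical section_fibre[OF _ q] b Ss D(1)[OF V] D(1)[OF V'])+
  then have "\<theta> q (J q (bracket P (bracket P S V) V' q)) =
      \<theta> q (J q (bracket P (bracket P S V') V q)) - \<theta> q (bracket P V V' q)"
    unfolding j by (subst \<theta>_add) (auto simp: \<theta>_minus subspace_neg[OF fibre_subspace])
  moreover have "snd (V q) (\<lambda>p. \<theta> p (V' p)) - snd (V' q) (\<lambda>p. \<theta> p (V p)) - \<theta> q (bracket P V V' q) = 0"
    using \<theta>_closed[OF U V V' q] by (simp add: diff1_def)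
  ultimately show ?thesis unfolding *[OF V V'] *[OF V' V] by simp
qed

text \<open>Compatibility makes \<open>- [S, V]\<close> a \<open>J\<close>-preimage of
  \<open>V\<close>, so the metric can be computed from brackets with \<open>S\<close>.\<close>

lemma metric_bracket_S:
  assumes "open U" "vertical_section P U V" "q \<in> U" "w \<in> vertical P q"
  shows "g q (V q) w = - \<Omega> q (bracket P S V q) w"
proof -
  have f: "bracket P S V q \<in> fibre P q"
    using section_fibre[OF bracket_section[OF assms(1) S_section[OF assms(1)] vertical_sectionD(1)[OF assms(2)]]] assms(3)
    by blast
  then have "g q (J q (- bracket P S V q)) w = \<Omega> q (- bracket P S V q) w"
    using metric_eq assms(4) subspace_neg[OF fibre_subspace] by blast
  then show ?thesis
    using f J_bracket_S[OF assms(1-3)] by (simp add: J_minus \<Omega>_minus_left vertical_fibre[OF assms(4)])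
qed

lemma vertical_sections_through:
  assumes "v \<in> vertical P m" "w \<in> vertical P m"
  obtains U V V' where "open U" "m \<in> U" "vertical_section P U V" "vertical_section P U V'" "V m = v" "V' m = w"
proof -
  obtain U1 V where 1: "open U1" "m \<in> U1" "vertical_section P U1 V" "V m = v"
    using vertical_section_through[OF assms(1)] by blast
  obtain U2 V' where 2: "open U2" "m \<in> U2" "vertical_section P U2 V'" "V' m = w"
    using vertical_section_through[OF assms(2)] by blast
  show thesis
    by (rule that[of "U1 \<inter> U2" V V'])
      (use 1 2 vertical_section_subset[OF 1(3,1), of "U1 \<inter> U2"] vertical_section_subset[OF 2(3,1), of "U1 \<inter> U2"] in auto)
qed

lemma metric_symmetric:
  assumes "v \<in> vertical P m" "w \<in> vertical P m"
  shows "g m v w = g m w v"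
proof -
  obtain U V V' where U: "open U" "m \<in> U" "vertical_section P U V" "vertical_section P U V'" "V m = v" "V' m = w"
    using vertical_sections_through[OF assms] by blast
  then show ?thesis
    using metric_bracket_S[OF U(1,3,2) assms(2)] metric_bracket_S[OF U(1,4,2) assms(1)]
      \<Omega>_bracket_S_symmetric[OF U(1,3,4,2)] by simp
qed

lemma vertical_preimage:
  assumes "v \<in> vertical P m"
  obtains z where "z \<in> fibre P m" "J m z = v"
  using assms unfolding J_image[symmetric] by blast

lemma metric_add_left:
  assumes "v \<in> vertical P m" "v' \<in> vertical P m" "w \<in> vertical P m"
  shows "g m (v + v') w = g m v w + g m v' w"
proof -
  obtain z z' where "z \<in> fibre P m" "J m z = v" "z' \<in> fibre P m" "J m z' = v'"
    using vertical_preimage assms by metis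
  then show ?thesis
    using metric_eq[of z m w] metric_eq[of z' m w] metric_eq[of "z + z'" m w] assms(3)
      subspace_add[OF fibre_subspace] by (simp add: J_add \<Omega>_add_left vertical_fibre)
qed

lemma metric_nondegenerate:
  assumes "v \<in> vertical P m" "\<And>w. w \<in> vertical P m \<Longrightarrow> g m v w = 0"
  shows "v = 0"
proof -
  obtain z where z: "z \<in> fibre P m" "J m z = v" using vertical_preimage[OF assms(1)] by blast
  then have "z \<in> vertical P m" using assms(2) metric_eq \<Omega>_vertical_iff by metis
  then show ?thesis using z J_on_vertical by simp
qed

subsection \<open>The canonical connection\<close>

abbreviation N where "N \<equiv> canonical_connection P S J"

text \<open>The Lie derivative of \<open>J\<close> on the level of sections. The \<open>THE\<close>
  in \<open>lie_endo\<close> is resolved to it once tensoriality has been established.\<close>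

definition lie_J where "lie_J X q = bracket P S (\<lambda>p. J p (X p)) q - J q (bracket P S X q)"

lemma lie_J_scale:
  assumes "open W" "smooth_section P W X" "\<And>q. q \<in> W \<Longrightarrow> smooth_near \<A> q f" "q \<in> W"
  shows "lie_J (\<lambda>p. f p *\<^sub>R X p) q = f q *\<^sub>R lie_J X q"
proof -
  note Ss = S_section[OF assms(1)] and JX = J_section[OF assms(1,2)]
  have X: "X p \<in> fibre P p" if "p \<in> W" for p using section_fibre[OF assms(2) that] .
  have b: "bracket P S X q \<in> fibre P q" using section_fibre[OF bracket_section[OF assms(1) Ss assms(2)] assms(4)] .
  have "bracket P S (\<lambda>p. J p (f p *\<^sub>R X p)) q = bracket P S (\<lambda>p. f p *\<^sub>R J p (X p)) q"
    by (rule bracket_cong[OF assms(1) Ss smooth_section_scale[OF assms(1,3) JX]])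
      (auto simp: J_scale X assms(4))
  then show ?thesis
    using b X[OF assms(4)] subspace_scale[OF fibre_subspace]
    by (simp add: lie_J_def bracket_scale_right[OF assms(1) Ss JX assms(3,4)]
        bracket_scale_right[OF assms(1) Ss assms(2,3,4)] J_add J_scale scaleR_diff_right)
qed

lemma lie_J_add:
  assumes "open W" "smooth_section P W X" "smooth_section P W Y" "q \<in> W"
  shows "lie_J (\<lambda>p. X p + Y p) q = lie_J X q + lie_J Y q"
proof -
  note Ss = S_section[OF assms(1)] and JX = J_section[OF assms(1,2)] and JY = J_section[OF assms(1,3)]
  have b: "bracket P S X q \<in> fibre P q" "bracket P S Y q \<in> fibre P q"
    using section_fibre[OF bracket_section[OF assms(1) Ss] assms(4)] assms(2,3) by blast+
  have "bracket P S (\<lambda>p. J p (X p + Y p)) q = bracket P S (\<lambda>p. J p (X p) + J p (Y p)) q"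
    by (rule bracket_cong[OF assms(1) Ss smooth_section_add[OF assms(1) JX JY]])
      (auto simp: J_add section_fibre[OF assms(2)] section_fibre[OF assms(3)] assms(4))
  then show ?thesis
    using b by (simp add: lie_J_def bracket_add_right[OF assms(1) Ss JX JY assms(4)]
        bracket_add_right[OF assms(1) Ss assms(2,3,4)] J_add)
qed

lemma lie_J_cong:
  assumes "open W" "smooth_section P W X" "\<And>p. p \<in> W \<Longrightarrow> X p = Y p" "q \<in> W"
  shows "lie_J Y q = lie_J X q"
proof -
  note Ss = S_section[OF assms(1)]
  have "bracket P S (\<lambda>p. J p (Y p)) q = bracket P S (\<lambda>p. J p (X p)) q"
    by (rule bracket_cong[OF assms(1) Ss J_section[OF assms(1,2)]]) (auto simp: assms)
  moreover have "bracket P S Y q = bracket P S X q"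
    by (rule bracket_cong[OF assms(1) Ss assms(2)]) (auto simp: assms)
  ultimately show ?thesis by (simp add: lie_J_def)
qed

text \<open>In a frame the coefficients of \<open>X\<close> vanish at \<open>m\<close>, and
  linearity over smooth functions carries this over.\<close>

lemma lie_J_zero:
  assumes "open U" "smooth_section P U X" "m \<in> U" "X m = 0"
  shows "lie_J X m = 0"
proof -
  obtain F E where E: "(F, E) \<in> frames P" "m \<in> F" "local_frame P F E" "open F" by (rule frame_at)
  define W where "W = U \<inter> F"
  have W: "open W" "m \<in> W" "W \<subseteq> U" "W \<subseteq> F" using assms E by (auto simp: W_def)
  obtain c where c: "\<And>p i. p \<in> U \<inter> F \<Longrightarrow> smooth_near \<A> p (c i)"
    "\<And>p. p \<in> U \<inter> F \<Longrightarrow> X p = (\<Sum>i\<in>UNIV. c i p *\<^sub>R E i p)"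
    using smooth_sectionE[OF assms(1,2) E(1)] by blast
  have sE: "smooth_section P W (E i)" for i
    using smooth_section_subset[OF _ E(4) W(1,4)] E(3) by (simp add: local_frame_def)
  have c': "smooth_near \<A> p (c i)" if "p \<in> W" for p i using c(1) that by (simp add: W_def)
  have s: "smooth_section P W (\<lambda>p. c i p *\<^sub>R E i p)" for i
    by (rule smooth_section_scale[OF W(1) c' sE])
  have "(\<Sum>i\<in>UNIV. c i m *\<^sub>R E i m) = 0"
    using c(2)[of m, symmetric] W(2) assms(4) by (simp add: W_def)
  moreover have "is_basis_of (\<lambda>i. E i m) (fibre P m)" using E(2,3) by (simp add: local_frame_def)
  ultimately have c0: "c i m = 0" for i by (intro is_basis_of_zero)
  have "lie_J (\<lambda>p. \<Sum>i\<in>I. c i p *\<^sub>R E i p) m = 0" if "finite I" for I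
    using that
  proof induction
    case empty
    have "lie_J (\<lambda>p. 0 *\<^sub>R E undefined p) m = 0 *\<^sub>R lie_J (E undefined) m"
      by (rule lie_J_scale[OF W(1) sE smooth_near_const W(2)])
    then show ?case by simp
  next
    case (insert i I)
    then show ?case
      using lie_J_add[OF W(1) s smooth_section_sum[OF W(1), of I "\<lambda>i p. c i p *\<^sub>R E i p"] W(2), of i] s
        lie_J_scale[OF W(1) sE c' W(2)] c0 by simp
  qed
  moreover have "lie_J X m = lie_J (\<lambda>p. \<Sum>i\<in>UNIV. c i p *\<^sub>R E i p) m"
    by (rule lie_J_cong[OF W(1) smooth_section_sum[OF W(1) s] _ W(2)]) (use c(2) in \<open>simp add: W_def\<close>)
  ultimately show ?thesis by simp
qed

text \<open>Sections with the same value at \<open>m\<close> differ by one that vanishes there, so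
  every section through \<open>X m\<close> gives the same vector and the definite description has
  exactly one solution.\<close>

lemma canonical_connection_section:
  assumes "open U" "smooth_section P U X" "m \<in> U"
  shows "N m (X m) = J m (bracket P S X m) - bracket P S (\<lambda>p. J p (X p)) m"
proof -
  have "lie_J Y m = lie_J X m" if Y: "open U'" "m \<in> U'" "smooth_section P U' Y" "Y m = X m" for U' Y
  proof -
    have W: "open (U \<inter> U')" using assms(1) Y(1) by blast
    have X': "smooth_section P (U \<inter> U') X" using smooth_section_subset[OF assms(2,1) W] by blast
    have Y': "smooth_section P (U \<inter> U') Y" using smooth_section_subset[OF Y(3,1) W] by blast
    have "lie_J (\<lambda>p. Y p - X p) m = 0"
      by (rule lie_J_zero[OF W smooth_section_diff[OF W Y' X']]) (use assms Y in auto)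
    moreover have "lie_J Y m = lie_J (\<lambda>p. X p + (Y p - X p)) m" by simp
    ultimately show ?thesis
      using lie_J_add[OF W X' smooth_section_diff[OF W Y' X'], of m] assms(3) Y(2) by simp
  qed
  then have "(THE w. \<forall>U Y. open U \<and> m \<in> U \<and> smooth_section P U Y \<and> Y m = X m \<longrightarrow> w = lie_J Y m) = lie_J X m"
    using assms by (intro the_equality) (blast intro: sym, blast)
  then have "lie_endo P S J m (X m) = lie_J X m"
    by (simp add: lie_endo_def lie_J_def)
  then show ?thesis by (simp add: canonical_connection_def lie_J_def)
qed

text \<open>\<open>J\<close> kills the first, vertical term of the section formula for
  \<open>N\<close>, and compatibility turns \<open>- J [S, J X]\<close> into
  \<open>J X\<close>.\<close>

lemma N_fibre: "z \<in> fibre P m \<Longrightarrow> N m z \<in> fibre P m"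
  and J_N: "z \<in> fibre P m \<Longrightarrow> J m (N m z) = J m z"
proof -
  assume "z \<in> fibre P m"
  then obtain U X where X: "open U" "m \<in> U" "smooth_section P U X" "X m = z" by (rule section_through)
  note b = bracket_section[OF X(1) S_section[OF X(1)]]
  have f: "J m (bracket P S X m) \<in> vertical P m" "bracket P S (\<lambda>p. J p (X p)) m \<in> fibre P m"
    using J_vertical section_fibre[OF b[OF X(3)] X(2)] section_fibre[OF b[OF J_section[OF X(1,3)]] X(2)] by auto
  have N: "N m z = J m (bracket P S X m) - bracket P S (\<lambda>p. J p (X p)) m"
    using canonical_connection_section[OF X(1,3,2)] X(4) by simp
  show "N m z \<in> fibre P m" unfolding N using f vertical_fibre subspace_diff[OF fibre_subspace] by blast
  show "J m (N m z) = J m z"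
    unfolding N using f J_bracket_S[OF X(1) J_vertical_section[OF X(1,3)] X(2)]
    by (simp add: J_diff vertical_fibre J_on_vertical X(4))
qed

lemma N_vertical:
  assumes "z \<in> vertical P m"
  shows "N m z = - z"
proof -
  obtain U V where V: "open U" "m \<in> U" "vertical_section P U V" "V m = z"
    using vertical_section_through[OF assms] by blast
  have "bracket P S (\<lambda>p. J p (V p)) m = 0"
    by (rule bracket_zero_right[OF V(1) S_section[OF V(1)] _ V(2)])
      (simp add: J_on_vertical vertical_sectionD(2)[OF V(3)])
  then show ?thesis
    using canonical_connection_section[OF V(1) vertical_sectionD(1)[OF V(3)] V(2)] V(4)
      J_bracket_S[OF V(1,3,2)] by simp
qed

lemma N_endomorphism: "endomorphism P N"
proof -
  have sec: "smooth_section P W (\<lambda>p. N p (X p))" if "open W" "smooth_section P W X" for W X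
  proof (rule smooth_section_cong)
    note b = bracket_section[OF that(1) S_section[OF that(1)]]
    show "smooth_section P W (\<lambda>p. J p (bracket P S X p) - bracket P S (\<lambda>p. J p (X p)) p)"
      by (intro smooth_section_diff J_section b that)
    show "J p (bracket P S X p) - bracket P S (\<lambda>p. J p (X p)) p = N p (X p)" if "p \<in> W" for p
      using canonical_connection_section[OF \<open>open W\<close> \<open>smooth_section P W X\<close> that] by simp
  qed (rule that(1))
  have lin: "N m (z + z') = N m z + N m z' \<and> N m (c *\<^sub>R z) = c *\<^sub>R N m z"
    if z: "z \<in> fibre P m" and z': "z' \<in> fibre P m" for m z z' c
  proof -
    obtain U X where X: "open U" "m \<in> U" "smooth_section P U X" "X m = z" by (rule section_through[OF z])
    obtain U' Y where Y: "open U'" "m \<in> U'" "smooth_section P U' Y" "Y m = z'" by (rule section_through[OF z'])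
    have W: "open (U \<inter> U')" "m \<in> U \<inter> U'" using X Y by auto
    have X': "smooth_section P (U \<inter> U') X" using smooth_section_subset[OF X(3,1) W(1)] by blast
    have Y': "smooth_section P (U \<inter> U') Y" using smooth_section_subset[OF Y(3,1) W(1)] by blast
    have N: "N m (Z m) = - lie_J Z m" if "smooth_section P (U \<inter> U') Z" for Z
      using canonical_connection_section[OF W(1) that W(2)] by (simp add: lie_J_def)
    show ?thesis
      using N[OF smooth_section_add[OF W(1) X' Y']] N[OF X'] N[OF Y'] lie_J_add[OF W(1) X' Y' W(2)]
        N[OF smooth_section_scale[OF W(1) smooth_near_const X'], of c]
        lie_J_scale[OF W(1) X' smooth_near_const W(2), of c] X(4) Y(4) by simp
  qed
  show ?thesis
    unfolding endomorphism_def by (intro conjI allI ballI impI) (auto simp: lin N_fibre sec)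
qed

text \<open>As \<open>N'\<close> is an involution, \<open>z - N' m z\<close> lies in its eigenspace
  for -1, which is vertical; hence \<open>J\<close> does not distinguish \<open>z\<close> from
  \<open>N' m z\<close>.\<close>

lemma nonlinear_connectionD:
  assumes "nonlinear_connection P N'" "z \<in> fibre P m"
  shows "N' m z \<in> fibre P m"
    and "z' \<in> fibre P m \<Longrightarrow> N' m (z + z') = N' m z + N' m z'"
    and "N' m (c *\<^sub>R z) = c *\<^sub>R N' m z"
    and "z \<in> vertical P m \<Longrightarrow> N' m z = - z"
    and "z - N' m z \<in> vertical P m"
    and "J m (N' m z) = J m z"
    and "N' m (z + N' m z) = z + N' m z"
proof -
  have e: "endomorphism P N'" and i: "N' m (N' m z) = z"
    and v: "{z \<in> fibre P m. z + N' m z = 0} = vertical P m"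
    using assms by (auto simp: nonlinear_connection_def)
  show f: "N' m z \<in> fibre P m" and a: "z' \<in> fibre P m \<Longrightarrow> N' m (z + z') = N' m z + N' m z'"
    and s: "N' m (c *\<^sub>R z) = c *\<^sub>R N' m z" for z' c
    using e assms(2) unfolding endomorphism_def by blast+
  show "N' m z = - z" if "z \<in> vertical P m" using that v by (auto simp: eq_neg_iff_add_eq_0 add.commute)
  have a': "N' m (u + u') = N' m u + N' m u'" "N' m (- u) = - N' m u"
    if "u \<in> fibre P m" "u' \<in> fibre P m" for u u'
  proof -
    show "N' m (u + u') = N' m u + N' m u'" using e that unfolding endomorphism_def by blast
    have "N' m ((- 1) *\<^sub>R u) = (- 1) *\<^sub>R N' m u" using e that unfolding endomorphism_def by blast
    then show "N' m (- u) = - N' m u" by simp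
  qed
  have n: "- N' m z \<in> fibre P m" using subspace_neg[OF fibre_subspace f] .
  have "N' m (z - N' m z) = N' m z - z"
    using a'(1)[OF assms(2) n] a'(2)[OF f f] i by simp
  then show d: "z - N' m z \<in> vertical P m"
    unfolding v[symmetric] using subspace_diff[OF fibre_subspace assms(2) f] by simp
  show "J m (N' m z) = J m z" using J_on_vertical[OF d] J_diff[OF assms(2) f] by simp
  show "N' m (z + N' m z) = z + N' m z" using a'(1)[OF assms(2) f] i by (simp add: add.commute)
qed

text \<open>\<open>N z - z\<close> is killed by \<open>J\<close>, hence vertical, and
  \<open>N\<close> is minus the identity there; this gives the involution. Conversely
  \<open>N z = - z\<close> forces \<open>J z = - J z\<close>.\<close>

lemma N_connection: "nonlinear_connection P N"
proof -
  have lin: "N m (z - z') = N m z - N m z'" if "z \<in> fibre P m" "z' \<in> fibre P m" for m z z'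
  proof -
    have "N m (z + - z') = N m z + N m (- z')"
      using N_endomorphism that subspace_neg[OF fibre_subspace that(2)] by (simp only: endomorphism_def)
    moreover have "N m ((- 1) *\<^sub>R z') = (- 1) *\<^sub>R N m z'"
      using N_endomorphism that by (simp only: endomorphism_def)
    ultimately show ?thesis by simp
  qed
  have "N m (N m z) = z" if z: "z \<in> fibre P m" for m z
  proof -
    have d: "N m z - z \<in> vertical P m"
      using J_zero_iff[OF subspace_diff[OF fibre_subspace N_fibre[OF z] z]] J_diff[OF N_fibre[OF z] z] J_N[OF z]
      by simp
    have "N m (N m z) - N m z = - (N m z - z)"
      using N_vertical[OF d] lin[OF N_fibre[OF z] z] by simp
    then show ?thesis by (simp add: algebra_simps)
  qed
  moreover have "{z \<in> fibre P m. z + N m z = 0} = vertical P m" for m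
  proof (intro equalityI subsetI)
    fix z assume "z \<in> {z \<in> fibre P m. z + N m z = 0}"
    then have z: "z \<in> fibre P m" "N m z = - z" by (auto simp: add_eq_0_iff)
    then have "J m z = - J m z" using J_N[OF z(1)] J_minus[OF z(1)] by simp
    then have "2 *\<^sub>R J m z = 0" by (simp add: scaleR_2 eq_neg_iff_add_eq_0)
    then show "z \<in> vertical P m" using J_zero_iff[OF z(1)] by simp
  qed (use N_vertical vertical_fibre in auto)
  ultimately show ?thesis using N_endomorphism by (simp add: nonlinear_connection_def)
qed

end

context dynamics
begin

lemmas N_connectionD = nonlinear_connectionD[OF N_connection]

subsection \<open>The Lie derivative of \<open>\<Omega>\<close> along the semispray\<close>

definition lie_\<Omega> where
  "lie_\<Omega> X Y q = snd (S q) (\<lambda>p. \<Omega> p (X p) (Y p)) - \<Omega> q (bracket P S X q) (Y q) - \<Omega> q (X q) (bracket P S Y q)"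

text \<open>The remainder in the equation for the contraction of \<open>\<Omega>\<close> with
  \<open>S\<close>: the only candidate for \<open>\<xi>\<close> once \<open>L\<close> is
  chosen.\<close>

definition force where
  "force L q z = \<Omega> q (S q) z - diff0 P (\<lambda>q. lie_fun P (\<lambda>p. J p (S p)) L q - L q) q z"

lemma lie_\<Omega>_add_right:
  assumes W: "open W" and X: "smooth_section P W X" and Y: "smooth_section P W Y" and Y': "smooth_section P W Y'"
    and q: "q \<in> W"
  shows "lie_\<Omega> X (\<lambda>p. Y p + Y' p) q = lie_\<Omega> X Y q + lie_\<Omega> X Y' q"
proof -
  note Ss = S_section[OF W]
  note f = section_fibre[OF X] section_fibre[OF Y] section_fibre[OF Y']
  note b = section_fibre[OF bracket_section[OF W Ss X] q] section_fibre[OF bracket_section[OF W Ss Y] q]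
    section_fibre[OF bracket_section[OF W Ss Y'] q]
  have "snd (S q) (\<lambda>p. \<Omega> p (X p) (Y p + Y' p)) = snd (S q) (\<lambda>p. \<Omega> p (X p) (Y p) + \<Omega> p (X p) (Y' p))"
    by (rule tangent_cong[OF section_tangent[OF Ss q] W q]) (simp add: \<Omega>_add_right f)
  also have "\<dots> = snd (S q) (\<lambda>p. \<Omega> p (X p) (Y p)) + snd (S q) (\<lambda>p. \<Omega> p (X p) (Y' p))"
    by (rule tangent_add[OF section_tangent[OF Ss q] \<Omega>_smooth[OF W X Y q] \<Omega>_smooth[OF W X Y' q]])
  finally show ?thesis
    by (simp add: lie_\<Omega>_def bracket_add_right[OF W Ss Y Y' q] \<Omega>_add_right b f[OF q])
qed

lemma lie_\<Omega>_vertical: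
  assumes W: "open W" and V: "vertical_section P W V" and V': "vertical_section P W V'" and q: "q \<in> W"
  shows "lie_\<Omega> V V' q = 0"
proof -
  note D = vertical_sectionD
  have "snd (S q) (\<lambda>p. \<Omega> p (V p) (V' p)) = snd (S q) (\<lambda>p. 0)"
    by (rule tangent_cong[OF section_tangent[OF S_section[OF W] q] W q])
      (simp add: \<Omega>_vertical D(2)[OF V] D(2)[OF V'])
  then show ?thesis
    using \<Omega>_bracket_S_symmetric[OF W V V' q] tangent_const[OF section_tangent[OF S_section[OF W] q]]
      \<Omega>_antisym[OF section_fibre[OF D(1)[OF V] q] section_fibre[OF bracket_section[OF W S_section[OF W] D(1)[OF V']] q]]
    by (simp add: lie_\<Omega>_def)
qed

context
  fixes W L
  assumes W: "open W" and L: "\<And>q. q \<in> W \<Longrightarrow> smooth_near \<A> q L"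
    and potential: "is_minus_diff1 P W \<Omega> (pullback J (diff0 P L))"
begin

abbreviation dJL where "dJL X p \<equiv> snd (J p (X p)) L"

lemma \<Omega>_potential:
  assumes "smooth_section P W X" "smooth_section P W Y" "q \<in> W"
  shows "\<Omega> q (X q) (Y q) = - (snd (X q) (dJL Y) - snd (Y q) (dJL X) - dJL (bracket P X Y) q)"
  using is_minus_diff1D[OF potential W order_refl assms] by (simp add: diff1_def pullback_def diff0_def)

lemma dJL_smooth: "smooth_section P W X \<Longrightarrow> q \<in> W \<Longrightarrow> smooth_near \<A> q (dJL X)"
  by (rule section_apply_smooth[OF W J_section[OF W] _ L])

text \<open>In the expansion of \<open>\<Omega> q (S q) (X q)\<close>, the derivative along
  \<open>X\<close> of \<open>dJL S\<close> is that of the Lie derivative of \<open>L\<close> along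
  \<open>C = J S\<close>, and it cancels against the one in \<open>force\<close>.\<close>

lemma force_section:
  assumes X: "smooth_section P W X" and q: "q \<in> W"
  shows "force L q (X q) = snd (X q) L - snd (S q) (dJL X) + dJL (bracket P S X) q"
  unfolding force_def \<Omega>_potential[OF S_section[OF W] X q]
  by (simp add: diff0_def lie_fun_def tangent_diff[OF section_tangent[OF X q] dJL_smooth[OF S_section[OF W] q] L[OF q]])

lemma dJL_vertical: "vertical_section P W V \<Longrightarrow> q \<in> W \<Longrightarrow> dJL V q = 0"
  by (simp add: J_on_vertical vertical_sectionD(2))

lemma tangent_dJL_vertical:
  assumes "vertical_section P W V" "q \<in> W" "v \<in> tangent_space \<A> q"
  shows "v (dJL V) = 0"
proof -
  have "v (dJL V) = v (\<lambda>p. 0)"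
    by (rule tangent_cong[OF assms(3) W assms(2)]) (rule dJL_vertical[OF assms(1)])
  then show ?thesis using tangent_const[OF assms(3)] by simp
qed

lemma dJL_bracket_S:
  assumes "vertical_section P W V" "q \<in> W"
  shows "dJL (bracket P S V) q = - snd (V q) L"
  using J_bracket_S[OF W assms] by simp

lemma force_vertical:
  assumes V: "vertical_section P W V" and q: "q \<in> W"
  shows "force L q (V q) = 0"
  unfolding force_section[OF vertical_sectionD(1)[OF V] q]
  using tangent_dJL_vertical[OF V q section_tangent[OF S_section[OF W] q]] dJL_bracket_S[OF V q] by simp

text \<open>On the vertical bundle, \<open>d\<close> and the Lie derivative along \<open>S\<close> commute up to a Jacobiator
  killed by \<open>J\<^sup>* dL\<close>. Hence the differential of the force is the Lie derivative of \<open>\<Omega>\<close>.\<close>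

lemma diff_force:
  assumes V: "vertical_section P W V" and X: "smooth_section P W X" and q: "q \<in> W"
  shows "diff1 P (force L) V X q = lie_\<Omega> V X q"
proof -
  note Ss = S_section[OF W] and Vs = vertical_sectionD(1)[OF V]
  note b = bracket_section[OF W]
  note tV = section_tangent[OF Vs q] and tX = section_tangent[OF X q] and tS = section_tangent[OF Ss q]
  note sm = section_apply_smooth[OF W _ q]
  \<comment> \<open>Each term is reduced to iterated derivatives of \<open>L\<close> and of values
    of \<open>dJL\<close>, and to \<open>dJL\<close> of double brackets. The derivatives cancel in
    pairs, the double brackets by the Jacobiator.\<close>
  have "snd (V q) (\<lambda>p. force L p (X p)) = snd (V q) (\<lambda>p. snd (X p) L - snd (S p) (dJL X) + dJL (bracket P S X) p)"
    by (rule tangent_cong[OF tV W q]) (rule force_section[OF X])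
  also have "\<dots> = snd (V q) (\<lambda>p. snd (X p) L) - snd (V q) (\<lambda>p. snd (S p) (dJL X)) + snd (V q) (dJL (bracket P S X))"
    by (simp add: tangent_add[OF tV smooth_near_diff[OF sm[OF X L[OF q]] sm[OF Ss dJL_smooth[OF X q]]]
          dJL_smooth[OF b[OF Ss X] q]] tangent_diff[OF tV sm[OF X L[OF q]] sm[OF Ss dJL_smooth[OF X q]]])
  finally have 1: "snd (V q) (\<lambda>p. force L p (X p)) = \<dots>" .
  have "snd (X q) (\<lambda>p. force L p (V p)) = snd (X q) (\<lambda>p. 0)"
    by (rule tangent_cong[OF tX W q]) (rule force_vertical[OF V])
  then have 2: "snd (X q) (\<lambda>p. force L p (V p)) = 0" using tangent_const[OF tX] by simp
  have 3: "force L q (bracket P V X q) = snd (V q) (\<lambda>p. snd (X p) L) - snd (X q) (\<lambda>p. snd (V p) L)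
      - snd (S q) (dJL (bracket P V X)) + dJL (bracket P S (bracket P V X)) q"
    unfolding force_section[OF b[OF Vs X] q] anchor_bracket_vertical[OF W V X q L[OF q]] ..
  have "snd (S q) (\<lambda>p. \<Omega> p (V p) (X p)) = snd (S q) (\<lambda>p. dJL (bracket P V X) p - snd (V p) (dJL X))"
    by (rule tangent_cong[OF tS W q])
      (simp add: \<Omega>_potential[OF Vs X] tangent_dJL_vertical[OF V _ section_tangent[OF X]])
  also have "\<dots> = snd (S q) (dJL (bracket P V X)) - snd (S q) (\<lambda>p. snd (V p) (dJL X))"
    by (rule tangent_diff[OF tS dJL_smooth[OF b[OF Vs X] q] sm[OF Vs dJL_smooth[OF X q]]])
  finally have 4: "snd (S q) (\<lambda>p. \<Omega> p (V p) (X p)) = \<dots>" .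
  have "snd (X q) (dJL (bracket P S V)) = snd (X q) (\<lambda>p. - snd (V p) L)"
    by (rule tangent_cong[OF tX W q]) (rule dJL_bracket_S[OF V])
  then have 5: "snd (X q) (dJL (bracket P S V)) = - snd (X q) (\<lambda>p. snd (V p) L)"
    using tangent_minus[OF tX sm[OF Vs L[OF q]]] by simp
  have 6: "snd (bracket P S V q) (dJL X) = snd (S q) (\<lambda>p. snd (V p) (dJL X)) - snd (V q) (\<lambda>p. snd (S p) (dJL X))"
    using bracket_antisym[OF W Ss Vs q] anchor_bracket_vertical[OF W V Ss q dJL_smooth[OF X q]] by simp
  have 7: "\<Omega> q (bracket P S V q) (X q) = - snd (S q) (\<lambda>p. snd (V p) (dJL X)) + snd (V q) (\<lambda>p. snd (S p) (dJL X))
      - snd (X q) (\<lambda>p. snd (V p) L) + dJL (bracket P (bracket P S V) X) q"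
    unfolding \<Omega>_potential[OF b[OF Ss Vs] X q] 5 6 by simp
  have 8: "\<Omega> q (V q) (bracket P S X q) = - snd (V q) (dJL (bracket P S X)) + dJL (bracket P V (bracket P S X)) q"
    unfolding \<Omega>_potential[OF Vs b[OF Ss X] q]
    using tangent_dJL_vertical[OF V q section_tangent[OF b[OF Ss X] q]] by simp
  have f: "bracket P V (bracket P S X) q \<in> fibre P q" "bracket P S (bracket P V X) q \<in> fibre P q"
    "bracket P (bracket P S V) X q \<in> fibre P q"
    by (intro section_fibre[OF _ q] b Ss Vs X)+
  have "jacobiator V S X q = bracket P V (bracket P S X) q - bracket P S (bracket P V X) q + bracket P (bracket P S V) X q"
    using bracket_bracket_antisym[OF W Ss X Vs q] bracket_bracket_antisym[OF W X Vs Ss q]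
      bracket_antisym[OF W X b[OF Ss Vs] q] by (simp add: jacobiator_def)
  moreover have "J q (jacobiator V S X q) = 0"
    by (rule J_on_vertical[OF jacobiator_vertical[OF W V Ss X q]])
  ultimately have "J q (bracket P V (bracket P S X) q) - J q (bracket P S (bracket P V X) q) +
      J q (bracket P (bracket P S V) X q) = 0"
    using f by (simp add: J_add J_diff subspace_diff[OF fibre_subspace])
  then have "J q (bracket P S (bracket P V X) q) =
      J q (bracket P V (bracket P S X) q) + J q (bracket P (bracket P S V) X q)"
    by (simp add: algebra_simps)
  then have 9: "dJL (bracket P S (bracket P V X)) q = dJL (bracket P V (bracket P S X)) q + dJL (bracket P (bracket P S V) X) q"
    by simp
  show ?thesis
    unfolding diff1_def anchor_P lie_\<Omega>_def 1 2 3 4 7 8 9 by simp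
qed

end

lemma force_one_form:
  assumes "open W" "\<And>q. q \<in> W \<Longrightarrow> smooth_near \<A> q L"
  shows "one_form P W (force L)"
  unfolding one_form_def
proof (intro conjI allI impI ballI; (elim conjE)?)
  fix q z z' c assume q: "q \<in> W" and z: "z \<in> fibre P q" "z' \<in> fibre P q"
  have S: "S q \<in> fibre P q" using section_fibre[OF S_global] by simp
  show "force L q (z + z') = force L q z + force L q z'"
    by (simp add: force_def diff0_def \<Omega>_add_right[OF S z])
  show "force L q (c *\<^sub>R z) = c * force L q z"
    by (simp add: force_def diff0_def \<Omega>_scale_right[OF S z(1)] scaleR_fun_def right_diff_distrib)
next
  fix U X assume U: "open U" "U \<subseteq> W" "smooth_section P U X"
  show "smooth_fun \<A> U (\<lambda>q. force L q (X q))"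
    unfolding smooth_fun_iff[OF U(1)]
  proof
    fix q assume q: "q \<in> U"
    have Lq: "smooth_near \<A> q L" using assms(2) q U(2) by blast
    have "smooth_near \<A> q (\<lambda>q. \<Omega> q (S q) (X q) -
        snd (X q) (\<lambda>q. snd (J q (S q)) L - L q))"
      by (intro smooth_near_diff \<Omega>_smooth[OF U(1) S_section[OF U(1)] U(3) q] section_apply_smooth[OF U(1,3) q]
          section_apply_smooth[OF U(1) J_section[OF U(1) S_section[OF U(1)]] q] Lq)
    then show "smooth_near \<A> q (\<lambda>q. force L q (X q))" by (simp add: force_def diff0_def lie_fun_def)
  qed
qed

lemma is_minus_diff1_subset: "is_minus_diff1 P U \<omega> \<eta> \<Longrightarrow> W \<subseteq> U \<Longrightarrow> is_minus_diff1 P W \<omega> \<eta>"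
  unfolding is_minus_diff1_def by (meson order_trans)

text \<open>The force is determined by the potential, and it vanishes on the vertical bundle for every
  semispray, so that the only condition left is the one on its differential.\<close>

lemma semi_basic_force_iff:
  assumes W: "open W" and L: "\<And>q. q \<in> W \<Longrightarrow> smooth_near \<A> q L"
    and potential: "is_minus_diff1 P W \<Omega> (pullback J (diff0 P L))"
  shows "(\<exists>\<xi>. semi_basic_force P S J \<Omega> W L \<xi>) \<longleftrightarrow>
    (\<forall>U V X. open U \<and> U \<subseteq> W \<and> vertical_section P U V \<and> smooth_section P U X \<longrightarrow> (\<forall>q\<in>U. lie_\<Omega> V X q = 0))"
    (is "?l \<longleftrightarrow> ?r")
proof
  assume ?l
  then obtain \<xi> where \<xi>: "semi_basic_force P S J \<Omega> W L \<xi>" by blast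
  have eq: "\<xi> q z = force L q z" if "q \<in> W" "z \<in> fibre P q" for q z
    using \<xi> that unfolding semi_basic_force_def force_def by simp
  show ?r
  proof (intro allI impI ballI; elim conjE)
    fix U V X q assume U: "open U" "U \<subseteq> W" "vertical_section P U V" "smooth_section P U X" and q: "q \<in> U"
    note Vs = vertical_sectionD(1)[OF U(3)]
    have eqs: "\<xi> p (Y p) = force L p (Y p)" if "smooth_section P U Y" "p \<in> U" for Y p
      using eq section_fibre[OF that] that(2) U(2) by blast
    have "diff1 P \<xi> V X q = diff1 P (force L) V X q"
      unfolding diff1_def anchor_P eqs[OF bracket_section[OF U(1) Vs U(4)] q]
      by (intro arg_cong2[where f = "(-)"] refl tangent_cong[OF section_tangent[OF Vs q] U(1) q]
          tangent_cong[OF section_tangent[OF U(4) q] U(1) q]) (rule eqs[OF Vs] eqs[OF U(4)]; assumption)+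
    moreover have "diff1 P \<xi> V X q = 0"
      using \<xi> U q unfolding semi_basic_force_def semi_basic2_def by blast
    moreover have "diff1 P (force L) V X q = lie_\<Omega> V X q"
      by (rule diff_force[OF U(1) L is_minus_diff1_subset[OF potential U(2)] U(3,4) q]) (use U(2) in blast)
    ultimately show "lie_\<Omega> V X q = 0" by simp
  qed
next
  assume r: ?r
  have "force L q z = 0" if q: "q \<in> W" and z: "z \<in> vertical P q" for q z
  proof -
    obtain U V where V: "open U" "q \<in> U" "vertical_section P U V" "V q = z"
      using vertical_section_through[OF z] by blast
    have o: "open (U \<inter> W)" using V(1) W by blast
    have "force L q (V q) = 0"
      by (rule force_vertical[OF o L is_minus_diff1_subset[OF potential] vertical_section_subset[OF V(3,1) o]])
        (use q V(2) in auto)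
    then show ?thesis using V(4) by simp
  qed
  moreover have "semi_basic2 P W (diff1 P (force L))"
    unfolding semi_basic2_def
  proof (intro allI impI ballI; elim conjE)
    fix U V X q assume U: "open U" "U \<subseteq> W" "vertical_section P U V" "smooth_section P U X" and q: "q \<in> U"
    have "diff1 P (force L) V X q = lie_\<Omega> V X q"
      by (rule diff_force[OF U(1) L is_minus_diff1_subset[OF potential U(2)] U(3,4) q]) (use U(2) in blast)
    then show "diff1 P (force L) V X q = 0" using r U q by simp
  qed
  ultimately have "semi_basic_force P S J \<Omega> W L (force L)"
    using force_one_form[OF W L] by (simp add: semi_basic_force_def semi_basic1_def force_def)
  then show ?l by blast
qed

subsection \<open>Lagrangian and metric connections\<close>

definition metric_defect where
  "metric_defect V V' q = lie_fun P S (\<lambda>p. g p (V p) (V' p)) q - g q (dyn_derivative P S N V q) (V' q)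
     - g q (V q) (dyn_derivative P S N V' q)"

text \<open>Minus the horizontal projection of \<open>[S, V]\<close>; since
  \<open>J [S, V] = - V\<close>, it is the horizontal \<open>J\<close>-preimage of
  \<open>V\<close>.\<close>

definition lift where
  "lift V q = - ((1/2) *\<^sub>R (bracket P S V q + N q (bracket P S V q)))"

context
  fixes U V
  assumes U: "open U" and V: "vertical_section P U V"
begin

lemma bracket_S_fibre: "q \<in> U \<Longrightarrow> bracket P S V q \<in> fibre P q"
  by (rule section_fibre[OF bracket_section[OF U S_section[OF U] vertical_sectionD(1)[OF V]]])

lemma lift_section: "smooth_section P U (lift V)"
proof -
  note b = bracket_section[OF U S_section[OF U] vertical_sectionD(1)[OF V]]
  have "smooth_section P U (\<lambda>q. N q (bracket P S V q))"
    using N_endomorphism U b unfolding endomorphism_def by blast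
  then show ?thesis
    unfolding lift_def[abs_def]
    by (intro smooth_section_minus smooth_section_scale smooth_section_add U b smooth_near_const)
qed

lemma lift_fibre: "q \<in> U \<Longrightarrow> lift V q \<in> fibre P q"
  by (rule section_fibre[OF lift_section])

lemma J_lift: "q \<in> U \<Longrightarrow> J q (lift V q) = V q"
  using bracket_S_fibre[of q] J_bracket_S[OF U V, of q] N_connectionD(1)[of "bracket P S V q" q] N_connectionD(6)[of "bracket P S V q" q]
    subspace_add[OF fibre_subspace] subspace_scale[OF fibre_subspace]
  by (simp add: lift_def J_minus J_scale J_add scaleR_2[symmetric])

lemma N_lift:
  assumes "q \<in> U"
  shows "N q (lift V q) = lift V q"
proof -
  let ?z = "bracket P S V q + N q (bracket P S V q)"
  have z: "?z \<in> fibre P q" "N q ?z = ?z"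
    using N_connectionD(1,7)[OF bracket_S_fibre[OF assms]] subspace_add[OF fibre_subspace bracket_S_fibre[OF assms]] by auto
  then show ?thesis
    using N_connectionD(3)[OF z(1), of "- (1/2)"] by (simp add: lift_def)
qed

lemma dyn_derivative_vertical: "q \<in> U \<Longrightarrow> dyn_derivative P S N V q \<in> vertical P q"
  using N_connectionD(5)[OF bracket_S_fibre] subspace_scale[OF vertical_subspace] by (simp add: dyn_derivative_def)

lemma bracket_S_split: "bracket P S V q = dyn_derivative P S N V q - lift V q"
proof -
  have "dyn_derivative P S N V q - lift V q = (1/2) *\<^sub>R bracket P S V q + (1/2) *\<^sub>R bracket P S V q"
    by (simp add: dyn_derivative_def lift_def algebra_simps)
  then show ?thesis by (simp add: scaleR_left_distrib[symmetric])
qed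

end

lemma lie_\<Omega>_lift:
  assumes U: "open U" and V: "vertical_section P U V" and V': "vertical_section P U V'" and q: "q \<in> U"
  shows "lie_\<Omega> V (lift V') q = \<Omega> q (lift V q) (lift V' q) - metric_defect V V' q"
proof -
  note D = vertical_sectionD and Ss = S_section[OF U] and X = lift_section[OF U V']
  have VX: "\<Omega> p w (lift V' p) = - g p w (V' p)" if "p \<in> U" "w \<in> vertical P p" for p w
    using metric_eq[OF lift_fibre[OF U V' that(1)] that(2)] J_lift[OF U V' that(1)]
      metric_symmetric[OF that(2) D(2)[OF V' that(1)]]
      \<Omega>_antisym[OF lift_fibre[OF U V' that(1)] vertical_fibre[OF that(2)]] by simp
  have sg: "smooth_near \<A> q (\<lambda>p. g p (V p) (V' p))"
    by (rule smooth_near_cong[OF smooth_near_minus[OF \<Omega>_smooth[OF U D(1)[OF V] X q]] U q])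
      (simp add: VX D(2)[OF V])
  have "snd (S q) (\<lambda>p. \<Omega> p (V p) (lift V' p)) = snd (S q) (\<lambda>p. - g p (V p) (V' p))"
    by (rule tangent_cong[OF section_tangent[OF Ss q] U q]) (simp add: VX D(2)[OF V])
  then have 1: "snd (S q) (\<lambda>p. \<Omega> p (V p) (lift V' p)) = - snd (S q) (\<lambda>p. g p (V p) (V' p))"
    by (simp add: tangent_minus[OF section_tangent[OF Ss q] sg])
  have 2: "\<Omega> q (bracket P S V q) (lift V' q) =
      - g q (dyn_derivative P S N V q) (V' q) - \<Omega> q (lift V q) (lift V' q)"
    unfolding bracket_S_split[OF U V]
    using VX[OF q dyn_derivative_vertical[OF U V q]]
      \<Omega>_diff_left[OF lift_fibre[OF U V' q] vertical_fibre[OF dyn_derivative_vertical[OF U V q]] lift_fibre[OF U V q]]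
    by simp
  have b: "bracket P S (lift V') q \<in> fibre P q" by (rule section_fibre[OF bracket_section[OF U Ss X] q])
  have "bracket P S (\<lambda>p. J p (lift V' p)) q = bracket P S V' q"
    by (rule bracket_cong[OF U Ss D(1)[OF V']]) (auto simp: J_lift[OF U V'] q)
  \<comment> \<open>The section formula for \<open>N\<close> at \<open>lift V'\<close>, solved for
    its \<open>J\<close> term: \<open>N\<close> fixes \<open>lift V'\<close>, and \<open>J\<close>
    sends it to \<open>V'\<close>.\<close>
  then have "J q (bracket P S (lift V') q) = lift V' q + bracket P S V' q"
    using canonical_connection_section[OF U X q] N_lift[OF U V' q] by (simp add: algebra_simps)
  then have "J q (bracket P S (lift V') q) = dyn_derivative P S N V' q"
    by (simp add: bracket_S_split[OF U V'])
  then have 3: "\<Omega> q (V q) (bracket P S (lift V') q) = - g q (V q) (dyn_derivative P S N V' q)"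
    using metric_eq[OF b D(2)[OF V q]] \<Omega>_antisym[OF vertical_fibre[OF D(2)[OF V q]] b]
      metric_symmetric[OF D(2)[OF V q] dyn_derivative_vertical[OF U V' q]] by simp
  show ?thesis
    unfolding lie_\<Omega>_def metric_defect_def lie_fun_def anchor_P 1 2 3 by simp
qed

lemma metric_defect_symmetric:
  assumes U: "open U" and V: "vertical_section P U V" and V': "vertical_section P U V'" and q: "q \<in> U"
  shows "metric_defect V V' q = metric_defect V' V q"
proof -
  note D = vertical_sectionD(2)
  have "snd (S q) (\<lambda>p. g p (V p) (V' p)) = snd (S q) (\<lambda>p. g p (V' p) (V p))"
    by (rule tangent_cong[OF section_tangent[OF S_section[OF U] q] U q]) (simp add: metric_symmetric D[OF V] D[OF V'])
  then show ?thesis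
    using metric_symmetric[OF D[OF V q] dyn_derivative_vertical[OF U V' q]]
      metric_symmetric[OF D[OF V' q] dyn_derivative_vertical[OF U V q]]
    by (simp add: metric_defect_def lie_fun_def)
qed

lemma metric_connection_iff:
  "metric_connection P S g N \<longleftrightarrow>
    (\<forall>U V V'. open U \<and> vertical_section P U V \<and> vertical_section P U V' \<longrightarrow> (\<forall>q\<in>U. metric_defect V V' q = 0))"
  by (simp add: metric_connection_def metric_defect_def)

lemma lagrangian_connectionD:
  assumes "lagrangian_connection P \<Omega> N'" "z \<in> fibre P m" "w \<in> fibre P m" "N' m z = z" "N' m w = w"
  shows "\<Omega> m z w = 0"
proof -
  have "{z \<in> fibre P m. z - N' m z = 0} =
      {z \<in> fibre P m. \<forall>w\<in>{z \<in> fibre P m. z - N' m z = 0}. \<Omega> m z w = 0}"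
    using assms(1) unfolding lagrangian_connection_def lagrangian_subspace_def by blast
  moreover have "z \<in> {z \<in> fibre P m. z - N' m z = 0}" "w \<in> {z \<in> fibre P m. z - N' m z = 0}"
    using assms by auto
  ultimately show ?thesis by blast
qed

text \<open>The difference is vertical because the images under \<open>J\<close> agree, and it is
  fixed by \<open>N\<close>, which is minus the identity on vertical vectors; so it equals its own
  negative.\<close>

lemma horizontal_eq_lift:
  assumes U: "open U" "m \<in> U" and V: "vertical_section P U V" and z: "z \<in> fibre P m" "N m z = z" "J m z = V m"
  shows "z = lift V m"
proof -
  note l = lift_fibre[OF U(1) V U(2)]
  have d: "z - lift V m \<in> fibre P m" by (rule subspace_diff[OF fibre_subspace z(1) l])
  have v: "z - lift V m \<in> vertical P m"
    using J_zero_iff[OF d] J_diff[OF z(1) l] z(3) J_lift[OF U(1) V U(2)] by simp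
  have n: "- lift V m \<in> fibre P m" by (rule subspace_neg[OF fibre_subspace l])
  have "N m (z - lift V m) = z - lift V m"
    using N_connectionD(2)[OF z(1) n] N_connectionD(3)[OF l, of "- 1"] N_lift[OF U(1) V U(2)] z(2) by simp
  then have "z - lift V m = - (z - lift V m)" using N_vertical[OF v] by simp
  from arg_cong[OF this, of "(+) (z - lift V m)"] have "2 *\<^sub>R (z - lift V m) = 0"
    unfolding scaleR_2 by simp
  then show ?thesis by simp
qed

lemma lagrangian_metric_iff:
  "lagrangian_connection P \<Omega> N \<and> metric_connection P S g N \<longleftrightarrow>
    (\<forall>U V X. open U \<and> vertical_section P U V \<and> smooth_section P U X \<longrightarrow> (\<forall>q\<in>U. lie_\<Omega> V X q = 0))"
    (is "?l \<longleftrightarrow> ?r")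
proof
  assume l: ?l
  show ?r
  proof (intro allI impI ballI; elim conjE)
    fix U V X q assume U: "open U" and V: "vertical_section P U V" and X: "smooth_section P U X" and q: "q \<in> U"
    \<comment> \<open>\<open>X\<close> differs from the lift of \<open>J X\<close> by a vertical
      section, on which the Lie derivative of \<open>\<Omega>\<close> against \<open>V\<close>
      vanishes.\<close>
    define V' where "V' p = J p (X p)" for p
    have V': "vertical_section P U V'" unfolding V'_def by (rule J_vertical_section[OF U X])
    note h = lift_section[OF U V']
    have d: "smooth_section P U (\<lambda>p. X p - lift V' p)" by (rule smooth_section_diff[OF U X h])
    have "X p - lift V' p \<in> vertical P p" if "p \<in> U" for p
      using J_zero_iff[OF section_fibre[OF d that]] J_lift[OF U V' that]
        J_diff[OF section_fibre[OF X that] lift_fibre[OF U V' that]] by (simp add: V'_def)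
    then have v: "vertical_section P U (\<lambda>p. X p - lift V' p)" using d by (simp add: vertical_section_def)
    have "lie_\<Omega> V X q = lie_\<Omega> V (lift V') q + lie_\<Omega> V (\<lambda>p. X p - lift V' p) q"
      using lie_\<Omega>_add_right[OF U vertical_sectionD(1)[OF V] h d q] by simp
    also have "\<dots> = \<Omega> q (lift V q) (lift V' q) - metric_defect V V' q"
      using lie_\<Omega>_lift[OF U V V' q] lie_\<Omega>_vertical[OF U V v q] by simp
    also have "\<dots> = 0"
      using lagrangian_connectionD[OF conjunct1[OF l] lift_fibre[OF U V q] lift_fibre[OF U V' q]
          N_lift[OF U V q] N_lift[OF U V' q]] l U V V' q
      unfolding metric_connection_iff by simp
    finally show "lie_\<Omega> V X q = 0" .
  qed
next
  assume r: ?r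
  have *: "metric_defect V V' q = 0 \<and> \<Omega> q (lift V q) (lift V' q) = 0"
    if U: "open U" and V: "vertical_section P U V" and V': "vertical_section P U V'" and q: "q \<in> U" for U V V' q
  proof -
    have "\<Omega> q (lift V q) (lift V' q) = metric_defect V V' q"
      using lie_\<Omega>_lift[OF U V V' q] r U V lift_section[OF U V'] q by simp
    moreover have "\<Omega> q (lift V' q) (lift V q) = metric_defect V' V q"
      using lie_\<Omega>_lift[OF U V' V q] r U V' lift_section[OF U V] q by simp
    ultimately show ?thesis
      using metric_defect_symmetric[OF U V V' q] \<Omega>_antisym[OF lift_fibre[OF U V q] lift_fibre[OF U V' q]] by simp
  qed
  have "metric_connection P S g N" unfolding metric_connection_iff using * by blast
  moreover have "lagrangian_connection P \<Omega> N"
    unfolding lagrangian_connection_def lagrangian_subspace_def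
  proof (intro allI equalityI subsetI)
    fix m z assume z: "z \<in> {z \<in> fibre P m. z - N m z = 0}"
    have "\<Omega> m z w = 0" if w: "w \<in> fibre P m" "w - N m w = 0" for w
    proof -
      obtain U V V' where U: "open U" "m \<in> U" "vertical_section P U V" "vertical_section P U V'"
        "V m = J m z" "V' m = J m w"
        using vertical_sections_through[of "J m z" m "J m w"] J_vertical z w by blast
      then have "z = lift V m" "w = lift V' m"
        using horizontal_eq_lift[OF U(1,2,3), of z] horizontal_eq_lift[OF U(1,2,4), of w] z w by auto
      then show ?thesis using *[OF U(1,3,4,2)] by simp
    qed
    then show "z \<in> {z \<in> fibre P m. \<forall>w\<in>{z \<in> fibre P m. z - N m z = 0}. \<Omega> m z w = 0}" using z by blast
  next
    \<comment> \<open>Maximality of the horizontal space. The vertical part \<open>v\<close> of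
      \<open>z\<close> is orthogonal to vertical vectors, and to horizontal ones because both
      \<open>z\<close> and its horizontal part are; nondegeneracy makes it zero.\<close>
    fix m z assume z: "z \<in> {z \<in> fibre P m. \<forall>w\<in>{z \<in> fibre P m. z - N m z = 0}. \<Omega> m z w = 0}"
    then have zf: "z \<in> fibre P m" by simp
    define v where "v = (1/2) *\<^sub>R (z - N m z)"
    have v: "v \<in> vertical P m" unfolding v_def using N_connectionD(5)[OF zf] by (rule subspace_scale[OF vertical_subspace])
    have hz: "z - v = (1/2) *\<^sub>R (z + N m z)"
    proof -
      have "(1/2) *\<^sub>R (z + N m z) + v = (1/2) *\<^sub>R z + (1/2) *\<^sub>R z" by (simp add: v_def algebra_simps)
      then show ?thesis by (simp add: scaleR_left_distrib[symmetric] algebra_simps)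
    qed
    have horizontal: "(1/2) *\<^sub>R (u + N m u) \<in> fibre P m \<and>
        N m ((1/2) *\<^sub>R (u + N m u)) = (1/2) *\<^sub>R (u + N m u)" if "u \<in> fibre P m" for u
      using N_connectionD(1,7)[OF that] N_connectionD(3)[of "u + N m u" m "1/2"] that subspace_add[OF fibre_subspace]
        subspace_scale[OF fibre_subspace] by simp
    have "\<Omega> m v w = 0" if w: "w \<in> fibre P m" for w
    proof -
      let ?h = "(1/2) *\<^sub>R (w + N m w)" and ?v = "(1/2) *\<^sub>R (w - N m w)"
      have wv: "?v \<in> vertical P m" using N_connectionD(5)[OF w] by (rule subspace_scale[OF vertical_subspace])
      have h: "?h \<in> fibre P m" "N m ?h = ?h" using horizontal[OF w] by auto
      have "?h + ?v = (1/2) *\<^sub>R w + (1/2) *\<^sub>R w" by (simp add: algebra_simps)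
      then have ws: "?h + ?v = w" by (simp add: scaleR_left_distrib[symmetric])
      have "\<Omega> m (z - v) ?h = 0"
      proof -
        obtain U V V' where U: "open U" "m \<in> U" "vertical_section P U V" "vertical_section P U V'"
          "V m = J m (z - v)" "V' m = J m ?h"
          using vertical_sections_through[of "J m (z - v)" m "J m ?h"] J_vertical horizontal[OF zf] h(1) hz by metis
        have "z - v = lift V m" "?h = lift V' m"
          using horizontal_eq_lift[OF U(1,2,3), of "z - v"] horizontal_eq_lift[OF U(1,2,4), of ?h]
            horizontal[OF zf] h U(5,6) hz by simp_all
        then show ?thesis using *[OF U(1,3,4,2)] by simp
      qed
      moreover have "?h - N m ?h = 0" using h(2) by simp
      then have "\<Omega> m z ?h = 0" using z h(1) by blast
      ultimately have "\<Omega> m v ?h = 0" using \<Omega>_diff_left[OF h(1) zf vertical_fibre[OF v]] by simp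
      then show ?thesis
        using \<Omega>_add_right[OF vertical_fibre[OF v] h(1) vertical_fibre[OF wv]] \<Omega>_vertical[OF v wv] ws by simp
    qed
    then have "v = 0" using \<Omega>_nondegenerate[OF vertical_fibre[OF v]] by blast
    then show "z \<in> {z \<in> fibre P m. z - N m z = 0}" using zf by (simp add: v_def)
  qed
  ultimately show ?l by blast
qed

text \<open>Two connections differ by a bundle map \<open>b\<close> on the vertical bundle. If both are metric, then \<open>b\<close>
  is skew; if both are Lagrangian, then \<open>b\<close> is symmetric.\<close>

lemma metric_lagrangian_connection_unique:
  assumes N1: "nonlinear_connection P N1" "lagrangian_connection P \<Omega> N1" "metric_connection P S g N1"
    and N2: "nonlinear_connection P N2" "lagrangian_connection P \<Omega> N2" "metric_connection P S g N2"
    and z: "z \<in> fibre P m"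
  shows "N1 m z = N2 m z"
proof -
  note C1 = nonlinear_connectionD[OF N1(1)] and C2 = nonlinear_connectionD[OF N2(1)]
  have dv: "N1 m u - N2 m u \<in> vertical P m" if u: "u \<in> fibre P m" for u
    using J_zero_iff[OF subspace_diff[OF fibre_subspace C1(1)[OF u] C2(1)[OF u]]]
      J_diff[OF C1(1)[OF u] C2(1)[OF u]] C1(6)[OF u] C2(6)[OF u] by simp
  have sym: "g m (J m u) (N1 m w - N2 m w) = g m (J m w) (N1 m u - N2 m u)"
    if u: "u \<in> fibre P m" and w: "w \<in> fibre P m" for u w
  proof -
    have lag: "\<Omega> m (u + N' m u) (w + N' m w) = 0"
      if "nonlinear_connection P N'" "lagrangian_connection P \<Omega> N'" for N'
      using nonlinear_connectionD(1,7)[OF that(1) u] nonlinear_connectionD(1,7)[OF that(1) w] u w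
        subspace_add[OF fibre_subspace]
      by (intro lagrangian_connectionD[OF that(2)]) auto
    have fu: "u + N2 m u \<in> fibre P m" and fw: "w + N2 m w \<in> fibre P m"
      using u w C2(1) subspace_add[OF fibre_subspace] by auto
    let ?bu = "N1 m u - N2 m u" and ?bw = "N1 m w - N2 m w"
    note bu = dv[OF u] and bw = dv[OF w]
    have expand: "\<Omega> m (a + b) (c + d) = \<Omega> m a c + \<Omega> m a d + (\<Omega> m b c + \<Omega> m b d)"
      if "a \<in> fibre P m" "b \<in> fibre P m" "c \<in> fibre P m" "d \<in> fibre P m" for a b c d
      using that by (simp add: \<Omega>_add_left \<Omega>_add_right subspace_add[OF fibre_subspace])
    have "u + N1 m u = (u + N2 m u) + ?bu" "w + N1 m w = (w + N2 m w) + ?bw" by simp_all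
    then have "\<Omega> m ((u + N2 m u) + ?bu) ((w + N2 m w) + ?bw) = 0" using lag[OF N1(1,2)] by simp
    then have "\<Omega> m (u + N2 m u) ?bw + \<Omega> m ?bu (w + N2 m w) = 0"
      using expand[OF fu vertical_fibre[OF bu] fw vertical_fibre[OF bw]] lag[OF N2(1,2)] \<Omega>_vertical[OF bu bw]
      by linarith
    then have step: "\<Omega> m (u + N2 m u) ?bw = \<Omega> m (w + N2 m w) ?bu"
      using \<Omega>_antisym[OF vertical_fibre[OF bu] fw] by simp
    \<comment> \<open>\<open>u + N2 u\<close> is \<open>2 u\<close> up to a vertical vector, and
      \<open>\<Omega>\<close> vanishes between vertical vectors.\<close>
    have twice: "\<Omega> m (u + N2 m u) y = 2 * g m (J m u) y" if "u \<in> fibre P m" "y \<in> vertical P m" for u y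
    proof -
      have "N2 m u - u \<in> vertical P m"
        using C2(5)[OF that(1)] subspace_neg[OF vertical_subspace] by (metis minus_diff_eq)
      then have "\<Omega> m ((N2 m u - u) + 2 *\<^sub>R u) y = 2 * \<Omega> m u y"
        using that \<Omega>_vertical[OF _ that(2)] subspace_scale[OF fibre_subspace]
        by (simp add: \<Omega>_add_left \<Omega>_scale_left vertical_fibre)
      moreover have "(N2 m u - u) + 2 *\<^sub>R u = u + N2 m u" by (simp add: scaleR_2)
      ultimately show ?thesis using metric_eq[OF that] by simp
    qed
    from twice[OF u bw] twice[OF w bu] step show ?thesis by simp
  qed
  have skew: "g m (N1 m u - N2 m u) (J m w) + g m (J m u) (N1 m w - N2 m w) = 0"
    if u: "u \<in> fibre P m" and w: "w \<in> fibre P m" for u w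
  proof -
    obtain U V V' where U: "open U" "m \<in> U" "vertical_section P U V" "vertical_section P U V'"
      "V m = J m u" "V' m = J m w"
      using vertical_sections_through[OF J_vertical[OF u] J_vertical[OF w]] by blast
    \<comment> \<open>For \<open>x\<close> with \<open>J x = X m\<close>, the sum
      \<open>[S, X] + x\<close> is vertical, where \<open>N1\<close> and \<open>N2\<close> agree; so
      their difference at \<open>[S, X]\<close> is minus their difference at
      \<open>x\<close>.\<close>
    have diff: "dyn_derivative P S N1 X m = dyn_derivative P S N2 X m + (1/2) *\<^sub>R (N1 m x - N2 m x) \<and>
        dyn_derivative P S N2 X m \<in> vertical P m"
      if X: "vertical_section P U X" "X m = J m x" "x \<in> fibre P m" for X x
    proof -
      let ?b = "bracket P S X m"
      have b: "?b \<in> fibre P m" by (rule bracket_S_fibre[OF U(1) X(1) U(2)])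
      have s: "?b + x \<in> vertical P m"
        using J_zero_iff[OF subspace_add[OF fibre_subspace b X(3)]] J_add[OF b X(3)] J_bracket_S[OF U(1) X(1) U(2)] X(2)
        by simp
      have "N1 m ?b + N1 m x = N2 m ?b + N2 m x"
        using C1(4)[OF vertical_fibre[OF s] s] C2(4)[OF vertical_fibre[OF s] s] C1(2)[OF b X(3)] C2(2)[OF b X(3)] by simp
      then have "?b - N1 m ?b = (?b - N2 m ?b) + (N1 m x - N2 m x)" by (simp add: algebra_simps)
      then have "dyn_derivative P S N1 X m = dyn_derivative P S N2 X m + (1/2) *\<^sub>R (N1 m x - N2 m x)"
        by (simp add: dyn_derivative_def scaleR_right_distrib[symmetric] del: scaleR_right_distrib scaleR_right_diff_distrib)
      moreover have "dyn_derivative P S N2 X m \<in> vertical P m"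
        unfolding dyn_derivative_def using C2(5)[OF b] by (rule subspace_scale[OF vertical_subspace])
      ultimately show ?thesis by blast
    qed
    note du = diff[OF U(3,5) u] and dw = diff[OF U(4,6) w]
    note vu = J_vertical[OF u] and vw = J_vertical[OF w]
    have hv: "(1/2) *\<^sub>R (N1 m x - N2 m x) \<in> vertical P m" if "x \<in> fibre P m" for x
      using dv[OF that] by (rule subspace_scale[OF vertical_subspace])
    have "lie_fun P S (\<lambda>q. g q (V q) (V' q)) m
        - g m (dyn_derivative P S N' V m) (V' m) - g m (V m) (dyn_derivative P S N' V' m) = 0"
      if "metric_connection P S g N'" for N'
      using that U(1-4) unfolding metric_connection_def by blast
    from this[OF N1(3)] this[OF N2(3)]
    have "g m (dyn_derivative P S N1 V m) (J m w) + g m (J m u) (dyn_derivative P S N1 V' m) =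
        g m (dyn_derivative P S N2 V m) (J m w) + g m (J m u) (dyn_derivative P S N2 V' m)"
      by (simp add: U(5,6))
    moreover have "g m (dyn_derivative P S N1 V m) (J m w) =
        g m (dyn_derivative P S N2 V m) (J m w) + g m ((1/2) *\<^sub>R (N1 m u - N2 m u)) (J m w)"
      using du metric_add_left[OF _ hv[OF u] vw] by simp
    moreover have "g m (J m u) (dyn_derivative P S N1 V' m) =
        g m (J m u) (dyn_derivative P S N2 V' m) + g m ((1/2) *\<^sub>R (N1 m w - N2 m w)) (J m u)"
      using dw metric_add_left[OF _ hv[OF w] vu] metric_symmetric[OF vu] hv[OF w]
        subspace_add[OF vertical_subspace] by simp
    ultimately have half: "g m ((1/2) *\<^sub>R (N1 m u - N2 m u)) (J m w) + g m ((1/2) *\<^sub>R (N1 m w - N2 m w)) (J m u) = 0"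
      by simp
    \<comment> \<open>The factor 1/2 is removed by additivity of the metric, adding the half to
      itself.\<close>
    have two: "g m ((1/2) *\<^sub>R x) y + g m ((1/2) *\<^sub>R x) y = g m x y"
      if "x \<in> vertical P m" "y \<in> vertical P m" for x y
    proof -
      have "(1/2) *\<^sub>R x \<in> vertical P m" using that(1) by (rule subspace_scale[OF vertical_subspace])
      from metric_add_left[OF this this that(2)] show ?thesis by (simp add: scaleR_left_distrib[symmetric])
    qed
    show ?thesis
      using half two[OF dv[OF u] vw] two[OF dv[OF w] vu] metric_symmetric[OF vu dv[OF w]] by simp
  qed
  have "N1 m z - N2 m z = 0"
  proof (rule metric_nondegenerate[OF dv[OF z]])
    fix w assume w: "w \<in> vertical P m"
    obtain x where x: "x \<in> fibre P m" "J m x = w" using vertical_preimage[OF w] by blast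
    \<comment> \<open>Skewness and symmetry together make this value its own negative; every
      vertical \<open>w\<close> is reached because \<open>J\<close> is onto the vertical
      bundle.\<close>
    show "g m (N1 m z - N2 m z) w = 0"
      using skew[OF z x(1)] sym[OF z x(1)] metric_symmetric[OF dv[OF z] w] x(2) by simp
  qed
  then show ?thesis by simp
qed

end

text \<open>Reading \<open>L\<close> as some potential or as any potential makes no difference,
  since the criterion on the Lie derivative of \<open>\<Omega>\<close> does not involve
  \<open>L\<close>. Both readings are stated; the second lets \<open>\<xi>\<close> live on a smaller
  neighbourhood of the point.\<close>

theorem theorem6p3p1:
  fixes A :: "('k::finite, 'b::t2_space, 'e::real_normed_vector, 'v::real_vector) algebroid"
    and \<A> :: "('p::t2_space, 'e \<times> (real ^ 'k)) atlas"
    and \<pi> :: "'p \<Rightarrow> 'b"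
    and P :: "('k + 'k, 'p, 'e \<times> (real ^ 'k), 'v \<times> 'p tangent) algebroid"
    and S :: "'p \<Rightarrow> 'v \<times> 'p tangent"
    and J :: "'p \<Rightarrow> 'v \<times> 'p tangent \<Rightarrow> 'v \<times> 'p tangent"
    and \<Omega> :: "'p \<Rightarrow> 'v \<times> 'p tangent \<Rightarrow> 'v \<times> 'p tangent \<Rightarrow> real"
    and N\<^sub>S :: "'p \<Rightarrow> 'v \<times> 'p tangent \<Rightarrow> 'v \<times> 'p tangent"
    and g :: "'p \<Rightarrow> 'v \<times> 'p tangent \<Rightarrow> 'v \<times> 'p tangent \<Rightarrow> real"
  assumes connected: "connected (UNIV :: 'b set)"
    and paracompact: "paracompact_space TYPE('b)"
    and algebroid: "pre_lie_algebroid A"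
    and fibred: "fibred_manifold (base_atlas A) \<A> \<pi>"
    and fibres: "\<And>x. connected (\<pi> -` {x})"
    and prolongation: "is_prolongation A \<A> \<pi> P"
    and semispray: "semispray P S"
    and tangent_structure: "almost_tangent_structure P J"
    and compatible: "compatible P S J"
    and cotangent_structure: "almost_cotangent_structure P \<Omega>"
    and semi_hamiltonian: "semi_hamiltonian A \<pi> P J \<Omega>"
    and N\<^sub>S_def: "N\<^sub>S = canonical_connection P S J"
    and g_def: "g = induced_metric P J \<Omega>"
  shows "nonlinear_connection P N\<^sub>S \<and>
    ((lagrangian_connection P \<Omega> N\<^sub>S \<and> metric_connection P S g N\<^sub>S) \<longleftrightarrow>
       (\<forall>m. \<exists>U L \<xi>. m \<in> U \<and> local_potential P J \<Omega> U L \<and>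
          semi_basic_force P S J \<Omega> U L \<xi>)) \<and>
    ((lagrangian_connection P \<Omega> N\<^sub>S \<and> metric_connection P S g N\<^sub>S) \<longleftrightarrow>
       (\<forall>m U L. m \<in> U \<and> local_potential P J \<Omega> U L \<longrightarrow>
          (\<exists>W \<xi>. open W \<and> m \<in> W \<and> W \<subseteq> U \<and> semi_basic_force P S J \<Omega> W L \<xi>))) \<and>
    (lagrangian_connection P \<Omega> N\<^sub>S \<and> metric_connection P S g N\<^sub>S \<longrightarrow>
       (\<forall>N. nonlinear_connection P N \<and> lagrangian_connection P \<Omega> N \<and>
            metric_connection P S g N \<longrightarrow>
            (\<forall>m. \<forall>z\<in>fibre P m. N m z = N\<^sub>S m z)))"
proof -
  have base: "base_atlas P = \<A>" using prolongation by (simp add: is_prolongation_def)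
  obtain \<theta> where \<theta>: "regular_semi_hamiltonian A \<pi> P J \<theta>" "is_minus_diff1 P UNIV \<Omega> (pullback J \<theta>)"
    using semi_hamiltonian unfolding semi_hamiltonian_def by blast
  have \<theta>_form: "one_form P UNIV \<theta>"
    and \<theta>_closed: "open U \<Longrightarrow> vertical_section P U V \<Longrightarrow> vertical_section P U V' \<Longrightarrow> m \<in> U \<Longrightarrow> diff1 P \<theta> V V' m = 0"
    for U V V' m
    using \<theta>(1) unfolding regular_semi_hamiltonian_def by blast+
  interpret dynamics A \<pi> P S J \<Omega> \<theta>
    using algebroid fibred prolongation semispray tangent_structure compatible cotangent_structure \<theta>_form \<theta>_closed \<theta>(2)
    by unfold_locales (simp_all add: base semispray_def)
  define LM where "LM \<longleftrightarrow> lagrangian_connection P \<Omega> N\<^sub>S \<and> metric_connection P S g N\<^sub>S"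
  \<comment> \<open>\<open>Z\<close> no longer mentions \<open>L\<close> or \<open>\<xi>\<close>;
    both characterisations become the question on which open sets it holds.\<close>
  define Z where "Z U \<longleftrightarrow> (\<forall>V X. vertical_section P U V \<and> smooth_section P U X \<longrightarrow> (\<forall>q\<in>U. lie_\<Omega> V X q = 0))" for U
  have LM: "LM \<longleftrightarrow> (\<forall>U. open U \<longrightarrow> Z U)"
    unfolding LM_def N\<^sub>S_def g_def lagrangian_metric_iff Z_def by blast
  have force: "(\<exists>\<xi>. semi_basic_force P S J \<Omega> W L \<xi>) \<longleftrightarrow> (\<forall>U. open U \<and> U \<subseteq> W \<longrightarrow> Z U)"
    if "local_potential P J \<Omega> U L" "open W" "W \<subseteq> U" for U W L
  proof -
    have U: "open U" "\<And>q. q \<in> U \<Longrightarrow> smooth_near (base_atlas P) q L"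
      "is_minus_diff1 P U \<Omega> (pullback J (diff0 P L))"
      using that(1) smooth_fun_iff by (auto simp: local_potential_def)
    show ?thesis
      unfolding Z_def using that(3) U(2)
      by (subst semi_basic_force_iff[OF that(2) _ is_minus_diff1_subset[OF U(3) that(3)]]) blast+
  qed
  \<comment> \<open>The value of \<open>lie_\<Omega>\<close> at \<open>q\<close> is unchanged when
    the sections are regarded over a smaller open set, so \<open>Z\<close> on small sets around
    every point is enough.\<close>
  have local: "LM" if cover: "\<And>m. \<exists>W. open W \<and> m \<in> W \<and> (\<forall>U. open U \<and> U \<subseteq> W \<longrightarrow> Z U)"
    unfolding LM
  proof (intro allI impI)
    fix U :: "'p set" assume U: "open U"
    show "Z U"
      unfolding Z_def
    proof (intro allI impI ballI; elim conjE)
      fix V X q assume V: "vertical_section P U V" and X: "smooth_section P U X" and q: "q \<in> U"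
      obtain W where W: "open W" "q \<in> W" "\<forall>U. open U \<and> U \<subseteq> W \<longrightarrow> Z U" using cover[of q] by (elim exE conjE)
      have o: "open (U \<inter> W)" using U W(1) by blast
      have "Z (U \<inter> W)" using W(3) o by blast
      moreover have "vertical_section P (U \<inter> W) V" by (rule vertical_section_subset[OF V U o Int_lower1])
      moreover have "smooth_section P (U \<inter> W) X" by (rule smooth_section_subset[OF X U o Int_lower1])
      ultimately show "lie_\<Omega> V X q = 0" using q W(2) unfolding Z_def by (meson IntI)
    qed
  qed
  have 1: "LM \<longleftrightarrow> (\<forall>m. \<exists>U L \<xi>. m \<in> U \<and> local_potential P J \<Omega> U L \<and> semi_basic_force P S J \<Omega> U L \<xi>)"
  proof
    assume LM
    show "\<forall>m. \<exists>U L \<xi>. m \<in> U \<and> local_potential P J \<Omega> U L \<and> semi_basic_force P S J \<Omega> U L \<xi>"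
    proof
      fix m
      obtain U L where U: "m \<in> U" "local_potential P J \<Omega> U L" by (rule local_potential_exists)
      then have "open U" by (simp add: local_potential_def)
      then show "\<exists>U L \<xi>. m \<in> U \<and> local_potential P J \<Omega> U L \<and> semi_basic_force P S J \<Omega> U L \<xi>"
        using force[OF U(2) _ order_refl] U \<open>LM\<close> LM by blast
    qed
  next
    assume f: "\<forall>m. \<exists>U L \<xi>. m \<in> U \<and> local_potential P J \<Omega> U L \<and> semi_basic_force P S J \<Omega> U L \<xi>"
    show LM
    proof (rule local)
      fix m
      obtain U L \<xi> where U: "m \<in> U" "local_potential P J \<Omega> U L" "semi_basic_force P S J \<Omega> U L \<xi>" using f by blast
      then have "open U" by (simp add: local_potential_def)
      then show "\<exists>W. open W \<and> m \<in> W \<and> (\<forall>U. open U \<and> U \<subseteq> W \<longrightarrow> Z U)"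
        using force[OF U(2) _ order_refl] U(1,3) by blast
    qed
  qed
  have 2: "LM \<longleftrightarrow> (\<forall>m U L. m \<in> U \<and> local_potential P J \<Omega> U L \<longrightarrow>
      (\<exists>W \<xi>. open W \<and> m \<in> W \<and> W \<subseteq> U \<and> semi_basic_force P S J \<Omega> W L \<xi>))"
  proof
    assume LM
    show "\<forall>m U L. m \<in> U \<and> local_potential P J \<Omega> U L \<longrightarrow>
      (\<exists>W \<xi>. open W \<and> m \<in> W \<and> W \<subseteq> U \<and> semi_basic_force P S J \<Omega> W L \<xi>)"
    proof (intro allI impI; elim conjE)
      fix m U L assume U: "m \<in> U" "local_potential P J \<Omega> U L"
      then have "open U" by (simp add: local_potential_def)
      then show "\<exists>W \<xi>. open W \<and> m \<in> W \<and> W \<subseteq> U \<and> semi_basic_force P S J \<Omega> W L \<xi>"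
        using force[OF U(2) _ order_refl] U(1) \<open>LM\<close> LM by blast
    qed
  next
    assume f: "\<forall>m U L. m \<in> U \<and> local_potential P J \<Omega> U L \<longrightarrow>
      (\<exists>W \<xi>. open W \<and> m \<in> W \<and> W \<subseteq> U \<and> semi_basic_force P S J \<Omega> W L \<xi>)"
    show LM
    proof (rule local)
      fix m
      \<comment> \<open>Existence of a potential keeps the universal condition from being vacuous at
        \<open>m\<close>.\<close>
      obtain U L where U: "m \<in> U" "local_potential P J \<Omega> U L" by (rule local_potential_exists)
      obtain W \<xi> where W: "open W" "m \<in> W" "W \<subseteq> U" "semi_basic_force P S J \<Omega> W L \<xi>"
        using f[rule_format, OF conjI[OF U]] by (elim exE conjE)
      then show "\<exists>W. open W \<and> m \<in> W \<and> (\<forall>U. open U \<and> U \<subseteq> W \<longrightarrow> Z U)"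
        using force[OF U(2) W(1,3)] by blast
    qed
  qed
  have 3: "N m z = N\<^sub>S m z" if "LM" "nonlinear_connection P N" "lagrangian_connection P \<Omega> N"
    "metric_connection P S g N" "z \<in> fibre P m" for N m z
    using metric_lagrangian_connection_unique[OF that(2,3) _ N_connection _ _ that(5)] that(1,4)
    by (simp add: LM_def N\<^sub>S_def g_def)
  show ?thesis
  proof (intro conjI)
    show "nonlinear_connection P N\<^sub>S" unfolding N\<^sub>S_def by (rule N_connection)
    show "lagrangian_connection P \<Omega> N\<^sub>S \<and> metric_connection P S g N\<^sub>S \<longrightarrow>
       (\<forall>N. nonlinear_connection P N \<and> lagrangian_connection P \<Omega> N \<and> metric_connection P S g N \<longrightarrow>
            (\<forall>m. \<forall>z\<in>fibre P m. N m z = N\<^sub>S m z))"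
      using 3 unfolding LM_def by simp
  qed (use 1 2 in \<open>simp_all only: LM_def\<close>)
qed

end
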